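(* There is an absolute constant $C>0$, and for every $c_0\in(0,1)$ there is a constant $K>0$ depending only on $c_0$, such that the following holds. Let $n\ge m\ge 1$, let $p_{ij}\in[0,1]$ for $i\in[n]$, $j\in[m]$, let $A$ be the biadjacency matrix of an inhomogeneous Erdős–Rényi bipartite graph $\mathcal G(n,m,p_{ij})$, and let $\delta\in(0,1)$. With $d,\rho_{\max},\tilde\rho_{\max},\tilde\rho_{\min},\gamma$ as defined in the context, assume that (i) $\gamma\ge c_0$ and $d\ge\gamma^{-1/2}$; (ii) $\tilde\rho_{\max}\ge\rho_{\max}$, $\tilde\rho_{\min}>\sqrt\gamma$, and $\min\{1-\sqrt\gamma,\ \tilde\rho_{\min}-\sqrt\gamma\}\ge c_0$; (iii) $d^{7/2}\max_{ij}p_{ij}\le n^{-1/10}$; (iv) $d\ge C\max\{\delta^{-1/2},\ \delta^{-2}\gamma^{-1}\log n\}$. Then $$\frac1{\sqrt d}\,\mathbb E[\sigma_{\min}(A-\mathbb E A)]\ge\sqrt{(1-\sqrt\gamma)(\tilde\rho_{\min}-\sqrt\gamma)}-K\delta^{1/4}.$$ Moreover, with probability at least $1-Kn^{-3}$, $$\frac1{\sqrt d}\,\sigma_{\min}(A-\mathbb E A)\ge\sqrt{(1-\sqrt\gamma)(\tilde\rho_{\min}-\sqrt\gamma)}-K\delta^{1/4}.$$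
   Context: An inhomogeneous Erdős–Rényi bipartite graph $G\sim\mathcal G(n,m,p_{ij})$ is a random bipartite graph on a vertex set $V_1\cup V_2$ with $|V_1|=n$, $|V_2|=m$, in which each edge $ij$ ($i\in[n]$, $j\in[m]$) is included independently with probability $p_{ij}$. Its biadjacency matrix is $A\in\{0,1\}^{n\times m}$ with $A_{ij}=1$ if $ij$ is an edge and $A_{ij}=0$ otherwise. Notation: $d:=\max\big\{\max_{i\in[n]}\sum_{k=1}^m p_{ik},\ \max_{j\in[m]}\sum_{k=1}^n p_{kj}\big\}$; $\rho_{\max}:=\frac1d\max_{i\in[n]}\sum_{j\in[m]}p_{ij}$; $\tilde\rho_{\max}:=\frac1d\max_{j\in[m]}\sum_{i\in[n]}p_{ij}$; $\tilde\rho_{\min}:=\frac1d\min_{j\in[m]}\sum_{i\in[n]}p_{ij}(1-p_{ij})$; $\gamma:=\rho_{\max}\wedge\tilde\rho_{\max}\in(0,1]$, where $\wedge$ denotes the minimum. For an $n\times m$ matrix with $n\ge m$, $\sigma_{\min}$ denotes its smallest (that is, $m$-th largest) singular value. *)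

theory Defs
  imports
    "HOL-Probability.Probability"
    "Jordan_Normal_Form.Char_Poly"
begin

text \<open>
  The index sets \<open>[n]\<close> and \<open>[m]\<close> are \<open>{..<n}\<close> and \<open>{..<m}\<close>. A bipartite graph on two disjoint
  copies of them is represented by its edge set, a set of pairs \<open>(i, j)\<close> with \<open>i < n\<close>, \<open>j < m\<close>.
  Only the values \<open>p i j\<close> with \<open>i < n\<close>, \<open>j < m\<close> matter.
\<close>

definition inhom_er_bipartite :: "nat \<Rightarrow> nat \<Rightarrow> (nat \<Rightarrow> nat \<Rightarrow> real) \<Rightarrow> (nat \<times> nat) set pmf" where
  "inhom_er_bipartite n m p =
     map_pmf (\<lambda>b. {e. b e})
       (Pi_pmf ({..<n} \<times> {..<m}) False (\<lambda>(i, j). bernoulli_pmf (p i j)))"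

definition biadjacency :: "nat \<Rightarrow> nat \<Rightarrow> (nat \<times> nat) set \<Rightarrow> real mat" where
  "biadjacency n m E = Matrix.mat n m (\<lambda>(i, j). if (i, j) \<in> E then 1 else 0)"

definition expected_biadjacency :: "nat \<Rightarrow> nat \<Rightarrow> (nat \<Rightarrow> nat \<Rightarrow> real) \<Rightarrow> real mat" where
  "expected_biadjacency n m p =
     Matrix.mat n m (\<lambda>(i, j). measure_pmf.expectation (inhom_er_bipartite n m p)
       (\<lambda>E. biadjacency n m E $$ (i, j)))"

text \<open>
  For a real \<open>n \<times> m\<close> matrix \<open>M\<close> with \<open>n \<ge> m\<close>: the \<open>m\<close> singular values, i.e. the square roots of
  the eigenvalues of \<open>M\<^sup>T M\<close> counted with algebraic multiplicity, in decreasing order.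
  For \<open>n < m\<close> this list has \<open>m - n\<close> superfluous zeros at its end.
\<close>

definition singular_values :: "real mat \<Rightarrow> real list" where
  "singular_values M =
     rev (sorted_list_of_multiset
       (image_mset sqrt (proots (char_poly (transpose_mat M * M)))))"

text \<open>The \<open>m\<close>-th largest singular value; list positions start at 0.\<close>

definition sigma_min :: "real mat \<Rightarrow> real" where
  "sigma_min M = singular_values M ! (dim_col M - 1)"

definition row_sum_max :: "nat \<Rightarrow> nat \<Rightarrow> (nat \<Rightarrow> nat \<Rightarrow> real) \<Rightarrow> real" where
  "row_sum_max n m p = Max ((\<lambda>i. \<Sum>j<m. p i j) ` {..<n})"

definition col_sum_max :: "nat \<Rightarrow> nat \<Rightarrow> (nat \<Rightarrow> nat \<Rightarrow> real) \<Rightarrow> real" where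
  "col_sum_max n m p = Max ((\<lambda>j. \<Sum>i<n. p i j) ` {..<m})"

definition deg_max :: "nat \<Rightarrow> nat \<Rightarrow> (nat \<Rightarrow> nat \<Rightarrow> real) \<Rightarrow> real" where
  "deg_max n m p = max (row_sum_max n m p) (col_sum_max n m p)"

definition rho_max :: "nat \<Rightarrow> nat \<Rightarrow> (nat \<Rightarrow> nat \<Rightarrow> real) \<Rightarrow> real" where
  "rho_max n m p = row_sum_max n m p / deg_max n m p"

definition rho_tilde_max :: "nat \<Rightarrow> nat \<Rightarrow> (nat \<Rightarrow> nat \<Rightarrow> real) \<Rightarrow> real" where
  "rho_tilde_max n m p = col_sum_max n m p / deg_max n m p"

definition rho_tilde_min :: "nat \<Rightarrow> nat \<Rightarrow> (nat \<Rightarrow> nat \<Rightarrow> real) \<Rightarrow> real" where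
  "rho_tilde_min n m p =
     Min ((\<lambda>j. \<Sum>i<n. p i j * (1 - p i j)) ` {..<m}) / deg_max n m p"

definition aspect_gamma :: "nat \<Rightarrow> nat \<Rightarrow> (nat \<Rightarrow> nat \<Rightarrow> real) \<Rightarrow> real" where
  "aspect_gamma n m p = min (rho_max n m p) (rho_tilde_max n m p)"

definition prob_max :: "nat \<Rightarrow> nat \<Rightarrow> (nat \<Rightarrow> nat \<Rightarrow> real) \<Rightarrow> real" where
  "prob_max n m p = Max ((\<lambda>(i, j). p i j) ` ({..<n} \<times> {..<m}))"

end

theory Submission
  imports Defs "HOL-Real_Asymp.Real_Asymp"
begin

text \<open>
  Let \<open>H = A - E A\<close>, and let \<open>D1\<close>, \<open>D2\<close> be the diagonal matrices of the row and column sums of the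
  squared entries of \<open>H\<close>. By the Ihara--Bass correspondence, the matrix attached to \<open>H\<close> at the
  spectral parameter \<open>\<i> y\<close> is nonsingular as long as \<open>y\<close> exceeds the spectral radius of the
  nonbacktracking operator of \<open>H\<close>. Letting \<open>y\<close> decrease from infinity, its Schur complement therefore
  stays positive semidefinite, which says that \<open>H\<^sup>T (1 - D1 / y\<^sup>2)\<^sup>-\<^sup>1 H \<ge> D2 - y\<^sup>2\<close> up to small errors.
  By Chernoff bounds, \<open>D1\<close> is at most about \<open>\<gamma> d\<close> and \<open>D2\<close> at least about \<open>d\<close> times the minimal
  column variance ratio, so \<open>y\<^sup>2 = sqrt \<gamma> d (1 + o(1))\<close> gives the claim.

  That this \<open>y\<close> exceeds the spectral radius follows from the trace method: a pair of
  nonbacktracking walks with common ends is a closed walk that backtracks only at its midpoint, and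
  only walks that traverse each edge at least twice have nonzero expectation. Instead of
  enumerating the shapes of such walks, their total weight is bounded step by step, by a function of
  the walk explored so far whose sum over the possible next steps hardly increases.
\<close>

section \<open>Edge statistics of walks\<close>

text \<open>The imaginary parameter is what produces a lower bound: at a real parameter the
  off-diagonal blocks enter the Schur complement with a minus sign and bound \<open>H^T H\<close>
  from above; at \<open>\<i> y\<close> the sign is plus. The scale of \<open>y\<close> comes from
  the growth of walks: two steps multiply the weight by at most (maximal row sum) * (maximal column
  sum) = \<open>\<gamma> d * d\<close>, hence \<open>sqrt \<gamma> d\<close> per step. With
  \<open>y^2\<close> of this size, \<open>1 - D1 / y^2\<close> is about
  \<open>1 - sqrt \<gamma>\<close> and \<open>D2 - y^2\<close> about \<open>d\<close> times (column
  ratio - \<open>sqrt \<gamma>\<close>), whose product is the claimed constant. The obstacle is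
  precision. With \<open>x = \<delta> powr (1/4)\<close>, the radius must be known up to a factor
  \<open>1 + O(x)\<close>, which forces walks of length about \<open>ln n / x\<close>. The growth
  rate per step must then be exact up to \<open>1 + O(1/k)\<close>, although a long walk may revisit
  vertices of high degree many times. Sparsity pays for closing cycles: the cost is of order
  \<open>k^3 * P * s^(-4)\<close> with \<open>s\<close> about \<open>d^(-1/2)\<close> and
  \<open>k\<close> at most about \<open>ln n * d^(1/2)\<close>, which is the origin of the exponent
  7/2.\<close>

definition edge_deg :: "'a set list \<Rightarrow> 'a \<Rightarrow> nat" where
  "edge_deg L v = card {e \<in> set L. v \<in> e}"

definition once_deg :: "'a set list \<Rightarrow> 'a \<Rightarrow> nat" where
  "once_deg L v = card {e \<in> set L. v \<in> e \<and> count_list L e = 1}"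

definition once_edges :: "'a set list \<Rightarrow> nat" where
  "once_edges L = card {e \<in> set L. count_list L e = 1}"

text \<open>A walk standing at a vertex of degree 2 has one way to go on without backtracking along
  old edges. The truncated subtraction makes such vertices, and those of smaller degree, contribute
  nothing, so only surplus choices are counted.\<close>

definition excess :: "'a set \<Rightarrow> 'a set list \<Rightarrow> nat" where
  "excess V L = (\<Sum>v\<in>V. edge_deg L v - 2)"

text \<open>Counts the second traversals still pending at vertices where the walk has a genuine
  choice. An edge between two such vertices is counted at both ends.\<close>

definition branching :: "'a set \<Rightarrow> 'a set list \<Rightarrow> nat" where
  "branching V L = (\<Sum>v\<in>V. if edge_deg L v \<ge> 3 then once_deg L v else 0)"

text \<open>The exponent lets a new edge pay for two traversals in advance: it contributes
  \<open>s^2\<close>, its second traversal contributes 1, and every later one contributes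
  \<open>s\<close>. Once no edge is left with a single traversal, exactly
  \<open>s ^ length L\<close> remains.\<close>

definition edge_weight :: "('a set \<Rightarrow> real) \<Rightarrow> real \<Rightarrow> 'a set list \<Rightarrow> real" where
  "edge_weight p s L = (\<Prod>e\<in>set L. p e) * s ^ (length L + once_edges L)"

lemma once_deg_le_edge_deg: "once_deg L v \<le> edge_deg L v"
  unfolding once_deg_def edge_deg_def by (rule card_mono) auto

lemma count_list_pos_iff: "count_list L e > 0 \<longleftrightarrow> e \<in> set L"
  by (metis count_list_0_iff gr0I less_numeral_extra(3))

lemma edge_deg_new:
  assumes "e \<notin> set L"
  shows "edge_deg (e # L) v = edge_deg L v + (if v \<in> e then 1 else 0)"
proof -
  have "{x \<in> set (e # L). v \<in> x} = (if v \<in> e then insert e {x \<in> set L. v \<in> x} else {x \<in> set L. v \<in> x})"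
    by auto
  thus ?thesis unfolding edge_deg_def using assms by (auto simp: card_insert_if)
qed

lemma once_deg_new:
  assumes "e \<notin> set L"
  shows "once_deg (e # L) v = once_deg L v + (if v \<in> e then 1 else 0)"
proof -
  have "{x \<in> set (e # L). v \<in> x \<and> count_list (e # L) x = 1} =
      (if v \<in> e then insert e {x \<in> set L. v \<in> x \<and> count_list L x = 1}
       else {x \<in> set L. v \<in> x \<and> count_list L x = 1})"
    using assms by (auto simp: count_list_0_iff)
  thus ?thesis unfolding once_deg_def using assms by (auto simp: card_insert_if)
qed

lemma once_edges_new:
  assumes "e \<notin> set L"
  shows "once_edges (e # L) = once_edges L + 1"
proof -
  have "{x \<in> set (e # L). count_list (e # L) x = 1} = insert e {x \<in> set L. count_list L x = 1}"
    using assms by (auto simp: count_list_0_iff)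
  thus ?thesis unfolding once_edges_def using assms by (auto simp: card_insert_if)
qed

lemma edge_weight_new:
  assumes "e \<notin> set L"
  shows "edge_weight p s (e # L) = edge_weight p s L * (p e * s\<^sup>2)"
  unfolding edge_weight_def using assms by (simp add: once_edges_new power2_eq_square)

lemma edge_deg_old:
  assumes "e \<in> set L"
  shows "edge_deg (e # L) v = edge_deg L v"
  using assms by (simp add: edge_deg_def insert_absorb)

lemma once_deg_second:
  assumes "count_list L e = 1"
  shows "once_deg (e # L) v + (if v \<in> e then 1 else 0) = once_deg L v"
proof -
  have e: "e \<in> set L" using assms by (metis count_list_0_iff zero_neq_one)
  have "{x \<in> set L. v \<in> x \<and> count_list L x = 1} =
      (if v \<in> e then insert e {x \<in> set (e # L). v \<in> x \<and> count_list (e # L) x = 1}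
       else {x \<in> set (e # L). v \<in> x \<and> count_list (e # L) x = 1})"
    using assms e by auto
  moreover have "e \<notin> {x \<in> set (e # L). v \<in> x \<and> count_list (e # L) x = 1}"
    using assms by simp
  ultimately show ?thesis unfolding once_deg_def by (simp add: card_insert_if del: set_simps)
qed

lemma once_edges_second:
  assumes "count_list L e = 1"
  shows "once_edges (e # L) + 1 = once_edges L"
proof -
  have e: "e \<in> set L" using assms by (metis count_list_0_iff zero_neq_one)
  have "{x \<in> set L. count_list L x = 1} =
      insert e {x \<in> set (e # L). count_list (e # L) x = 1}"
    using assms e by auto
  moreover have "e \<notin> {x \<in> set (e # L). count_list (e # L) x = 1}"
    using assms by simp
  ultimately show ?thesis unfolding once_edges_def by (simp add: card_insert_if del: set_simps)
qed

lemma edge_weight_second: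
  assumes "count_list L e = 1"
  shows "edge_weight p s (e # L) = edge_weight p s L"
proof -
  have e: "e \<in> set L" using assms by (metis count_list_0_iff zero_neq_one)
  have "length (e # L) + once_edges (e # L) = length L + once_edges L"
    using once_edges_second[OF assms] by simp
  moreover have "set (e # L) = set L" using e by auto
  ultimately show ?thesis unfolding edge_weight_def by (simp only:)
qed

lemma once_deg_later:
  assumes "count_list L e \<ge> 2"
  shows "once_deg (e # L) v = once_deg L v"
proof -
  have "e \<in> set L" using assms by (metis count_list_0_iff not_numeral_le_zero)
  hence "{x \<in> set (e # L). v \<in> x \<and> count_list (e # L) x = 1} = {x \<in> set L. v \<in> x \<and> count_list L x = 1}"
    using assms by auto
  thus ?thesis unfolding once_deg_def by simp
qed

lemma edge_weight_later:
  assumes "count_list L e \<ge> 2"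
  shows "edge_weight p s (e # L) = edge_weight p s L * s"
proof -
  have e: "e \<in> set L" using assms by (metis count_list_0_iff not_numeral_le_zero)
  hence "{x \<in> set (e # L). count_list (e # L) x = 1} = {x \<in> set L. count_list L x = 1}"
    using assms by auto
  hence "once_edges (e # L) = once_edges L" unfolding once_edges_def by simp
  thus ?thesis unfolding edge_weight_def using e by (simp add: insert_absorb)
qed

lemma excess_new:
  assumes "finite V" "u \<noteq> v" "{u, v} \<notin> set L"
  shows "excess V ({u, v} # L) \<le> excess V L
    + (if edge_deg L u \<ge> 2 then 1 else 0) + (if edge_deg L v \<ge> 2 then 1 else 0)"
proof -
  have "excess V ({u, v} # L) \<le> (\<Sum>x\<in>V. (edge_deg L x - 2)
      + (if x = u then (if edge_deg L u \<ge> 2 then 1 else 0) else 0)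
      + (if x = v then (if edge_deg L v \<ge> 2 then 1 else 0) else 0))"
    unfolding excess_def by (rule sum_mono) (use assms in \<open>auto simp: edge_deg_new\<close>)
  also have "\<dots> = excess V L + (if u \<in> V then (if edge_deg L u \<ge> 2 then 1 else 0) else 0)
     + (if v \<in> V then (if edge_deg L v \<ge> 2 then 1 else 0) else 0)"
    unfolding excess_def by (simp add: sum.distrib sum.delta assms(1))
  also have "\<dots> \<le> excess V L
    + (if edge_deg L u \<ge> 2 then 1 else 0) + (if edge_deg L v \<ge> 2 then 1 else 0)"
    by auto
  finally show ?thesis .
qed

text \<open>The 3 is attained when an endpoint passes from degree 2 to degree 3: all of its edges
  start to count at that moment. At an endpoint of degree at least 3 only the new edge is
  added.\<close>

lemma branching_new:
  assumes "finite V" "u \<noteq> v" "{u, v} \<notin> set L"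
  shows "branching V ({u, v} # L) \<le> branching V L
    + (if edge_deg L u \<ge> 2 then 3 else 0) + (if edge_deg L v \<ge> 2 then 3 else 0)"
proof -
  have "branching V ({u, v} # L) \<le> (\<Sum>x\<in>V. (if edge_deg L x \<ge> 3 then once_deg L x else 0)
      + (if x = u then (if edge_deg L u \<ge> 2 then 3 else 0) else 0)
      + (if x = v then (if edge_deg L v \<ge> 2 then 3 else 0) else 0))"
    unfolding branching_def
  proof (rule sum_mono)
    fix x
    have "once_deg L x \<le> edge_deg L x" by (rule once_deg_le_edge_deg)
    thus "(if 3 \<le> edge_deg ({u, v} # L) x then once_deg ({u, v} # L) x else 0)
        \<le> (if edge_deg L x \<ge> 3 then once_deg L x else 0)
      + (if x = u then (if edge_deg L u \<ge> 2 then 3 else 0) else 0)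
      + (if x = v then (if edge_deg L v \<ge> 2 then 3 else 0) else 0)"
      using assms by (auto simp: edge_deg_new once_deg_new)
  qed
  also have "\<dots> = branching V L + (if u \<in> V then (if edge_deg L u \<ge> 2 then 3 else 0) else 0)
     + (if v \<in> V then (if edge_deg L v \<ge> 2 then 3 else 0) else 0)"
    unfolding branching_def by (simp add: sum.distrib sum.delta assms(1))
  also have "\<dots> \<le> branching V L
    + (if edge_deg L u \<ge> 2 then 3 else 0) + (if edge_deg L v \<ge> 2 then 3 else 0)"
    by auto
  finally show ?thesis .
qed

lemma excess_old:
  assumes "e \<in> set L"
  shows "excess V (e # L) = excess V L"
  unfolding excess_def using assms by (simp add: edge_deg_old)

lemma branching_old:
  assumes "e \<in> set L"
  shows "branching V (e # L) \<le> branching V L"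
  unfolding branching_def
proof (rule sum_mono)
  fix x
  have "count_list L e = 1 \<or> count_list L e \<ge> 2"
    using assms count_list_pos_iff[of L e] by linarith
  hence "once_deg (e # L) x \<le> once_deg L x"
    using once_deg_second[of L e x] once_deg_later[of L e x] by (auto split: if_splits)
  thus "(if 3 \<le> edge_deg (e # L) x then once_deg (e # L) x else 0)
     \<le> (if 3 \<le> edge_deg L x then once_deg L x else 0)"
    using assms by (simp add: edge_deg_old)
qed

lemma branching_second:
  assumes "finite V" "u \<in> V" "u \<in> e" "edge_deg L u \<ge> 3" "count_list L e = 1"
  shows "branching V (e # L) + 1 \<le> branching V L"
proof -
  have e: "e \<in> set L" using assms by (metis count_list_0_iff zero_neq_one)
  have "branching V (e # L) < branching V L"
    unfolding branching_def
  proof (rule sum_strict_mono_ex1)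
    show "finite V" by fact
    show "\<forall>x\<in>V. (if 3 \<le> edge_deg (e # L) x then once_deg (e # L) x else 0)
         \<le> (if 3 \<le> edge_deg L x then once_deg L x else 0)"
    proof
      fix x show "(if 3 \<le> edge_deg (e # L) x then once_deg (e # L) x else 0)
         \<le> (if 3 \<le> edge_deg L x then once_deg L x else 0)"
        using once_deg_second[OF assms(5), of x] e by (simp add: edge_deg_old)
    qed
    show "\<exists>a\<in>V. (if 3 \<le> edge_deg (e # L) a then once_deg (e # L) a else 0)
        < (if 3 \<le> edge_deg L a then once_deg L a else 0)"
      using once_deg_second[OF assms(5), of u] e assms by (intro bexI[of _ u]) (auto simp: edge_deg_old)
  qed
  thus ?thesis by simp
qed

lemma edge_deg_le_excess:
  assumes "finite V" "u \<in> V"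
  shows "edge_deg L u \<le> 2 + excess V L"
proof -
  have "edge_deg L u - 2 \<le> excess V L"
    unfolding excess_def using assms by (intro member_le_sum) auto
  thus ?thesis by simp
qed

section \<open>The edge sequence of a walk, newest vertex and newest edge first\<close>

fun walk_edges :: "'a list \<Rightarrow> 'a set list" where
  "walk_edges (v # u # xs) = {v, u} # walk_edges (u # xs)"
| "walk_edges _ = []"

lemma walk_edges_Cons:
  "xs \<noteq> [] \<Longrightarrow> walk_edges (v # xs) = {v, hd xs} # walk_edges xs"
  by (cases xs) auto

lemma length_walk_edges: "length (walk_edges xs) = length xs - 1"
  by (induction xs rule: walk_edges.induct) auto

lemma walk_edges_subset: "e \<in> set (walk_edges xs) \<Longrightarrow> e \<subseteq> set xs"
  by (induction xs rule: walk_edges.induct) auto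

lemma edge_deg_notin: "v \<notin> set xs \<Longrightarrow> edge_deg (walk_edges xs) v = 0"
  unfolding edge_deg_def using walk_edges_subset[of _ xs] by (auto simp: card_eq_0_iff)

lemma edge_deg_fresh_hd:
  assumes "u \<notin> set ys"
  shows "edge_deg (walk_edges (u # ys)) u \<le> 1"
proof (cases ys)
  case Nil thus ?thesis by (simp add: edge_deg_def)
next
  case (Cons a zs)
  have "{e \<in> set (walk_edges (u # ys)). u \<in> e} \<subseteq> {{u, a}}"
    using assms walk_edges_subset[of _ ys] Cons by auto
  hence "card {e \<in> set (walk_edges (u # ys)). u \<in> e} \<le> card {{u, a}}" by (intro card_mono) auto
  thus ?thesis by (simp add: edge_deg_def)
qed

text \<open>The only edge at a vertex just discovered is the one through which it was reached. A
  nonbacktracking step from such a vertex therefore uses a new edge.\<close>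

lemma fresh_edge_cases:
  assumes "u \<notin> set ys" "u \<noteq> v" "{v, u} \<in> set (walk_edges (u # ys))"
  shows "ys \<noteq> [] \<and> v = hd ys"
proof (cases ys)
  case Nil thus ?thesis using assms by simp
next
  case (Cons a zs)
  have "{v, u} \<notin> set (walk_edges ys)" using walk_edges_subset[of "{v,u}" ys] assms by auto
  hence "{v, u} = {u, a}" using assms Cons by simp
  thus ?thesis using assms Cons by (auto simp: doubleton_eq_iff)
qed

section \<open>Weighted count of doubled walks\<close>

text \<open>The step after \<open>k\<close> edges is forced to backtrack, all others must not. Walks
  need not be closed; that property is not recorded. For \<open>k = 0\<close> the turn would refer
  to \<open>hd []\<close>, whence \<open>0 < k\<close> in the results below.\<close>

fun turn_walks :: "'a set \<Rightarrow> nat \<Rightarrow> nat \<Rightarrow> 'a list set" where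
  "turn_walks V k 0 = (\<lambda>v. [v]) ` V"
| "turn_walks V k (Suc t) = (\<Union>xs\<in>turn_walks V k t. (\<lambda>v. v # xs) `
     {v\<in>V. v \<noteq> hd xs \<and> (if t = k then v = hd (tl xs) else tl xs \<noteq> [] \<longrightarrow> v \<noteq> hd (tl xs))})"

lemma turn_walksD:
  assumes "xs \<in> turn_walks V k t"
  shows "length xs = Suc t" "set xs \<subseteq> V" "tl xs \<noteq> [] \<longrightarrow> hd xs \<noteq> hd (tl xs)"
  using assms by (induction t arbitrary: xs) (fastforce+)

lemma finite_turn_walks: "finite V \<Longrightarrow> finite (turn_walks V k t)"
  by (induction t) auto

lemma sum_turn_walks_Suc:
  assumes "finite V"
  shows "(\<Sum>xs\<in>turn_walks V k (Suc t). F xs) = (\<Sum>xs\<in>turn_walks V k t. \<Sum>v\<in>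
     {v\<in>V. v \<noteq> hd xs \<and> (if t = k then v = hd (tl xs) else tl xs \<noteq> [] \<longrightarrow> v \<noteq> hd (tl xs))}. F (v # xs))"
proof -
  let ?N = "\<lambda>xs. {v\<in>V. v \<noteq> hd xs \<and> (if t = k then v = hd (tl xs) else tl xs \<noteq> [] \<longrightarrow> v \<noteq> hd (tl xs))}"
  have "(\<Sum>xs\<in>turn_walks V k (Suc t). F xs) = (\<Sum>xs\<in>turn_walks V k t. \<Sum>ys\<in>(\<lambda>v. v # xs) ` ?N xs. F ys)"
    unfolding turn_walks.simps by (rule sum.UNION_disjoint) (use assms finite_turn_walks in auto)
  also have "\<dots> = (\<Sum>xs\<in>turn_walks V k t. \<Sum>v\<in>?N xs. F (v # xs))"
    by (intro sum.cong refl) (subst sum.reindex, auto simp: inj_on_def)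
  finally show ?thesis .
qed

text \<open>
  \<open>potential r xs\<close> bounds the total weight of all continuations of the walk \<open>xs\<close> by \<open>r\<close> further
  steps. As long as the walk discovers new vertices it pays the small factor \<open>\<alpha>\<close>: such an excursion
  has to end with an edge that closes a cycle, which is expensive. At a vertex of degree at most 2
  a walk along old edges has no choice; at other vertices its choices are paid for by \<open>branching\<close>
  (second traversal of an edge) or by the factor \<open>s\<close> (later traversals).
\<close>

locale walk_potential =
  fixes V :: "'a set" and p :: "'a set \<Rightarrow> real" and f :: "'a \<Rightarrow> real"
    and s c \<alpha> \<mu> P :: real and T :: nat
  assumes fin: "finite V"
    and p_nonneg: "0 \<le> p e" and p_le: "p e \<le> P"
    and f_ge: "u \<in> V \<Longrightarrow> c \<le> f u" and f_le: "u \<in> V \<Longrightarrow> f u \<le> 1"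
    and c_pos: "0 < c" and s_pos: "0 < s" and s_le: "s \<le> 1"
    and \<alpha>_pos: "0 < \<alpha>" and \<mu>_ge: "1 \<le> \<mu>" and c\<alpha>: "c * \<alpha> \<le> 1"
    and subharmonic: "u \<in> V \<Longrightarrow> s\<^sup>2 * (\<Sum>v\<in>V. p {v, u} * f v) \<le> f u"
    and close_cycle: "T * P * exp (s * T) / s \<le> (\<mu> - 1) * \<alpha> * c"
    and leave_old: "\<alpha> * exp (s * T) / s ^ 3 + T * P * (exp (s * T))\<^sup>2 / s ^ 4 \<le> \<mu> - 1"
begin

text \<open>The exponential is a credit for the \<open>r\<close> steps still to come: each of them
  may meet a vertex with up to \<open>1 + excess V L\<close> choices, each of relative cost
  \<open>s\<close>, that is, a factor of at most \<open>exp (s * excess V L)\<close>. The power of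
  \<open>1 / s\<close> is the credit returned at second traversals.\<close>

definition core :: "nat \<Rightarrow> 'a set list \<Rightarrow> real" where
  "core r L = edge_weight p s L * exp (s * r * excess V L) * (1 / s) ^ branching V L"

definition mode :: "'a list \<Rightarrow> real" where
  "mode xs = (if hd xs \<in> set (tl xs) then 1 else \<alpha> * f (hd xs))"

definition potential :: "nat \<Rightarrow> 'a list \<Rightarrow> real" where
  "potential r xs = core r (walk_edges xs) * \<mu> ^ r * mode xs"

lemma P_nonneg: "0 \<le> P" using p_nonneg p_le order_trans by blast

lemma edge_weight_nonneg: "0 \<le> edge_weight p s L"
  unfolding edge_weight_def using p_nonneg s_pos by (intro mult_nonneg_nonneg prod_nonneg) auto

lemma core_nonneg: "0 \<le> core r L"
  unfolding core_def using edge_weight_nonneg s_pos by (intro mult_nonneg_nonneg) auto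

lemma core_Suc: "core (Suc r) L = core r L * exp (s * excess V L)"
  unfolding core_def by (simp add: algebra_simps exp_add)

lemma core_mono: "core r L \<le> core (Suc r) L"
  unfolding core_Suc using mult_left_mono[OF _ core_nonneg, of 1 "exp (s * excess V L)" r L] s_pos by simp

text \<open>\<open>j\<close> bounds the number of endpoints that already have degree at least 2.
  Each of them may raise \<open>excess\<close> by 1, at the price \<open>exp (s * T)\<close>, and
  \<open>branching\<close> by 3, at the price \<open>1 / s ^ 3\<close>.\<close>

lemma core_new:
  assumes "r \<le> T" "u \<noteq> v" "{v, u} \<notin> set L"
    and j: "(if edge_deg L u \<ge> 2 then 1 else 0) + (if edge_deg L v \<ge> 2 then 1 else 0) \<le> (j::nat)"
  shows "core r ({v, u} # L) \<le> core r L * (p {v, u} * s\<^sup>2 * (exp (s * T) / s ^ 3) ^ j)"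
proof -
  have sj: "excess V ({v, u} # L) \<le> excess V L + j" "branching V ({v, u} # L) \<le> branching V L + 3 * j"
    using excess_new[OF fin, of v u L] branching_new[OF fin, of v u L] assms j by (auto split: if_splits)
  have "real r * excess V ({v, u} # L) \<le> real r * (excess V L + j)"
    using sj(1) by (intro mult_left_mono) (auto simp flip: of_nat_add)
  also have "\<dots> = r * excess V L + real r * real j"
    by (simp add: algebra_simps)
  also have "\<dots> \<le> r * excess V L + T * real j"
    using assms(1) by (intro add_left_mono mult_right_mono) auto
  finally have "s * (real r * excess V ({v, u} # L)) \<le> s * (r * excess V L + T * real j)"
    using s_pos by simp
  hence "exp (s * r * excess V ({v, u} # L)) \<le> exp (s * r * excess V L + j * (s * T))"
    by (simp add: algebra_simps)
  also have "\<dots> = exp (s * r * excess V L) * exp (s * T) ^ j"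
    by (simp add: exp_add exp_of_nat_mult)
  finally have 1: "exp (s * r * excess V ({v, u} # L)) \<le> exp (s * r * excess V L) * exp (s * T) ^ j" .
  have 2: "(1 / s) ^ branching V ({v, u} # L) \<le> (1 / s) ^ (branching V L + 3 * j)"
    using sj(2) s_pos s_le by (intro power_increasing) auto
  have "core r ({v, u} # L) \<le> (edge_weight p s L * (p {v, u} * s\<^sup>2))
     * (exp (s * r * excess V L) * exp (s * T) ^ j) * (1 / s) ^ (branching V L + 3 * j)"
    unfolding core_def edge_weight_new[OF assms(3)]
    by (intro mult_mono 1 2 order.refl) (use edge_weight_nonneg p_nonneg s_pos in auto)
  also have "\<dots> = core r L * (p {v, u} * s\<^sup>2 * (exp (s * T) / s ^ 3) ^ j)"
    unfolding core_def by (simp add: power_add power_mult power_divide)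
  finally show ?thesis .
qed

lemma core_old:
  assumes "e \<in> set L"
  shows "core r (e # L) \<le> core r L"
proof -
  have "count_list L e = 1 \<or> count_list L e \<ge> 2"
    using assms count_list_pos_iff[of L e] by linarith
  hence "edge_weight p s (e # L) \<le> edge_weight p s L"
    using edge_weight_second[of L e p s] edge_weight_later[of L e p s]
      mult_left_mono[OF s_le edge_weight_nonneg[of L]] by auto
  thus ?thesis unfolding core_def excess_old[OF assms]
    using branching_old[OF assms, of V] s_pos s_le edge_weight_nonneg
    by (intro mult_mono power_increasing) auto
qed

lemma core_old_branch:
  assumes "e \<in> set L" "u \<in> V" "u \<in> e" "edge_deg L u \<ge> 3"
  shows "core r (e # L) \<le> s * core r L"
proof -
  consider "count_list L e = 1" | "count_list L e \<ge> 2"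
    using assms count_list_pos_iff[of L e] by linarith
  thus ?thesis
  proof cases
    case 1
    from branching_second[OF fin assms(2-4) 1]
    have "s * (1 / s) ^ Suc (branching V (e # L)) \<le> s * (1 / s) ^ branching V L"
      using s_pos s_le by (intro mult_left_mono power_increasing) auto
    hence "(1 / s) ^ branching V (e # L) \<le> s * (1 / s) ^ branching V L"
      using s_pos by simp
    hence "edge_weight p s L * exp (s * r * excess V L) * (1 / s) ^ branching V (e # L)
        \<le> edge_weight p s L * exp (s * r * excess V L) * (s * (1 / s) ^ branching V L)"
      using edge_weight_nonneg by (intro mult_left_mono) auto
    thus ?thesis unfolding core_def excess_old[OF assms(1)] edge_weight_second[OF 1]
      by (simp only: mult_ac)
  next
    case 2
    have "edge_weight p s L * s * exp (s * r * excess V L) * (1 / s) ^ branching V (e # L)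
        \<le> edge_weight p s L * s * exp (s * r * excess V L) * (1 / s) ^ branching V L"
      using branching_old[OF assms(1), of V] s_pos s_le edge_weight_nonneg
      by (intro mult_left_mono power_increasing) auto
    thus ?thesis unfolding core_def excess_old[OF assms(1)] edge_weight_later[OF 2]
      by (simp only: mult_ac)
  qed
qed

lemma mode_pos: "xs \<noteq> [] \<Longrightarrow> set xs \<subseteq> V \<Longrightarrow> c * \<alpha> \<le> mode xs"
  unfolding mode_def using c\<alpha> f_ge[of "hd xs"] \<alpha>_pos by (auto simp: mult.commute mult_left_mono subset_eq)

lemma potential_nonneg: "xs \<noteq> [] \<Longrightarrow> set xs \<subseteq> V \<Longrightarrow> 0 \<le> potential r xs"
  unfolding potential_def using core_nonneg \<mu>_ge mode_pos[of xs] c_pos \<alpha>_pos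
  by (intro mult_nonneg_nonneg) (auto intro: order_trans[of 0 "c * \<alpha>"])

lemma f_nonneg: "v \<in> V \<Longrightarrow> 0 \<le> f v"
  using f_ge[of v] c_pos by simp

lemma sum_visited:
  assumes "length (u # ys) \<le> T" "0 \<le> b"
  shows "(\<Sum>v\<in>V. if v \<in> set (u # ys) then p {v, u} * b else 0) \<le> T * P * b"
proof -
  have "(\<Sum>v\<in>V. if v \<in> set (u # ys) then p {v, u} * b else 0) = (\<Sum>v\<in>V \<inter> set (u # ys). p {v, u} * b)"
    using fin by (simp add: sum.inter_restrict)
  also have "\<dots> \<le> real (card (V \<inter> set (u # ys))) * (P * b)"
    using p_le assms(2) by (intro sum_bounded_above mult_right_mono)
  also have "\<dots> \<le> T * (P * b)"
  proof (intro mult_right_mono)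
    have "card (V \<inter> set (u # ys)) \<le> card (set (u # ys))" by (intro card_mono) auto
    also have "\<dots> \<le> T" using card_length[of "u # ys"] assms(1) by linarith
    finally show "real (card (V \<inter> set (u # ys))) \<le> T" by simp
  qed (use P_nonneg assms in auto)
  finally show ?thesis by (simp add: mult.assoc)
qed

text \<open>The next edge is necessarily new. Fresh targets reproduce \<open>\<alpha> * f u\<close>
  by \<open>subharmonic\<close>. A visited target loses the factor \<open>\<alpha>\<close>, but
  there are at most \<open>T\<close> of them, and \<open>close_cycle\<close> charges them to the
  part \<open>\<mu> - 1\<close> of the growth factor.\<close>

lemma step_fresh:
  assumes u: "u \<in> V" "u \<notin> set ys" and len: "length (u # ys) \<le> T" and r: "r \<le> T"
  shows "(\<Sum>v\<in>{v\<in>V. v \<noteq> u \<and> (ys \<noteq> [] \<longrightarrow> v \<noteq> hd ys)}. potential r (v # u # ys)) \<le> potential (Suc r) (u # ys)"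
proof -
  define L where "L = walk_edges (u # ys)"
  let ?S = "{v\<in>V. v \<noteq> u \<and> (ys \<noteq> [] \<longrightarrow> v \<noteq> hd ys)}"
  let ?b = "exp (s * T) / s"
  have du: "edge_deg L u \<le> 1" unfolding L_def by (rule edge_deg_fresh_hd) fact
  have "(\<Sum>v\<in>?S. potential r (v # u # ys))
     \<le> (\<Sum>v\<in>?S. core r L * \<mu> ^ r * (\<alpha> * s\<^sup>2 * (p {v, u} * f v)
           + (if v \<in> set (u # ys) then p {v, u} * ?b else 0)))"
  proof (rule sum_mono)
    fix v assume v: "v \<in> ?S"
    have new: "{v, u} \<notin> set L"
      using fresh_edge_cases[OF u(2), of v] v unfolding L_def by auto
    show "potential r (v # u # ys) \<le> core r L * \<mu> ^ r * (\<alpha> * s\<^sup>2 * (p {v, u} * f v)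
           + (if v \<in> set (u # ys) then p {v, u} * ?b else 0))"
    proof (cases "v \<in> set (u # ys)")
      case True
      \<comment> \<open>The current vertex has degree at most 1, so only \<open>v\<close> can count,
        and the exponent is 1 instead of 2.\<close>
      have "core r ({v, u} # L) \<le> core r L * (p {v, u} * s\<^sup>2 * (exp (s * T) / s ^ 3) ^ 1)"
        by (rule core_new) (use r v new du in auto)
      also have "p {v, u} * s\<^sup>2 * (exp (s * T) / s ^ 3) ^ 1 = p {v, u} * ?b"
        using s_pos by (simp add: field_simps power2_eq_square power3_eq_cube)
      also have "core r L * (p {v, u} * ?b) \<le> core r L * (\<alpha> * s\<^sup>2 * (p {v, u} * f v) + p {v, u} * ?b)"
        using f_nonneg[of v] v \<alpha>_pos p_nonneg core_nonneg by (intro mult_left_mono) auto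
      finally have "core r ({v, u} # L) * \<mu> ^ r
          \<le> core r L * (\<alpha> * s\<^sup>2 * (p {v, u} * f v) + p {v, u} * ?b) * \<mu> ^ r"
        using \<mu>_ge by (intro mult_right_mono) auto
      thus ?thesis using True by (simp add: potential_def mode_def L_def mult_ac)
    next
      case False
      hence dv: "edge_deg L v = 0" unfolding L_def by (intro edge_deg_notin) auto
      have "core r ({v, u} # L) \<le> core r L * (p {v, u} * s\<^sup>2 * (exp (s * T) / s ^ 3) ^ 0)"
        by (rule core_new) (use r v new du dv in auto)
      hence "core r ({v, u} # L) * (\<mu> ^ r * (\<alpha> * f v)) \<le> core r L * (p {v, u} * s\<^sup>2) * (\<mu> ^ r * (\<alpha> * f v))"
        using \<mu>_ge \<alpha>_pos f_nonneg[of v] v by (intro mult_right_mono) auto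
      thus ?thesis using False by (simp add: potential_def mode_def L_def mult_ac)
    qed
  qed
  also have "\<dots> \<le> (\<Sum>v\<in>V. core r L * \<mu> ^ r * (\<alpha> * s\<^sup>2 * (p {v, u} * f v)
           + (if v \<in> set (u # ys) then p {v, u} * ?b else 0)))"
    using fin core_nonneg \<mu>_ge \<alpha>_pos p_nonneg f_nonneg s_pos
    by (intro sum_mono2 mult_nonneg_nonneg add_nonneg_nonneg) auto
  also have "\<dots> = core r L * \<mu> ^ r * (\<alpha> * (s\<^sup>2 * (\<Sum>v\<in>V. p {v, u} * f v))
           + (\<Sum>v\<in>V. if v \<in> set (u # ys) then p {v, u} * ?b else 0))"
    unfolding sum_distrib_left[symmetric] sum.distrib by (simp add: sum_distrib_left mult_ac)
  also have "\<dots> \<le> core r L * \<mu> ^ r * (\<alpha> * f u + (\<mu> - 1) * \<alpha> * f u)"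
  proof (intro mult_left_mono add_mono)
    have "(\<Sum>v\<in>V. if v \<in> set (u # ys) then p {v, u} * ?b else 0) \<le> T * P * ?b"
      by (rule sum_visited) (use len s_pos in auto)
    also have "\<dots> \<le> (\<mu> - 1) * \<alpha> * c" using close_cycle by simp
    also have "\<dots> \<le> (\<mu> - 1) * \<alpha> * f u"
      using f_ge[OF u(1)] \<mu>_ge \<alpha>_pos by (intro mult_left_mono) auto
    finally show "(\<Sum>v\<in>V. if v \<in> set (u # ys) then p {v, u} * ?b else 0) \<le> (\<mu> - 1) * \<alpha> * f u" .
  qed (use subharmonic[OF u(1)] \<alpha>_pos core_nonneg \<mu>_ge in auto)
  also have "\<dots> = core r L * (\<mu> ^ Suc r * (\<alpha> * f u))" by (simp add: algebra_simps)
  also have "\<dots> \<le> core (Suc r) L * (\<mu> ^ Suc r * (\<alpha> * f u))"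
    using core_mono \<mu>_ge \<alpha>_pos f_nonneg[OF u(1)] by (intro mult_right_mono) auto
  also have "\<dots> = potential (Suc r) (u # ys)"
    using u by (simp add: potential_def mode_def L_def)
  finally show ?thesis .
qed

text \<open>Old edges are the main term: at most \<open>1 + excess V L\<close> of them at relative
  cost \<open>s\<close> when the degree is at least 3, and a single one at cost 1 otherwise. In both
  cases the total is at most \<open>exp (s * excess V L)\<close>, which is exactly the growth of
  \<open>core\<close> from \<open>r\<close> to \<open>Suc r\<close>. New edges, to fresh or to
  visited vertices, fit into \<open>\<mu> - 1\<close> by \<open>leave_old\<close>.\<close>

lemma step_old:
  assumes u: "u \<in> V" "u \<in> set ys" and len: "length (u # ys) \<le> T" and r: "r \<le> T"
  shows "(\<Sum>v\<in>{v\<in>V. v \<noteq> u \<and> (ys \<noteq> [] \<longrightarrow> v \<noteq> hd ys)}. potential r (v # u # ys)) \<le> potential (Suc r) (u # ys)"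
proof -
  define L where "L = walk_edges (u # ys)"
  have ys: "ys \<noteq> []" using u by auto
  let ?S = "{v\<in>V. v \<noteq> u \<and> (ys \<noteq> [] \<longrightarrow> v \<noteq> hd ys)}"
  let ?b = "exp (s * T) / s ^ 3"
  let ?q = "if edge_deg L u \<ge> 3 then s else 1"
  have "(\<Sum>v\<in>?S. potential r (v # u # ys))
     \<le> (\<Sum>v\<in>?S. core r L * \<mu> ^ r * (\<alpha> * ?b * s\<^sup>2 * (p {v, u} * f v)
           + (if v \<in> set (u # ys) then p {v, u} * (s\<^sup>2 * ?b\<^sup>2) else 0)
           + (if {v, u} \<in> set L then ?q else 0)))"
  proof (rule sum_mono)
    fix v assume v: "v \<in> ?S"
    have nn: "0 \<le> \<alpha> * ?b * s\<^sup>2 * (p {v, u} * f v)" "0 \<le> p {v, u} * (s\<^sup>2 * ?b\<^sup>2)" "0 \<le> ?q"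
      using f_nonneg[of v] v \<alpha>_pos p_nonneg s_pos by auto
    show "potential r (v # u # ys) \<le> core r L * \<mu> ^ r * (\<alpha> * ?b * s\<^sup>2 * (p {v, u} * f v)
           + (if v \<in> set (u # ys) then p {v, u} * (s\<^sup>2 * ?b\<^sup>2) else 0)
           + (if {v, u} \<in> set L then ?q else 0))" (is "_ \<le> core r L * \<mu> ^ r * ?rhs")
    proof -
      have "core r ({v, u} # L) * mode (v # u # ys) \<le> core r L * ?rhs"
      proof (cases "{v, u} \<in> set L")
        case True
        hence vs: "v \<in> set (u # ys)" using walk_edges_subset[of "{v,u}" "u # ys"] unfolding L_def by auto
        have "core r ({v, u} # L) \<le> ?q * core r L"
          using core_old[OF True, of r] core_old_branch[OF True u(1), of r] by auto
        also have "\<dots> = core r L * ?q" by (rule mult.commute)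
        also have "\<dots> \<le> core r L * ?rhs"
          using nn True vs core_nonneg by (intro mult_left_mono) auto
        finally show ?thesis using vs by (simp add: mode_def)
      next
        case new: False
        show ?thesis
        proof (cases "v \<in> set (u # ys)")
          case True
          have "core r ({v, u} # L) \<le> core r L * (p {v, u} * s\<^sup>2 * ?b ^ 2)"
            by (rule core_new) (use r v new in auto)
          also have "\<dots> \<le> core r L * ?rhs"
            using nn True core_nonneg by (intro mult_left_mono) (auto simp: mult.assoc)
          finally show ?thesis using True by (simp add: mode_def)
        next
          case False
          hence dv: "edge_deg L v = 0" unfolding L_def by (intro edge_deg_notin) auto
          have "core r ({v, u} # L) \<le> core r L * (p {v, u} * s\<^sup>2 * ?b ^ 1)"
            by (rule core_new) (use r v new dv in auto)
          hence "core r ({v, u} # L) * (\<alpha> * f v) \<le> core r L * (p {v, u} * s\<^sup>2 * ?b ^ 1) * (\<alpha> * f v)"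
            using \<alpha>_pos f_nonneg[of v] v by (intro mult_right_mono) auto
          thus ?thesis using False new by (simp add: mode_def mult_ac)
        qed
      qed
      hence "core r ({v, u} # L) * mode (v # u # ys) * \<mu> ^ r \<le> core r L * ?rhs * \<mu> ^ r"
        using \<mu>_ge by (intro mult_right_mono) auto
      thus ?thesis by (simp add: potential_def L_def mult_ac)
    qed
  qed
  also have "\<dots> = core r L * \<mu> ^ r * (\<Sum>v\<in>?S. \<alpha> * ?b * s\<^sup>2 * (p {v, u} * f v)
           + (if v \<in> set (u # ys) then p {v, u} * (s\<^sup>2 * ?b\<^sup>2) else 0)
           + (if {v, u} \<in> set L then ?q else 0))"
    by (simp add: sum_distrib_left)
  also have "\<dots> \<le> core r L * \<mu> ^ r * (\<alpha> * ?b + T * P * (exp (s * T))\<^sup>2 / s ^ 4 + exp (s * excess V L))"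
  proof (intro mult_left_mono)
    have 1: "(\<Sum>v\<in>?S. \<alpha> * ?b * s\<^sup>2 * (p {v, u} * f v)) \<le> \<alpha> * ?b"
    proof -
      have "(\<Sum>v\<in>?S. \<alpha> * ?b * s\<^sup>2 * (p {v, u} * f v)) \<le> (\<Sum>v\<in>V. \<alpha> * ?b * s\<^sup>2 * (p {v, u} * f v))"
        using fin \<alpha>_pos p_nonneg f_nonneg s_pos by (intro sum_mono2) auto
      also have "\<dots> = \<alpha> * ?b * (s\<^sup>2 * (\<Sum>v\<in>V. p {v, u} * f v))" by (simp add: sum_distrib_left mult_ac)
      also have "\<dots> \<le> \<alpha> * ?b * 1"
        using subharmonic[OF u(1)] f_le[OF u(1)] \<alpha>_pos s_pos by (intro mult_left_mono) auto
      finally show ?thesis by simp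
    qed
    have 2: "(\<Sum>v\<in>?S. if v \<in> set (u # ys) then p {v, u} * (s\<^sup>2 * ?b\<^sup>2) else 0)
        \<le> T * P * (exp (s * T))\<^sup>2 / s ^ 4"
    proof -
      have "(\<Sum>v\<in>?S. if v \<in> set (u # ys) then p {v, u} * (s\<^sup>2 * ?b\<^sup>2) else 0)
        \<le> (\<Sum>v\<in>V. if v \<in> set (u # ys) then p {v, u} * (s\<^sup>2 * ?b\<^sup>2) else 0)"
        using fin p_nonneg s_pos by (intro sum_mono2) auto
      also have "\<dots> \<le> T * P * (s\<^sup>2 * ?b\<^sup>2)" by (rule sum_visited[OF len]) simp
      also have "T * P * (s\<^sup>2 * ?b\<^sup>2) = T * P * (exp (s * T))\<^sup>2 / s ^ 4"
        using s_pos by (simp add: power_divide field_simps flip: power_mult power_add)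
      finally show ?thesis .
    qed
    have 3: "(\<Sum>v\<in>?S. if {v, u} \<in> set L then ?q else 0) \<le> exp (s * excess V L)"
    proof -
      define A where "A = {v\<in>?S. {v, u} \<in> set L}"
      \<comment> \<open>The edge just traversed is forbidden. The resulting \<open>- 1\<close> is
        essential: it leaves a single continuation at a vertex of degree 2, so long stretches along
        old edges cost nothing.\<close>
      have "(\<lambda>v. {v, u}) ` A \<subseteq> {e \<in> set L. u \<in> e} - {{u, hd ys}}"
        using ys by (auto simp: A_def doubleton_eq_iff)
      hence "card ((\<lambda>v. {v, u}) ` A) \<le> card ({e \<in> set L. u \<in> e} - {{u, hd ys}})"
        by (intro card_mono) auto
      also have "\<dots> = edge_deg L u - 1"
        unfolding edge_deg_def by (subst card_Diff_singleton) (use ys in \<open>auto simp: L_def walk_edges_Cons\<close>)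
      finally have "card ((\<lambda>v. {v, u}) ` A) \<le> edge_deg L u - 1" .
      moreover have "card ((\<lambda>v. {v, u}) ` A) = card A"
        by (intro card_image inj_onI) (auto simp: A_def doubleton_eq_iff)
      ultimately have cA: "card A \<le> edge_deg L u - 1" by simp
      have "(\<Sum>v\<in>?S. if {v, u} \<in> set L then ?q else 0) = (\<Sum>v\<in>A. ?q)"
        unfolding A_def using fin by (intro sum.inter_filter[symmetric]) auto
      also have "\<dots> = card A * ?q" by simp
      also have "\<dots> \<le> 1 + s * excess V L"
      proof (cases "edge_deg L u \<ge> 3")
        case True
        have "real (card A) \<le> 1 + excess V L"
          using cA edge_deg_le_excess[OF fin u(1), of L] by linarith
        hence "card A * s \<le> (1 + excess V L) * s" using s_pos by (intro mult_right_mono) auto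
        thus ?thesis using True s_le by (simp add: algebra_simps)
      next
        case False
        hence "card A \<le> 1" using cA by linarith
        moreover have "0 \<le> s * excess V L" using s_pos by simp
        ultimately show ?thesis using False by (auto intro: order_trans[of _ 1])
      qed
      also have "\<dots> \<le> exp (s * excess V L)" by (rule exp_ge_add_one_self)
      finally show ?thesis .
    qed
    show "(\<Sum>v\<in>?S. \<alpha> * ?b * s\<^sup>2 * (p {v, u} * f v)
           + (if v \<in> set (u # ys) then p {v, u} * (s\<^sup>2 * ?b\<^sup>2) else 0)
           + (if {v, u} \<in> set L then ?q else 0))
        \<le> \<alpha> * ?b + T * P * (exp (s * T))\<^sup>2 / s ^ 4 + exp (s * excess V L)"
      unfolding sum.distrib by (intro add_mono 1 2 3)
  qed (use core_nonneg \<mu>_ge in auto)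
  also have "\<dots> \<le> core r L * \<mu> ^ r * (\<mu> * exp (s * excess V L))"
  proof (intro mult_left_mono)
    have "\<alpha> * ?b + T * P * (exp (s * T))\<^sup>2 / s ^ 4 + exp (s * excess V L) \<le> (\<mu> - 1) + exp (s * excess V L)"
      using leave_old by simp
    also have "\<dots> \<le> (\<mu> - 1) * exp (s * excess V L) + exp (s * excess V L)"
      using \<mu>_ge s_pos mult_left_mono[of 1 "exp (s * excess V L)" "\<mu> - 1"] by simp
    finally show "\<alpha> * ?b + T * P * (exp (s * T))\<^sup>2 / s ^ 4 + exp (s * excess V L) \<le> \<mu> * exp (s * excess V L)"
      by (simp add: algebra_simps)
  qed (use core_nonneg \<mu>_ge in auto)
  also have "\<dots> = potential (Suc r) (u # ys)"
    using u by (simp add: potential_def mode_def L_def core_Suc mult_ac)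
  finally show ?thesis .
qed

text \<open>The turn runs along an old edge, so \<open>core\<close> does not grow, but the walk may
  jump from a fresh vertex, where \<open>mode\<close> can be as small as
  \<open>c * \<alpha>\<close>, to a visited one, where it is 1. This price is paid once per
  walk.\<close>

lemma turn:
  assumes "set (u # ys) \<subseteq> V" "ys \<noteq> []"
  shows "potential r (hd ys # u # ys) \<le> 1 / (c * \<alpha>) * potential (Suc r) (u # ys)"
proof -
  define L where "L = walk_edges (u # ys)"
  have e: "{hd ys, u} \<in> set L" unfolding L_def using assms by (simp add: walk_edges_Cons insert_commute)
  have "potential r (hd ys # u # ys) = core r ({hd ys, u} # L) * \<mu> ^ r"
    using assms by (simp add: potential_def mode_def L_def)
  also have "\<dots> \<le> core r L * \<mu> ^ r" using core_old[OF e, of r] \<mu>_ge by (intro mult_right_mono) auto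
  also have "\<dots> \<le> core (Suc r) L * \<mu> ^ Suc r"
    using core_mono core_nonneg \<mu>_ge by (intro mult_mono power_increasing) auto
  also have "\<dots> = 1 / (c * \<alpha>) * (core (Suc r) L * \<mu> ^ Suc r * (c * \<alpha>))"
    using c_pos \<alpha>_pos by simp
  also have "\<dots> \<le> 1 / (c * \<alpha>) * (core (Suc r) L * \<mu> ^ Suc r * mode (u # ys))"
    using mode_pos[of "u # ys"] assms core_nonneg \<mu>_ge c_pos \<alpha>_pos
    by (intro mult_left_mono) auto
  also have "\<dots> = 1 / (c * \<alpha>) * potential (Suc r) (u # ys)"
    by (simp add: potential_def L_def)
  finally show ?thesis .
qed


lemma sum_potential_step:
  assumes k: "0 < k" and t: "t < T"
  shows "(\<Sum>xs\<in>turn_walks V k (Suc t). potential (T - Suc t) xs)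
    \<le> (if t = k then 1 / (c * \<alpha>) else 1) * (\<Sum>xs\<in>turn_walks V k t. potential (T - t) xs)"
  unfolding sum_turn_walks_Suc[OF fin] sum_distrib_left
proof (rule sum_mono)
  fix xs assume "xs \<in> turn_walks V k t"
  note D = turn_walksD[OF this]
  obtain u ys where xs: "xs = u # ys" using D(1) by (cases xs) auto
  have r: "T - t = Suc (T - Suc t)" using t by simp
  show "(\<Sum>v\<in>{v\<in>V. v \<noteq> hd xs \<and> (if t = k then v = hd (tl xs) else tl xs \<noteq> [] \<longrightarrow> v \<noteq> hd (tl xs))}.
       potential (T - Suc t) (v # xs)) \<le> (if t = k then 1 / (c * \<alpha>) else 1) * potential (T - t) xs"
  proof (cases "t = k")
    case True
    have ys: "ys \<noteq> []" using D(1) k True xs by auto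
    have "{v\<in>V. v \<noteq> u \<and> v = hd ys} = {hd ys}"
      using D ys xs by (auto simp: hd_in_set subset_eq)
    thus ?thesis using turn[of u ys "T - Suc t"] D(2) ys True xs r by simp
  next
    case False
    have "(\<Sum>v\<in>{v\<in>V. v \<noteq> u \<and> (ys \<noteq> [] \<longrightarrow> v \<noteq> hd ys)}. potential (T - Suc t) (v # u # ys))
       \<le> potential (Suc (T - Suc t)) (u # ys)"
      using step_fresh[of u ys "T - Suc t"] step_old[of u ys "T - Suc t"] D xs t
      by (cases "u \<in> set ys") auto
    thus ?thesis using False xs r by simp
  qed
qed

lemma sum_potential:
  assumes k: "0 < k" and t: "t \<le> T"
  shows "(\<Sum>xs\<in>turn_walks V k t. potential (T - t) xs)
    \<le> (if k < t then 1 / (c * \<alpha>) else 1) * (card V * (\<mu> ^ T * \<alpha>))"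
  using t
proof (induction t)
  case 0
  have "(\<Sum>xs\<in>turn_walks V k 0. potential (T - 0) xs) = (\<Sum>v\<in>V. potential T [v])"
    by (simp add: sum.reindex inj_on_def)
  also have "\<dots> \<le> (\<Sum>v\<in>V. \<mu> ^ T * \<alpha>)"
    using \<mu>_ge \<alpha>_pos f_le
    by (intro sum_mono) (auto simp: potential_def mode_def core_def edge_weight_def once_edges_def
        excess_def branching_def edge_deg_def intro!: mult_left_mono)
  finally show ?case by simp
next
  case (Suc t)
  have "(\<Sum>xs\<in>turn_walks V k (Suc t). potential (T - Suc t) xs)
      \<le> (if t = k then 1 / (c * \<alpha>) else 1) * (\<Sum>xs\<in>turn_walks V k t. potential (T - t) xs)"
    using sum_potential_step[OF k, of t] Suc.prems by simp
  also have "\<dots> \<le> (if t = k then 1 / (c * \<alpha>) else 1) *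
      ((if k < t then 1 / (c * \<alpha>) else 1) * (card V * (\<mu> ^ T * \<alpha>)))"
    using Suc c_pos \<alpha>_pos by (intro mult_left_mono) auto
  also have "\<dots> = (if k < Suc t then 1 / (c * \<alpha>) else 1) * (card V * (\<mu> ^ T * \<alpha>))"
    by (auto simp: less_Suc_eq)
  finally show ?case .
qed

text \<open>A walk without singly traversed edges ends at a visited vertex, since otherwise its last
  edge would occur once; so its final \<open>mode\<close> is 1 and its potential is at least its
  weight. The factor \<open>\<alpha>\<close> earned by the fresh starting vertex cancels the one
  lost at the turn, leaving only \<open>1 / c\<close>.\<close>

lemma sum_doubled_walks:
  assumes k: "0 < k" "k < T"
  shows "(\<Sum>xs\<in>{xs\<in>turn_walks V k T. \<forall>e\<in>set (walk_edges xs). count_list (walk_edges xs) e \<noteq> 1}.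
     \<Prod>e\<in>set (walk_edges xs). p e) \<le> card V * \<mu> ^ T / (c * s ^ T)"
proof -
  let ?D = "{xs\<in>turn_walks V k T. \<forall>e\<in>set (walk_edges xs). count_list (walk_edges xs) e \<noteq> 1}"
  have "(\<Sum>xs\<in>?D. (\<Prod>e\<in>set (walk_edges xs). p e) * s ^ T) \<le> (\<Sum>xs\<in>?D. potential (T - T) xs)"
  proof (rule sum_mono)
    fix xs assume xs: "xs \<in> ?D"
    define L where "L = walk_edges xs"
    from xs have D: "length xs = Suc T" "set xs \<subseteq> V" using turn_walksD[of xs V k T] by auto
    obtain u ys where u: "xs = u # ys" using D(1) by (cases xs) auto
    have ys: "ys \<noteq> []" using D(1) k u by auto
    have "u \<in> set ys"
    proof (rule ccontr)
      assume n: "u \<notin> set ys"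
      have "{u, hd ys} \<notin> set (walk_edges ys)" using walk_edges_subset[of "{u, hd ys}" ys] n by auto
      hence "count_list L {u, hd ys} = 1" using ys u by (simp add: L_def walk_edges_Cons count_list_0_iff)
      moreover have "{u, hd ys} \<in> set L" using ys u by (simp add: L_def walk_edges_Cons)
      ultimately show False using xs by (auto simp: L_def)
    qed
    have "once_edges L = 0" unfolding once_edges_def using xs by (auto simp: L_def card_eq_0_iff)
    hence w: "edge_weight p s L = (\<Prod>e\<in>set (walk_edges xs). p e) * s ^ T"
      unfolding edge_weight_def L_def by (simp add: length_walk_edges D)
    have "edge_weight p s L * 1 \<le> edge_weight p s L * (1 / s) ^ branching V L"
      using s_pos s_le edge_weight_nonneg by (intro mult_left_mono one_le_power) auto
    also have "\<dots> = potential 0 xs"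
      using \<open>u \<in> set ys\<close> by (simp add: potential_def mode_def core_def u L_def)
    finally show "(\<Prod>e\<in>set (walk_edges xs). p e) * s ^ T \<le> potential (T - T) xs"
      using w by simp
  qed
  also have "\<dots> \<le> (\<Sum>xs\<in>turn_walks V k T. potential (T - T) xs)"
  proof (rule sum_mono2[OF finite_turn_walks[OF fin]])
    fix xs assume "xs \<in> turn_walks V k T - ?D"
    thus "0 \<le> potential (T - T) xs" using turn_walksD[of xs V k T] by (intro potential_nonneg) auto
  qed auto
  also have "\<dots> \<le> 1 / (c * \<alpha>) * (card V * (\<mu> ^ T * \<alpha>))"
    using sum_potential[of k T] k by simp
  also have "\<dots> = card V * \<mu> ^ T / c" using \<alpha>_pos by simp
  finally have "(\<Sum>xs\<in>?D. \<Prod>e\<in>set (walk_edges xs). p e) * s ^ T \<le> card V * \<mu> ^ T / c"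
    by (simp only: sum_distrib_right)
  thus ?thesis using s_pos c_pos by (simp add: field_simps)
qed

end

section \<open>Nonbacktracking walks\<close>

text \<open>Paths are lists with the current endpoint at the head; the initial directed edge carries no weight.\<close>

fun nb_paths :: "'a set \<Rightarrow> 'a \<Rightarrow> 'a \<Rightarrow> nat \<Rightarrow> 'a list set" where
  "nb_paths V a b 0 = {[b, a]}"
| "nb_paths V a b (Suc k) =
     (\<Union>xs\<in>nb_paths V a b k. (\<lambda>v. v # xs) ` {v\<in>V. v \<noteq> hd xs \<and> v \<noteq> hd (tl xs)})"

fun path_weight :: "('a \<Rightarrow> 'a \<Rightarrow> real) \<Rightarrow> 'a list \<Rightarrow> real" where
  "path_weight H (v # u # w # xs) = H u v * path_weight H (u # w # xs)"
| "path_weight H _ = 1"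

text \<open>The squared Frobenius norm of the \<open>k\<close>-th power of the weighted
  nonbacktracking operator; \<open>(a, b)\<close> is the initial and \<open>(c, d)\<close> the final
  directed edge. All pairs of vertices serve as directed edges, those outside the graph having
  weight 0 when they are traversed.\<close>

definition nb_frobenius :: "'a set \<Rightarrow> ('a \<Rightarrow> 'a \<Rightarrow> real) \<Rightarrow> nat \<Rightarrow> real" where
  "nb_frobenius V H k = (\<Sum>a\<in>V. \<Sum>b\<in>V. \<Sum>c\<in>V. \<Sum>d\<in>V.
     (\<Sum>xs\<in>{xs\<in>nb_paths V a b k. hd xs = d \<and> hd (tl xs) = c}. path_weight H xs)\<^sup>2)"

lemma finite_nb_paths: "finite V \<Longrightarrow> finite (nb_paths V a b k)"
  by (induction k) auto

lemma nb_paths_props: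
  assumes "xs \<in> nb_paths V a b k"
  shows "length xs = k + 2" "a \<in> V \<Longrightarrow> b \<in> V \<Longrightarrow> set xs \<subseteq> V"
    "drop k xs = [b, a]"
  using assms by (induction k arbitrary: xs) fastforce+

lemma sum_nb_paths_Suc:
  assumes "finite V"
  shows "(\<Sum>xs\<in>nb_paths V a b (Suc k). F xs) =
    (\<Sum>xs\<in>nb_paths V a b k. \<Sum>v\<in>{v\<in>V. v \<noteq> hd xs \<and> v \<noteq> hd (tl xs)}. F (v # xs))"
proof -
  have "(\<Sum>xs\<in>nb_paths V a b (Suc k). F xs) =
      (\<Sum>xs\<in>nb_paths V a b k. \<Sum>ys\<in>(\<lambda>v. v # xs) ` {v\<in>V. v \<noteq> hd xs \<and> v \<noteq> hd (tl xs)}. F ys)"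
    unfolding nb_paths.simps by (rule sum.UNION_disjoint) (use assms finite_nb_paths in auto)
  also have "\<dots> = (\<Sum>xs\<in>nb_paths V a b k. \<Sum>v\<in>{v\<in>V. v \<noteq> hd xs \<and> v \<noteq> hd (tl xs)}. F (v # xs))"
    by (intro sum.cong refl) (subst sum.reindex, auto simp: inj_on_def)
  finally show ?thesis .
qed

lemma nb_eigen_iterate:
  assumes fin: "finite V"
    and eig: "\<And>a b. a \<in> V \<Longrightarrow> b \<in> V \<Longrightarrow> y * X a b = (\<Sum>w\<in>V - {a}. H b w * X b w)"
    and loop: "\<And>b. H b b = 0" and ab: "a \<in> V" "b \<in> V"
  shows "y ^ k * X a b = (\<Sum>xs\<in>nb_paths V a b k. path_weight H xs * X (hd (tl xs)) (hd xs))"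
proof (induction k)
  case 0 show ?case by simp
next
  case (Suc k)
  have "y ^ Suc k * X a b = (\<Sum>xs\<in>nb_paths V a b k. path_weight H xs * (y * X (hd (tl xs)) (hd xs)))"
    using Suc by (simp add: sum_distrib_left mult_ac)
  also have "\<dots> = (\<Sum>xs\<in>nb_paths V a b k. \<Sum>v\<in>{v\<in>V. v \<noteq> hd xs \<and> v \<noteq> hd (tl xs)}.
      path_weight H (v # xs) * X (hd (tl (v # xs))) (hd (v # xs)))"
  proof (rule sum.cong[OF refl])
    fix xs assume xs: "xs \<in> nb_paths V a b k"
    obtain u w ys where e: "xs = u # w # ys"
      using nb_paths_props(1)[OF xs] by (cases xs; cases "tl xs") auto
    have in_V: "u \<in> V" "w \<in> V" using nb_paths_props(2)[OF xs ab] e by auto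
    have "y * X w u = (\<Sum>v\<in>V - {w}. H u v * X u v)" by (rule eig) (use in_V in auto)
    also have "\<dots> = (\<Sum>v\<in>{v\<in>V. v \<noteq> u \<and> v \<noteq> w}. H u v * X u v)"
      using fin loop by (intro sum.mono_neutral_right) auto
    finally show "path_weight H xs * (y * X (hd (tl xs)) (hd xs)) =
       (\<Sum>v\<in>{v\<in>V. v \<noteq> hd xs \<and> v \<noteq> hd (tl xs)}. path_weight H (v # xs) * X (hd (tl (v # xs))) (hd (v # xs)))"
      using e by (simp add: sum_distrib_left mult_ac)
  qed
  also have "\<dots> = (\<Sum>xs\<in>nb_paths V a b (Suc k). path_weight H xs * X (hd (tl xs)) (hd xs))"
    by (rule sum_nb_paths_Suc[OF fin, symmetric])
  finally show ?case .
qed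

text \<open>Hypothesis \<open>eig\<close> says that \<open>X\<close> is an eigenvector of the
  nonbacktracking operator with real eigenvalue \<open>y\<close>. Iterating it \<open>k\<close>
  times and applying Cauchy--Schwarz is the comparison of an eigenvalue with the Frobenius
  norm.\<close>

lemma nb_eigenvalue_le_frobenius:
  assumes fin: "finite V"
    and eig: "\<And>a b. a \<in> V \<Longrightarrow> b \<in> V \<Longrightarrow> y * X a b = (\<Sum>w\<in>V - {a}. H b w * X b w)"
    and loop: "\<And>b. H b b = 0"
    and nz: "a0 \<in> V" "b0 \<in> V" "X a0 b0 \<noteq> 0"
  shows "y ^ (2 * k) \<le> nb_frobenius V H k"
proof -
  define N where "N = (\<Sum>a\<in>V. \<Sum>b\<in>V. (X a b)\<^sup>2)"
  have N0: "N > 0"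
  proof -
    have "0 < (X a0 b0)\<^sup>2" using nz by simp
    also have "\<dots> \<le> (\<Sum>b\<in>V. (X a0 b)\<^sup>2)" using nz fin by (intro member_le_sum) auto
    also have "\<dots> \<le> N" unfolding N_def using nz fin
      by (intro member_le_sum[where f = "\<lambda>a. \<Sum>b\<in>V. (X a b)\<^sup>2"]) (auto intro: sum_nonneg)
    finally show ?thesis .
  qed
  let ?B = "\<lambda>a b c d. \<Sum>xs\<in>{xs\<in>nb_paths V a b k. hd xs = d \<and> hd (tl xs) = c}. path_weight H xs"
  have "(y ^ k * X a b)\<^sup>2 \<le> (\<Sum>c\<in>V. \<Sum>d\<in>V. (?B a b c d)\<^sup>2) * N" if ab: "a \<in> V" "b \<in> V" for a b
  proof -
    have "y ^ k * X a b = (\<Sum>xs\<in>nb_paths V a b k. path_weight H xs * X (hd (tl xs)) (hd xs))"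
      by (rule nb_eigen_iterate[OF fin eig loop ab])
    also have "\<dots> = (\<Sum>q\<in>V \<times> V. \<Sum>xs\<in>{xs\<in>nb_paths V a b k. (hd (tl xs), hd xs) = q}.
         path_weight H xs * X (hd (tl xs)) (hd xs))"
    proof (rule sum.group[symmetric])
      show "(\<lambda>xs. (hd (tl xs), hd xs)) ` nb_paths V a b k \<subseteq> V \<times> V"
      proof (intro subsetI, elim imageE)
        fix q xs assume q: "q = (hd (tl xs), hd xs)" and xs: "xs \<in> nb_paths V a b k"
        obtain u w ys where e: "xs = u # w # ys"
          using nb_paths_props(1)[OF xs] by (cases xs; cases "tl xs") auto
        show "q \<in> V \<times> V" using nb_paths_props(2)[OF xs ab] e q by auto
      qed
    qed (use fin finite_nb_paths in auto)
    also have "\<dots> = (\<Sum>q\<in>V \<times> V. ?B a b (fst q) (snd q) * X (fst q) (snd q))"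
    proof (rule sum.cong[OF refl])
      fix q assume "q \<in> V \<times> V"
      have "{xs\<in>nb_paths V a b k. (hd (tl xs), hd xs) = q} = {xs\<in>nb_paths V a b k. hd xs = snd q \<and> hd (tl xs) = fst q}"
        by auto
      thus "(\<Sum>xs\<in>{xs\<in>nb_paths V a b k. (hd (tl xs), hd xs) = q}. path_weight H xs * X (hd (tl xs)) (hd xs))
         = ?B a b (fst q) (snd q) * X (fst q) (snd q)"
        by (simp add: sum_distrib_right)
    qed
    finally have "(y ^ k * X a b)\<^sup>2 = (\<Sum>q\<in>V \<times> V. ?B a b (fst q) (snd q) * X (fst q) (snd q))\<^sup>2" by simp
    also have "\<dots> \<le> (\<Sum>q\<in>V \<times> V. (?B a b (fst q) (snd q))\<^sup>2) * (\<Sum>q\<in>V \<times> V. (X (fst q) (snd q))\<^sup>2)"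
      by (rule Cauchy_Schwarz_ineq_sum)
    also have "\<dots> = (\<Sum>c\<in>V. \<Sum>d\<in>V. (?B a b c d)\<^sup>2) * N"
      unfolding N_def by (simp add: sum.cartesian_product case_prod_beta)
    finally show ?thesis .
  qed
  hence "(\<Sum>a\<in>V. \<Sum>b\<in>V. (y ^ k * X a b)\<^sup>2) \<le> (\<Sum>a\<in>V. \<Sum>b\<in>V. (\<Sum>c\<in>V. \<Sum>d\<in>V. (?B a b c d)\<^sup>2) * N)"
    by (intro sum_mono)
  moreover have "(\<Sum>a\<in>V. \<Sum>b\<in>V. (y ^ k * X a b)\<^sup>2) = y ^ (2 * k) * N"
    unfolding N_def by (simp add: power_mult_distrib sum_distrib_left mult.commute[of 2] power_mult)
  moreover have "(\<Sum>a\<in>V. \<Sum>b\<in>V. (\<Sum>c\<in>V. \<Sum>d\<in>V. (?B a b c d)\<^sup>2) * N) = nb_frobenius V H k * N"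
    unfolding nb_frobenius_def sum_distrib_right[symmetric] ..
  ultimately have "y ^ (2 * k) * N \<le> nb_frobenius V H k * N" by simp
  thus ?thesis using N0 by simp
qed

text \<open>
  The vector \<open>X\<close> below makes \<open>\<plusminus> \<i> y\<close> an eigenvalue of the nonbacktracking operator (easy half
  of the Ihara--Bass correspondence); the signs \<open>\<tau>\<close> of the two sides of the bipartition absorb \<open>\<i>\<close>.
\<close>

lemma ihara_bass_frobenius:
  fixes H :: "'a \<Rightarrow> 'a \<Rightarrow> real" and \<tau> g :: "'a \<Rightarrow> real"
  assumes fin: "finite V" and y: "0 < y"
    and sym: "\<And>u v. H u v = H v u" and \<tau>: "\<And>v. \<tau> v = 1 \<or> \<tau> v = - 1"
    and bip: "\<And>u v. H u v \<noteq> 0 \<Longrightarrow> \<tau> u = - \<tau> v"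
    and null: "\<And>v. v \<in> V \<Longrightarrow> g v * (1 - (\<Sum>w\<in>V. (H v w)\<^sup>2 / (y\<^sup>2 + (H v w)\<^sup>2))) =
        - \<tau> v * (\<Sum>w\<in>V. y * H v w * g w / (y\<^sup>2 + (H v w)\<^sup>2))"
    and nz: "v0 \<in> V" "g v0 \<noteq> 0"
  shows "y ^ (2 * k) \<le> nb_frobenius V (\<lambda>u v. \<tau> u * H u v) k"
proof -
  \<comment> \<open>The classical Ihara--Bass vector
    \<open>(\<lambda> * g v - H u v * g u) / (\<lambda>^2 - (H u v)^2)\<close> at
    \<open>\<lambda> = \<i> * y\<close>, up to phases: multiplying \<open>g\<close> by
    \<open>\<i>\<close> on the side where \<open>\<tau>\<close> is 1 makes it real, apart from a
    constant phase for each orientation.\<close>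
  define X where "X u v = (H u v * g u + \<tau> v * y * g v) / (y\<^sup>2 + (H u v)\<^sup>2)" for u v
  have pos: "y\<^sup>2 + (H u v)\<^sup>2 > 0" for u v using y by (simp add: add_pos_nonneg)
  have \<tau>2: "\<tau> v * \<tau> v = 1" for v using \<tau>[of v] by auto
  have \<tau>H: "\<tau> w * H v w = - \<tau> v * H v w" for v w
    by (cases "H v w = 0") (use bip[of v w] in auto)
  have loop: "H b b = 0" for b using bip[of b b] \<tau>[of b] by (cases "H b b = 0") auto
  \<comment> \<open>The condition \<open>null\<close> says exactly that \<open>g\<close> is
    recovered as the total weighted outflow of \<open>X\<close>. Subtracting the one backtracking
    term then yields the eigenvalue equation.\<close>
  have S: "(\<Sum>w\<in>V. H v w * X v w) = g v" if "v \<in> V" for v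
  proof -
    have "H v w * X v w = g v * ((H v w)\<^sup>2 / (y\<^sup>2 + (H v w)\<^sup>2)) - \<tau> v * (y * H v w * g w / (y\<^sup>2 + (H v w)\<^sup>2))" for w
    proof -
      have "H v w * (H v w * g v + \<tau> w * y * g w) = g v * (H v w)\<^sup>2 + (\<tau> w * H v w) * (y * g w)"
        by (simp add: power2_eq_square algebra_simps)
      also have "\<dots> = g v * (H v w)\<^sup>2 - \<tau> v * (y * H v w * g w)"
        unfolding \<tau>H by (simp add: algebra_simps)
      finally show ?thesis unfolding X_def by (simp add: diff_divide_distrib)
    qed
    hence "(\<Sum>w\<in>V. H v w * X v w) = g v * (\<Sum>w\<in>V. (H v w)\<^sup>2 / (y\<^sup>2 + (H v w)\<^sup>2))
        - \<tau> v * (\<Sum>w\<in>V. y * H v w * g w / (y\<^sup>2 + (H v w)\<^sup>2))"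
      by (simp add: sum_subtractf sum_distrib_left)
    also have "\<dots> = g v" using null[OF that] by (simp add: algebra_simps)
    finally show ?thesis .
  qed
  have eig: "y * X a b = (\<Sum>w\<in>V - {a}. \<tau> b * H b w * X b w)" if "a \<in> V" "b \<in> V" for a b
  proof -
    have "(\<Sum>w\<in>V - {a}. \<tau> b * H b w * X b w) = \<tau> b * ((\<Sum>w\<in>V. H b w * X b w) - H b a * X b a)"
      using that fin by (simp add: sum_diff1 sum_distrib_left mult.assoc right_diff_distrib)
    also have "\<dots> = \<tau> b * (g b - H b a * X b a)" using S[OF that(2)] by simp
    also have "\<dots> = y * X a b"
    proof -
      have H: "H b a = H a b" by (rule sym)
      have "\<tau> b * (g b * (y\<^sup>2 + (H a b)\<^sup>2) - H a b * (H a b * g b + \<tau> a * y * g a))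
          = \<tau> b * g b * y\<^sup>2 - \<tau> b * (\<tau> a * H b a) * (y * g a)"
        unfolding H by (simp add: power2_eq_square algebra_simps)
      also have "\<tau> b * (\<tau> a * H b a) = - H a b"
        unfolding \<tau>H using \<tau>2[of b] H by (simp add: algebra_simps flip: mult.assoc)
      finally have "\<tau> b * (g b * (y\<^sup>2 + (H a b)\<^sup>2) - H a b * (H a b * g b + \<tau> a * y * g a))
          = y * (H a b * g a + \<tau> b * y * g b)"
        by (simp add: power2_eq_square algebra_simps)
      moreover have "\<tau> b * (g b - h * (q / D)) = \<tau> b * (g b * D - h * q) / D" if "D > 0" for h q D :: real
        using that by (simp add: field_simps)
      from this[OF pos[of a b]] have "\<tau> b * (g b - H b a * X b a) =
          \<tau> b * (g b * (y\<^sup>2 + (H a b)\<^sup>2) - H a b * (H a b * g b + \<tau> a * y * g a)) / (y\<^sup>2 + (H a b)\<^sup>2)"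
        unfolding X_def H .
      ultimately show ?thesis unfolding X_def by simp
    qed
    finally show ?thesis by simp
  qed
  have "\<exists>w\<in>V. X v0 w \<noteq> 0"
  proof (rule ccontr)
    assume "\<not> ?thesis"
    hence "(\<Sum>w\<in>V. H v0 w * X v0 w) = 0" by (intro sum.neutral) auto
    thus False using S[OF nz(1)] nz(2) by simp
  qed
  then obtain w where "w \<in> V" "X v0 w \<noteq> 0" by auto
  thus ?thesis
    using nb_eigenvalue_le_frobenius[OF fin, of y X "\<lambda>u v. \<tau> u * H u v" v0 w k] eig loop nz(1) by auto
qed

section \<open>From pairs of nonbacktracking paths to walks with one turn\<close>

lemma nb_paths_distinct:
  assumes "xs \<in> nb_paths V a b k" "i < k"
  shows "xs ! i \<noteq> xs ! Suc i" "xs ! i \<noteq> xs ! Suc (Suc i)"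
proof -
  have "xs ! i \<noteq> xs ! Suc i \<and> xs ! i \<noteq> xs ! Suc (Suc i)"
    using assms
  proof (induction k arbitrary: xs i)
    case (Suc k)
    note IH = Suc.IH
    from Suc.prems obtain v ys where ys: "xs = v # ys" "ys \<in> nb_paths V a b k" "v \<noteq> hd ys" "v \<noteq> hd (tl ys)" by auto
    obtain x y zs where e: "ys = x # y # zs"
      using nb_paths_props(1)[OF ys(2)] by (cases ys; cases "tl ys") auto
    show ?case
    proof (cases i)
      case 0 thus ?thesis using ys e by simp
    next
      case i: (Suc j)
      have "j < k" using Suc.prems i by simp
      from IH[OF ys(2) this] show ?thesis using ys(1) i by simp
    qed
  qed simp
  thus "xs ! i \<noteq> xs ! Suc i" "xs ! i \<noteq> xs ! Suc (Suc i)" by auto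
qed

lemma butlast_nb_path:
  assumes "b \<in> V" "xs \<in> nb_paths V a b t" "t \<le> k"
  shows "butlast xs \<in> turn_walks V k t"
  using assms(2,3)
proof (induction t arbitrary: xs)
  case 0 thus ?case using assms(1) by simp
next
  case (Suc t)
  then obtain v ys where ys: "xs = v # ys" "ys \<in> nb_paths V a b t" "v \<in> V" "v \<noteq> hd ys" "v \<noteq> hd (tl ys)" by auto
  obtain x y zs where e: "ys = x # y # zs"
    using nb_paths_props(1)[OF ys(2)] by (cases ys; cases "tl ys") auto
  have "butlast ys \<in> turn_walks V k t" using Suc.IH[OF ys(2)] Suc.prems by simp
  thus ?case using ys e Suc.prems by (auto intro!: bexI[of _ "butlast ys"] image_eqI[of _ _ v])
qed

text \<open>Runs from \<open>b\<close> to the common end along \<open>xs\<close> and returns along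
  \<open>xs'\<close>. \<open>butlast\<close> removes the vertex \<open>a\<close>, whose edge carries
  no weight, and \<open>tl\<close> keeps the common end from being listed twice.\<close>

definition closed_walk :: "'a list \<Rightarrow> 'a list \<Rightarrow> 'a list" where
  "closed_walk xs xs' = rev (tl (butlast xs')) @ butlast xs"

text \<open>The two paths share their last directed edge, so the first step of the return is the
  turn. The later steps are nonbacktracking because the reversal of a nonbacktracking path is; the
  induction runs over the number of return steps.\<close>

lemma closed_walk_in_turn_walks:
  assumes k: "0 < k" and V: "a \<in> V" "b \<in> V"
    and xs: "xs \<in> nb_paths V a b k" and xs': "xs' \<in> nb_paths V a b k"
    and ends: "hd xs = hd xs'" "hd (tl xs) = hd (tl xs')"
  shows "closed_walk xs xs' \<in> turn_walks V k (2 * k)"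
proof -
  define zs where "zs = butlast xs'"
  have len: "length xs = k + 2" "length xs' = k + 2" "length zs = Suc k"
    using nb_paths_props(1)[OF xs] nb_paths_props(1)[OF xs'] by (auto simp: zs_def)
  have zs_nth: "zs ! i = xs' ! i" if "i \<le> k" for i using that len by (simp add: zs_def nth_butlast)
  obtain x y ws where e: "xs = x # y # ws" using len(1) by (cases xs; cases "tl xs") auto
  have ws: "ws \<noteq> []" using len(1) e k by auto
  have b: "butlast xs = x # y # butlast ws" using e ws by auto
  have z0: "zs ! 0 = x" "zs ! 1 = y"
    using ends e len k zs_nth[of 0] zs_nth[of 1] by (auto simp: hd_conv_nth nth_tl simp flip: length_0_conv)
  have "rev (take t (tl zs)) @ butlast xs \<in> turn_walks V k (k + t)" if "t \<le> k" for t
    using that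
  proof (induction t)
    case 0 thus ?case using butlast_nb_path[OF V(2) xs, of k] by simp
  next
    case (Suc t)
    define cur where "cur = rev (take t (tl zs)) @ butlast xs"
    have cur: "cur \<in> turn_walks V k (k + t)" using Suc unfolding cur_def by simp
    have hd_cur: "hd cur = zs ! t"
    proof (cases t)
      case 0 thus ?thesis using z0 b by (simp add: cur_def)
    next
      case (Suc t')
      have "take t (tl zs) = take t' (tl zs) @ [tl zs ! t']"
        unfolding Suc by (rule take_Suc_conv_app_nth) (use len Suc \<open>Suc t \<le> k\<close> in auto)
      thus ?thesis using Suc len \<open>Suc t \<le> k\<close> by (simp add: cur_def nth_tl)
    qed
    have hd_tl_cur: "hd (tl cur) = (if t = 0 then y else zs ! (t - 1))"
    proof (cases t)
      case 0 thus ?thesis using z0 b by (simp add: cur_def)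
    next
      case (Suc t')
      have 1: "take t (tl zs) = take t' (tl zs) @ [tl zs ! t']"
        unfolding Suc by (rule take_Suc_conv_app_nth) (use len Suc \<open>Suc t \<le> k\<close> in auto)
      show ?thesis
      proof (cases t')
        case 0 thus ?thesis using Suc 1 z0 b by (simp add: cur_def)
      next
        case (Suc t'')
        have "take t' (tl zs) = take t'' (tl zs) @ [tl zs ! t'']"
          unfolding Suc by (rule take_Suc_conv_app_nth) (use len Suc \<open>t = Suc t'\<close> \<open>Suc t \<le> k\<close> in auto)
        thus ?thesis using Suc \<open>t = Suc t'\<close> 1 len \<open>Suc t \<le> k\<close> by (simp add: cur_def nth_tl)
      qed
    qed
    have tk: "t < k" using Suc.prems by simp
    have "zs ! Suc t \<in> V"
      using nb_paths_props(2)[OF xs' V] len tk zs_nth[of "Suc t"] by (auto simp: subset_eq)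
    moreover have "zs ! Suc t \<noteq> zs ! t"
      using nb_paths_distinct(1)[OF xs' tk] zs_nth[of t] zs_nth[of "Suc t"] tk by simp
    moreover have "zs ! Suc t \<noteq> zs ! (t - 1)" if "t \<noteq> 0"
      using nb_paths_distinct(2)[OF xs', of "t - 1"] zs_nth[of "t - 1"] zs_nth[of "Suc t"] tk that
      by (cases t) auto
    ultimately have "zs ! Suc t # cur \<in> turn_walks V k (Suc (k + t))"
      using cur hd_cur hd_tl_cur z0 by (auto intro!: bexI[of _ cur])
    moreover have "take (Suc t) (tl zs) = take t (tl zs) @ [tl zs ! t]"
      by (rule take_Suc_conv_app_nth) (use len tk in auto)
    ultimately show ?case using len tk by (simp add: cur_def nth_tl)
  qed
  from this[of k] show ?thesis using len by (simp add: closed_walk_def zs_def mult_2)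
qed

text \<open>Given \<open>a\<close>, the walk determines both paths. Summing over pairs of paths thus
  counts each walk at most once for every \<open>a\<close>, and the free choice of \<open>a\<close>
  only costs a factor \<open>card V\<close>.\<close>

lemma closed_walk_inverse:
  assumes xs: "xs \<in> nb_paths V a b k" and xs': "xs' \<in> nb_paths V a b k" and hd: "hd xs = hd xs'"
  shows "drop k (closed_walk xs xs') @ [a] = xs" "rev (take (Suc k) (closed_walk xs xs')) @ [a] = xs'"
proof -
  have len: "length xs = k + 2" "length xs' = k + 2"
    using nb_paths_props(1)[OF xs] nb_paths_props(1)[OF xs'] by auto
  have last: "butlast ys @ [a] = ys" if "ys \<in> nb_paths V a b k" for ys
  proof -
    have "last ys = a"
      using nb_paths_props(1,3)[OF that] last_drop[of k ys] by simp
    moreover have "ys \<noteq> []" using nb_paths_props(1)[OF that] by auto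
    ultimately show ?thesis using append_butlast_last_id[of ys] by metis
  qed
  show "drop k (closed_walk xs xs') @ [a] = xs"
    using last[OF xs] len by (simp add: closed_walk_def)
  obtain x zs where x: "butlast xs' = x # zs" using len by (cases "butlast xs'") (auto simp flip: length_0_conv)
  have "hd (butlast xs) = hd xs" "hd (butlast xs') = hd xs'"
    using len by (cases xs; cases "tl xs"; cases xs'; cases "tl xs'"; auto)+
  hence y: "hd (butlast xs) = x" using x hd by simp
  have lz: "length zs = k" using x len by (metis add_2_eq_Suc' diff_Suc_1 length_Cons length_butlast nat.inject)
  have ne: "butlast xs \<noteq> []" using len by (simp flip: length_0_conv)
  have "take (Suc k) (closed_walk xs xs') = rev zs @ [x]"
    unfolding closed_walk_def using x y lz ne by (cases "butlast xs") auto
  thus "rev (take (Suc k) (closed_walk xs xs')) @ [a] = xs'" using last[OF xs'] x by simp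
qed

lemma walk_edges_rev_append:
  "walk_edges (rev xs @ y # zs) = rev (walk_edges (y # xs)) @ walk_edges (y # zs)"
  by (induction xs arbitrary: y zs) (auto simp: insert_commute)

lemma walk_edges_closed_walk:
  assumes "hd xs = hd xs'" "length xs \<ge> 2" "length xs' \<ge> 2"
  shows "walk_edges (closed_walk xs xs') = rev (walk_edges (butlast xs')) @ walk_edges (butlast xs)"
proof -
  obtain x y zs x' y' zs' where e: "xs = x # y # zs" "xs' = x' # y' # zs'"
    using assms by (cases xs; cases "tl xs"; cases xs'; cases "tl xs'") auto
  have b: "butlast xs = x # butlast (y # zs)" "butlast xs' = x # butlast (y' # zs')" using e assms by auto
  show ?thesis unfolding closed_walk_def b list.sel by (rule walk_edges_rev_append)
qed

lemma path_weight_edges: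
  assumes X: "\<And>u v. H u v = X {u, v}" and \<tau>: "\<And>v. \<tau> v = 1 \<or> \<tau> v = - (1::real)"
    and len: "length xs \<ge> 2"
  shows "path_weight (\<lambda>u v. \<tau> u * H u v) xs = path_weight (\<lambda>u v. \<tau> u) xs * prod_list (map X (walk_edges (butlast xs)))"
  using len
proof (induction xs)
  case (Cons v xs)
  show ?case
  proof (cases "length xs \<ge> 2")
    case True
    then obtain u w ys where "xs = u # w # ys" by (cases xs; cases "tl xs") auto
    thus ?thesis using Cons.IH[OF True] X[of u v] by (cases ys) (auto simp: insert_commute)
  next
    case False
    then obtain u where "xs = [u]" using Cons.prems by (cases xs; cases "tl xs") auto
    thus ?thesis by simp
  qed
qed simp

lemma path_weight_sign:
  assumes \<tau>: "\<And>v. \<tau> v = 1 \<or> \<tau> v = - (1::real)"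
  shows "path_weight (\<lambda>u v. \<tau> u) xs = 1 \<or> path_weight (\<lambda>u v. \<tau> u) xs = -1"
proof (induction xs)
  case (Cons v xs)
  thus ?case using \<tau>[of "hd xs"] by (cases xs; cases "tl xs") auto
qed simp

lemma path_weight_pair:
  assumes X: "\<And>u v. H u v = X {u, v}" and \<tau>: "\<And>v. \<tau> v = 1 \<or> \<tau> v = - (1::real)"
    and len: "length xs \<ge> 2" "length xs' \<ge> 2" and hd: "hd xs = hd xs'"
  shows "path_weight (\<lambda>u v. \<tau> u * H u v) xs * path_weight (\<lambda>u v. \<tau> u * H u v) xs' =
    path_weight (\<lambda>u v. \<tau> u) xs * path_weight (\<lambda>u v. \<tau> u) xs' * prod_list (map X (walk_edges (closed_walk xs xs')))"
  unfolding walk_edges_closed_walk[OF hd len] path_weight_edges[where H=H and X=X and \<tau>=\<tau>, OF X \<tau> len(1)]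
    path_weight_edges[where H=H and X=X and \<tau>=\<tau>, OF X \<tau> len(2)]
  by (simp add: prod_list.rev mult_ac flip: rev_map)

text \<open>Expanding the squares gives pairs of paths with equal ends. The signs
  \<open>\<tau>\<close> contribute a deterministic factor of modulus 1 to each pair, so only the
  moments of \<open>X\<close> along the combined walk matter.\<close>

lemma expectation_nb_frobenius_le:
  fixes M :: "'o pmf" and X :: "'o \<Rightarrow> 'a set \<Rightarrow> real" and p :: "'a set \<Rightarrow> real"
  assumes finM: "finite (set_pmf M)" and fin: "finite V" and k: "0 < k"
    and \<tau>: "\<And>v. \<tau> v = 1 \<or> \<tau> v = - (1::real)"
    and bound: "\<And>L. \<bar>measure_pmf.expectation M (\<lambda>\<omega>. prod_list (map (X \<omega>) L))\<bar>
        \<le> (if \<forall>e\<in>set L. count_list L e \<noteq> 1 then \<Prod>e\<in>set L. p e else 0)"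
    and p: "\<And>e. 0 \<le> p e"
  shows "measure_pmf.expectation M (\<lambda>\<omega>. nb_frobenius V (\<lambda>u v. \<tau> u * X \<omega> {u, v}) k) \<le>
    card V * (\<Sum>xs\<in>{xs\<in>turn_walks V k (2 * k). \<forall>e\<in>set (walk_edges xs). count_list (walk_edges xs) e \<noteq> 1}.
     \<Prod>e\<in>set (walk_edges xs). p e)"
proof -
  define A where "A a b c d = {xs\<in>nb_paths V a b k. hd xs = d \<and> hd (tl xs) = c}" for a b c d
  define W where "W = turn_walks V k (2 * k)"
  define \<phi> where "\<phi> w = (if \<forall>e\<in>set (walk_edges w). count_list (walk_edges w) e \<noteq> 1
      then \<Prod>e\<in>set (walk_edges w). p e else 0)" for w :: "'a list"
  have \<phi>0: "0 \<le> \<phi> w" for w unfolding \<phi>_def using p by (auto intro: prod_nonneg)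
  have finA: "finite (A a b c d)" for a b c d unfolding A_def using finite_nb_paths[OF fin] by simp
  have int: "integrable M F" for F :: "'o \<Rightarrow> real" by (rule integrable_measure_pmf_finite[OF finM])
  let ?H = "\<lambda>\<omega> u v. \<tau> u * X \<omega> {u, v}"
  have pair: "measure_pmf.expectation M (\<lambda>\<omega>. path_weight (?H \<omega>) xs * path_weight (?H \<omega>) xs') \<le> \<phi> (closed_walk xs xs')"
    if "xs \<in> A a b c d" "xs' \<in> A a b c d" for a b c d xs xs'
  proof -
    have len: "length xs \<ge> 2" "length xs' \<ge> 2" "hd xs = hd xs'"
      using that nb_paths_props(1)[of xs] nb_paths_props(1)[of xs'] unfolding A_def by auto
    let ?\<sigma> = "path_weight (\<lambda>u v. \<tau> u) xs * path_weight (\<lambda>u v. \<tau> u) xs'"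
    have "measure_pmf.expectation M (\<lambda>\<omega>. path_weight (?H \<omega>) xs * path_weight (?H \<omega>) xs')
        = ?\<sigma> * measure_pmf.expectation M (\<lambda>\<omega>. prod_list (map (X \<omega>) (walk_edges (closed_walk xs xs'))))"
      by (subst path_weight_pair[where \<tau> = \<tau>, OF refl \<tau> len]) simp
    also have "\<dots> \<le> \<bar>?\<sigma>\<bar> * \<bar>measure_pmf.expectation M (\<lambda>\<omega>. prod_list (map (X \<omega>) (walk_edges (closed_walk xs xs'))))\<bar>"
      by (metis abs_ge_self abs_mult)
    also have "\<bar>?\<sigma>\<bar> = 1"
      using path_weight_sign[of \<tau> xs, OF \<tau>] path_weight_sign[of \<tau> xs', OF \<tau>] by (auto simp: abs_mult)
    also have "1 * \<bar>measure_pmf.expectation M (\<lambda>\<omega>. prod_list (map (X \<omega>) (walk_edges (closed_walk xs xs'))))\<bar>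
        \<le> \<phi> (closed_walk xs xs')"
      unfolding \<phi>_def mult_1 by (rule bound)
    finally show ?thesis .
  qed
  have "measure_pmf.expectation M (\<lambda>\<omega>. nb_frobenius V (?H \<omega>) k) =
     (\<Sum>a\<in>V. \<Sum>b\<in>V. \<Sum>c\<in>V. \<Sum>d\<in>V. \<Sum>xs\<in>A a b c d. \<Sum>xs'\<in>A a b c d.
        measure_pmf.expectation M (\<lambda>\<omega>. path_weight (?H \<omega>) xs * path_weight (?H \<omega>) xs'))"
    unfolding nb_frobenius_def A_def[symmetric]
    by (simp add: power2_eq_square sum_product int)
  also have "\<dots> \<le> (\<Sum>a\<in>V. \<Sum>b\<in>V. \<Sum>c\<in>V. \<Sum>d\<in>V. \<Sum>xs\<in>A a b c d. \<Sum>xs'\<in>A a b c d. \<phi> (closed_walk xs xs'))"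
    by (intro sum_mono pair)
  also have "\<dots> \<le> (\<Sum>a\<in>V. \<Sum>w\<in>W. \<phi> w)"
  proof (rule sum_mono)
    fix a assume a: "a \<in> V"
    let ?I = "SIGMA b:V. SIGMA c:V. SIGMA d:V. A a b c d \<times> A a b c d"
    have "(\<Sum>b\<in>V. \<Sum>c\<in>V. \<Sum>d\<in>V. \<Sum>xs\<in>A a b c d. \<Sum>xs'\<in>A a b c d. \<phi> (closed_walk xs xs'))
       = (\<Sum>(b, c, d, xs, xs')\<in>?I. \<phi> (closed_walk xs xs'))"
      using fin finA by (simp add: sum.Sigma sum.cartesian_product case_prod_beta)
    also have "\<dots> \<le> (\<Sum>w\<in>W. \<phi> w)"
    \<comment> \<open>The map recovers \<open>(b, c, d, xs, xs')\<close> from a walk and the fixed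
      \<open>a\<close>; it witnesses that distinct index tuples belong to distinct walks.\<close>
    proof (rule sum_le_included[where i = "\<lambda>w. (hd (drop k (drop k w @ [a])), hd (tl (drop k w @ [a])),
         hd (drop k w @ [a]), drop k w @ [a], rev (take (Suc k) w) @ [a])"])
      show "finite ?I" using fin finA by auto
      show "finite W" unfolding W_def by (rule finite_turn_walks[OF fin])
      show "\<forall>w\<in>W. 0 \<le> \<phi> w" using \<phi>0 by simp
      show "\<forall>q\<in>?I. \<exists>w\<in>W. (hd (drop k (drop k w @ [a])), hd (tl (drop k w @ [a])),
         hd (drop k w @ [a]), drop k w @ [a], rev (take (Suc k) w) @ [a]) = q \<and>
         (case q of (b, c, d, xs, xs') \<Rightarrow> \<phi> (closed_walk xs xs')) \<le> \<phi> w"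
      proof
        fix q assume "q \<in> ?I"
        then obtain b c d xs xs' where q: "q = (b, c, d, xs, xs')" and V: "b \<in> V" "c \<in> V" "d \<in> V"
          and xs: "xs \<in> nb_paths V a b k" "hd xs = d" "hd (tl xs) = c"
          and xs': "xs' \<in> nb_paths V a b k" "hd xs' = d" "hd (tl xs') = c"
          unfolding A_def by auto
        have w: "closed_walk xs xs' \<in> W" unfolding W_def
          by (rule closed_walk_in_turn_walks[OF k a V(1) xs(1) xs'(1)]) (use xs xs' in auto)
        have "hd (drop k xs) = b" using nb_paths_props(3)[OF xs(1)] by simp
        with closed_walk_inverse[OF xs(1) xs'(1)] xs xs' w q
        show "\<exists>w\<in>W. (hd (drop k (drop k w @ [a])), hd (tl (drop k w @ [a])),
         hd (drop k w @ [a]), drop k w @ [a], rev (take (Suc k) w) @ [a]) = q \<and>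
         (case q of (b, c, d, xs, xs') \<Rightarrow> \<phi> (closed_walk xs xs')) \<le> \<phi> w"
          by (intro bexI[OF _ w]) auto
      qed
    qed
    finally show "(\<Sum>b\<in>V. \<Sum>c\<in>V. \<Sum>d\<in>V. \<Sum>xs\<in>A a b c d. \<Sum>xs'\<in>A a b c d. \<phi> (closed_walk xs xs')) \<le> (\<Sum>w\<in>W. \<phi> w)" .
  qed
  also have "\<dots> = card V * (\<Sum>w\<in>W. \<phi> w)" by simp
  also have "(\<Sum>w\<in>W. \<phi> w) = (\<Sum>w\<in>{xs\<in>W. \<forall>e\<in>set (walk_edges xs). count_list (walk_edges xs) e \<noteq> 1}.
     \<Prod>e\<in>set (walk_edges w). p e)"
    unfolding \<phi>_def W_def using finite_turn_walks[OF fin] by (intro sum.inter_filter[symmetric])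
  finally show ?thesis unfolding W_def .
qed

section \<open>The random bipartite graph\<close>

lemma finite_set_inhom_er_bipartite: "finite (set_pmf (inhom_er_bipartite n m p))"
proof -
  have "finite (set_pmf (Pi_pmf ({..<n} \<times> {..<m}) False (\<lambda>(i, j). bernoulli_pmf (p i j))))"
    by (rule finite_subset[OF set_Pi_pmf_subset']) (auto intro!: finite_PiE_dflt)
  thus ?thesis unfolding inhom_er_bipartite_def by simp
qed

lemma integrable_inhom_er_bipartite: "integrable (inhom_er_bipartite n m p) (f :: _ \<Rightarrow> real)"
  by (rule integrable_measure_pmf_finite[OF finite_set_inhom_er_bipartite])

lemma expectation_prod_inhom_er_bipartite:
  fixes \<phi> :: "nat \<times> nat \<Rightarrow> bool \<Rightarrow> real"
  assumes p: "\<And>i j. i < n \<Longrightarrow> j < m \<Longrightarrow> 0 \<le> p i j \<and> p i j \<le> 1"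
  shows "measure_pmf.expectation (inhom_er_bipartite n m p) (\<lambda>E. \<Prod>q\<in>{..<n} \<times> {..<m}. \<phi> q (q \<in> E)) =
    (\<Prod>(i, j)\<in>{..<n} \<times> {..<m}. p i j * \<phi> (i, j) True + (1 - p i j) * \<phi> (i, j) False)"
proof -
  let ?I = "{..<n} \<times> {..<m}"
  let ?b = "\<lambda>(i, j). bernoulli_pmf (p i j)"
  let ?M = "Pi_pmf ?I False ?b"
  have fin: "finite (set_pmf ?M)"
    by (rule finite_subset[OF set_Pi_pmf_subset']) (auto intro!: finite_PiE_dflt)
  have "prob_space.indep_vars ?M (\<lambda>_. count_space UNIV) (\<lambda>x f. f x) ?I"
    by (rule indep_vars_Pi_pmf) auto
  hence ind: "prob_space.indep_vars ?M (\<lambda>_. borel) (\<lambda>x f. \<phi> x (f x)) ?I"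
    by (rule prob_space.indep_vars_compose2[OF prob_space_measure_pmf]) auto
  have "measure_pmf.expectation (inhom_er_bipartite n m p) (\<lambda>E. \<Prod>q\<in>?I. \<phi> q (q \<in> E)) =
      measure_pmf.expectation ?M (\<lambda>b. \<Prod>q\<in>?I. \<phi> q (b q))"
    unfolding inhom_er_bipartite_def by simp
  also have "\<dots> = (\<Prod>q\<in>?I. measure_pmf.expectation ?M (\<lambda>b. \<phi> q (b q)))"
    by (rule prob_space.indep_vars_lebesgue_integral[OF prob_space_measure_pmf _ ind])
       (auto intro: integrable_measure_pmf_finite[OF fin])
  also have "\<dots> = (\<Prod>(i, j)\<in>?I. p i j * \<phi> (i, j) True + (1 - p i j) * \<phi> (i, j) False)"
  proof (rule prod.cong[OF refl])
    fix q assume "q \<in> ?I"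
    then obtain i j where ij: "q = (i, j)" "i < n" "j < m" by auto
    have "measure_pmf.expectation ?M (\<lambda>b. \<phi> (i, j) (b (i, j)))
        = measure_pmf.expectation (map_pmf (\<lambda>b. b (i, j)) ?M) (\<phi> (i, j))" by simp
    also have "map_pmf (\<lambda>b. b (i, j)) ?M = bernoulli_pmf (p i j)"
      by (subst Pi_pmf_component) (use ij in auto)
    also have "measure_pmf.expectation (bernoulli_pmf (p i j)) (\<phi> (i, j))
        = p i j * \<phi> (i, j) True + (1 - p i j) * \<phi> (i, j) False"
      using p[of i j] ij by simp
    finally show "measure_pmf.expectation ?M (\<lambda>b. \<phi> q (b q)) =
        (case q of (i, j) \<Rightarrow> p i j * \<phi> (i, j) True + (1 - p i j) * \<phi> (i, j) False)"
      using ij(1) by simp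
  qed
  finally show ?thesis .
qed

definition centered_entry :: "(nat \<Rightarrow> nat \<Rightarrow> real) \<Rightarrow> (nat \<times> nat) set \<Rightarrow> nat \<Rightarrow> nat \<Rightarrow> real" where
  "centered_entry p E i j = of_bool ((i, j) \<in> E) - p i j"

lemma expectation_biadjacency:
  assumes p: "\<And>i j. i < n \<Longrightarrow> j < m \<Longrightarrow> 0 \<le> p i j \<and> p i j \<le> 1" and ij: "i < n" "j < m"
  shows "measure_pmf.expectation (inhom_er_bipartite n m p) (\<lambda>E. biadjacency n m E $$ (i, j)) = p i j"
proof -
  let ?\<phi> = "\<lambda>q b. if q = (i, j) then of_bool b else (1 :: real)"
  have "biadjacency n m E $$ (i, j) = (\<Prod>q\<in>{..<n} \<times> {..<m}. ?\<phi> q (q \<in> E))" for E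
    using ij by (simp add: biadjacency_def prod.delta)
  hence "measure_pmf.expectation (inhom_er_bipartite n m p) (\<lambda>E. biadjacency n m E $$ (i, j)) =
      (\<Prod>(i', j')\<in>{..<n} \<times> {..<m}. p i' j' * ?\<phi> (i', j') True + (1 - p i' j') * ?\<phi> (i', j') False)"
    by (simp only: expectation_prod_inhom_er_bipartite[where \<phi> = ?\<phi>, OF p])
  also have "\<dots> = (\<Prod>q\<in>{..<n} \<times> {..<m}. if q = (i, j) then p i j else 1)"
    by (rule prod.cong) (auto split: if_split_asm)
  also have "\<dots> = p i j" using ij by (simp add: prod.delta)
  finally show ?thesis .
qed

lemma centered_biadjacency_index:
  assumes p: "\<And>i j. i < n \<Longrightarrow> j < m \<Longrightarrow> 0 \<le> p i j \<and> p i j \<le> 1" and ij: "i < n" "j < m"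
  shows "(biadjacency n m E - expected_biadjacency n m p) $$ (i, j) = centered_entry p E i j"
  using ij expectation_biadjacency[OF p ij]
  by (auto simp: expected_biadjacency_def biadjacency_def centered_entry_def)

lemma prod_list_map_count:
  fixes f :: "'a \<Rightarrow> 'b :: comm_monoid_mult"
  assumes "finite S" "set L \<subseteq> S"
  shows "prod_list (map f L) = (\<Prod>x\<in>S. f x ^ count_list L x)"
  using assms(2)
proof (induction L)
  case (Cons y L)
  have "(\<Prod>x\<in>S. f x ^ count_list (y # L) x) = (\<Prod>x\<in>S. (if x = y then f x else 1) * f x ^ count_list L x)"
    by (rule prod.cong) auto
  also have "\<dots> = f y * (\<Prod>x\<in>S. f x ^ count_list L x)"
    using Cons.prems assms(1) by (simp add: prod.distrib prod.delta)
  finally show ?case using Cons by simp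
qed simp

definition bip_edge :: "nat \<times> nat \<Rightarrow> (nat + nat) set" where
  "bip_edge q = {Inl (fst q), Inr (snd q)}"

text \<open>As \<open>bip_edge\<close> is injective, at most one term is nonzero. The sum avoids
  choosing endpoints of a set and gives value 0 to loops and to pairs inside one side, so walks may
  range over the whole vertex set without respecting the bipartition.\<close>

definition on_edges :: "nat \<Rightarrow> nat \<Rightarrow> (nat \<Rightarrow> nat \<Rightarrow> real) \<Rightarrow> (nat + nat) set \<Rightarrow> real" where
  "on_edges n m F e = (\<Sum>q\<in>{..<n} \<times> {..<m}. if e = bip_edge q then F (fst q) (snd q) else 0)"

lemma inj_bip_edge: "inj bip_edge"
  by (auto simp: inj_def bip_edge_def doubleton_eq_iff)

lemma on_edges_bip_edge [simp]:
  "i < n \<Longrightarrow> j < m \<Longrightarrow> on_edges n m F (bip_edge (i, j)) = F i j"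
  unfolding on_edges_def inj_eq[OF inj_bip_edge] by (simp add: sum.delta)

lemma on_edges_other: "e \<notin> bip_edge ` ({..<n} \<times> {..<m}) \<Longrightarrow> on_edges n m F e = 0"
  unfolding on_edges_def by (intro sum.neutral) auto

lemma on_edges_nonneg:
  "(\<And>i j. i < n \<Longrightarrow> j < m \<Longrightarrow> 0 \<le> F i j) \<Longrightarrow> 0 \<le> on_edges n m F e"
  unfolding on_edges_def by (intro sum_nonneg) auto

lemma centered_bernoulli_moment:
  fixes q :: real
  assumes q: "0 \<le> q" "q \<le> 1" and c: "c \<noteq> 0" "c \<noteq> 1"
  shows "\<bar>q * (1 - q) ^ c + (1 - q) * (- q) ^ c\<bar> \<le> q"
proof -
  have c2: "2 \<le> c" using c by simp
  have 1: "(1 - q) ^ c \<le> (1 - q) ^ 1" using q c2 by (intro power_decreasing) auto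
  have 2: "q ^ c \<le> q ^ 2" using q c2 by (intro power_decreasing) auto
  have "\<bar>q * (1 - q) ^ c + (1 - q) * (- q) ^ c\<bar> \<le> \<bar>q * (1 - q) ^ c\<bar> + \<bar>(1 - q) * (- q) ^ c\<bar>"
    by (rule abs_triangle_ineq)
  also have "\<dots> = q * (1 - q) ^ c + (1 - q) * q ^ c"
    using q by (simp add: abs_mult power_abs)
  also have "\<dots> \<le> q * (1 - q) ^ 1 + (1 - q) * q ^ 2"
    using q by (intro add_mono mult_left_mono 1 2) auto
  also have "\<dots> = q - q * q\<^sup>2" by (simp add: power2_eq_square algebra_simps)
  also have "\<dots> \<le> q" using q by simp
  finally show ?thesis .
qed

text \<open>Entries are independent and centered, so one edge with a single traversal makes the
  expectation vanish. A moment of order at least 2 is bounded by \<open>p\<close> whatever its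
  order, which is why the product runs over the set of edges and not over the list.\<close>

lemma edge_moment_bound:
  assumes p: "\<And>i j. i < n \<Longrightarrow> j < m \<Longrightarrow> 0 \<le> p i j \<and> p i j \<le> 1"
  shows "\<bar>measure_pmf.expectation (inhom_er_bipartite n m p)
      (\<lambda>E. prod_list (map (on_edges n m (centered_entry p E)) L))\<bar>
    \<le> (if \<forall>e\<in>set L. count_list L e \<noteq> 1 then \<Prod>e\<in>set L. on_edges n m p e else 0)"
proof -
  let ?I = "{..<n} \<times> {..<m}"
  have pnn: "0 \<le> on_edges n m p e" for e using p by (intro on_edges_nonneg) auto
  show ?thesis
  proof (cases "set L \<subseteq> bip_edge ` ?I")
    case False
    then obtain e where e: "e \<in> set L" "e \<notin> bip_edge ` ?I" by auto
    have 0: "prod_list (map (on_edges n m (centered_entry p E)) L) = 0" for E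
      using e on_edges_other[OF e(2)] by (auto simp: prod_list_zero_iff image_iff intro!: bexI[of _ e])
    show ?thesis unfolding 0 using pnn by (simp add: prod_nonneg)
  next
    case True
    define c where "c q = count_list L (bip_edge q)" for q
    have 1: "prod_list (map (on_edges n m (centered_entry p E)) L)
        = (\<Prod>q\<in>?I. (of_bool (q \<in> E) - p (fst q) (snd q)) ^ c q)" for E
    proof -
      have "prod_list (map (on_edges n m (centered_entry p E)) L)
          = (\<Prod>e\<in>bip_edge ` ?I. on_edges n m (centered_entry p E) e ^ count_list L e)"
        by (rule prod_list_map_count[OF _ True]) auto
      also have "\<dots> = (\<Prod>q\<in>?I. on_edges n m (centered_entry p E) (bip_edge q) ^ c q)"
        unfolding c_def by (subst prod.reindex) (auto intro: inj_on_subset[OF inj_bip_edge])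
      also have "\<dots> = (\<Prod>q\<in>?I. (of_bool (q \<in> E) - p (fst q) (snd q)) ^ c q)"
        by (rule prod.cong) (auto simp: centered_entry_def)
      finally show ?thesis .
    qed
    have E: "measure_pmf.expectation (inhom_er_bipartite n m p)
      (\<lambda>E. prod_list (map (on_edges n m (centered_entry p E)) L))
      = (\<Prod>(i, j)\<in>?I. p i j * (1 - p i j) ^ c (i, j) + (1 - p i j) * (- p i j) ^ c (i, j))"
      unfolding 1 using expectation_prod_inhom_er_bipartite[OF p, where
          \<phi> = "\<lambda>q b. (of_bool b - p (fst q) (snd q)) ^ c q"] by simp
    show ?thesis
    proof (cases "\<forall>e\<in>set L. count_list L e \<noteq> 1")
      case all: True
      have "\<bar>p i j * (1 - p i j) ^ c (i, j) + (1 - p i j) * (- p i j) ^ c (i, j)\<bar>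
          \<le> (if c (i, j) = 0 then 1 else p i j)" if "i < n" "j < m" for i j
      proof (cases "c (i, j) = 0")
        case False
        hence "bip_edge (i, j) \<in> set L" unfolding c_def by (metis count_list_0_iff)
        hence "c (i, j) \<noteq> 1" using all unfolding c_def by auto
        thus ?thesis using centered_bernoulli_moment[of "p i j" "c (i, j)"] p[OF that] False by simp
      qed simp
      note entry = this
      have "\<bar>\<Prod>(i, j)\<in>?I. p i j * (1 - p i j) ^ c (i, j) + (1 - p i j) * (- p i j) ^ c (i, j)\<bar>
          \<le> (\<Prod>q\<in>?I. if c q = 0 then 1 else p (fst q) (snd q))"
        unfolding abs_prod
      proof (intro prod_mono conjI)
        fix q assume "q \<in> ?I"
        then obtain i j where "q = (i, j)" "i < n" "j < m" by auto
        thus "\<bar>case q of (i, j) \<Rightarrow> p i j * (1 - p i j) ^ c (i, j) + (1 - p i j) * (- p i j) ^ c (i, j)\<bar>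
            \<le> (if c q = 0 then 1 else p (fst q) (snd q))"
          using entry[of i j] by (auto split: if_split_asm)
      qed simp
      also have "\<dots> = (\<Prod>q\<in>{q\<in>?I. c q \<noteq> 0}. p (fst q) (snd q))"
        by (subst prod.inter_filter) (auto intro!: prod.cong)
      also have "\<dots> = (\<Prod>q\<in>{q\<in>?I. c q \<noteq> 0}. on_edges n m p (bip_edge q))"
        by (rule prod.cong) auto
      also have "\<dots> = (\<Prod>e\<in>bip_edge ` {q\<in>?I. c q \<noteq> 0}. on_edges n m p e)"
        by (subst prod.reindex) (auto intro: inj_on_subset[OF inj_bip_edge])
      also have "bip_edge ` {q\<in>?I. c q \<noteq> 0} = set L"
        using True by (auto simp: c_def count_list_0_iff image_iff subset_eq)
      finally show ?thesis unfolding E using all by simp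
    next
      case False
      then obtain e where e: "e \<in> set L" "count_list L e = 1" by auto
      then obtain i j where ij: "i < n" "j < m" "e = bip_edge (i, j)" using True by auto
      hence "c (i, j) = 1" using e unfolding c_def by simp
      hence "p i j * (1 - p i j) ^ c (i, j) + (1 - p i j) * (- p i j) ^ c (i, j) = 0"
        by (simp add: algebra_simps)
      hence "(\<Prod>(i, j)\<in>?I. p i j * (1 - p i j) ^ c (i, j) + (1 - p i j) * (- p i j) ^ c (i, j)) = 0"
        using ij by (intro prod_zero) (auto intro!: bexI[of _ "(i, j)"])
      thus ?thesis unfolding E using False by auto
    qed
  qed
qed

section \<open>Chernoff bounds for sums of squared entries\<close>

lemma exp_le_quadratic:
  fixes x :: real
  assumes "\<bar>x\<bar> \<le> 1"
  shows "exp x \<le> 1 + x + x\<^sup>2"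
proof (cases "x \<ge> 0")
  case True thus ?thesis using assms exp_bound[of x] by simp
next
  case False
  define u where "u = - x"
  have u: "0 \<le> u" "u \<le> 1" using False assms by (auto simp: u_def)
  \<comment> \<open>For negative \<open>x = - u\<close> the claim is equivalent to
    \<open>1 \<le> (1 - u + u^2) * exp u\<close>, and the quadratic Taylor bound for
    \<open>exp u\<close> already suffices.\<close>
  have "1 \<le> 1 + u\<^sup>2 / 2 + u ^ 3 / 2 + u ^ 4 / 2" using u by simp
  also have "\<dots> = (1 - u + u\<^sup>2) * (1 + u + u\<^sup>2 / 2)"
    by (simp add: field_simps power2_eq_square power3_eq_cube power4_eq_xxxx)
  also have "\<dots> \<le> (1 - u + u\<^sup>2) * exp u"
    using u by (intro mult_left_mono exp_lower_Taylor_quadratic) auto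
  finally have "exp x * 1 \<le> exp x * ((1 - u + u\<^sup>2) * exp u)" by (intro mult_left_mono) auto
  also have "\<dots> = (1 - u + u\<^sup>2) * (exp x * exp u)" by (simp only: mult_ac)
  also have "exp x * exp u = 1" by (simp add: u_def flip: exp_add)
  finally show ?thesis by (simp add: u_def)
qed

text \<open>Squared entries lie in [0,1], so \<open>exp (t * z^2)\<close> is at most
  \<open>1 + (t + t^2) * z^2\<close>; taking expectations bounds the exponential moment by
  \<open>exp ((t + t^2) * \<mu>)\<close>. Of the margin \<open>2 * t^2 * D\<close>, one half absorbs
  \<open>t^2 * \<mu>\<close>, the other is the decay rate. Positive \<open>t\<close> gives the upper
  and negative \<open>t\<close> the lower tail.\<close>

lemma chernoff_inhom_er_bipartite:
  assumes p: "\<And>i j. i < n \<Longrightarrow> j < m \<Longrightarrow> 0 \<le> p i j \<and> p i j \<le> 1"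
    and J: "J \<subseteq> {..<n} \<times> {..<m}" and t: "\<bar>t\<bar> \<le> 1"
    and D: "(\<Sum>(i, j)\<in>J. p i j * (1 - p i j)) \<le> D"
  shows "measure_pmf.prob (inhom_er_bipartite n m p)
     {E. t * (\<Sum>(i, j)\<in>J. (centered_entry p E i j)\<^sup>2) \<ge> t * (\<Sum>(i, j)\<in>J. p i j * (1 - p i j)) + 2 * t\<^sup>2 * D}
     \<le> exp (- (t\<^sup>2 * D))"
proof -
  let ?I = "{..<n} \<times> {..<m}" and ?G = "inhom_er_bipartite n m p"
  let ?S = "\<lambda>E. \<Sum>(i, j)\<in>J. (centered_entry p E i j)\<^sup>2"
  define \<mu> where "\<mu> = (\<Sum>(i, j)\<in>J. p i j * (1 - p i j))"
  have finJ: "finite J" by (rule finite_subset[OF J]) auto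
  let ?\<phi> = "\<lambda>q b. if q \<in> J then exp (t * (of_bool b - p (fst q) (snd q))\<^sup>2) else 1"
  have "exp (t * ?S E) = (\<Prod>q\<in>?I. ?\<phi> q (q \<in> E))" for E
  proof -
    have "exp (t * ?S E) = (\<Prod>q\<in>J. exp (t * (of_bool (q \<in> E) - p (fst q) (snd q))\<^sup>2))"
      by (simp add: sum_distrib_left exp_sum[OF finJ] case_prod_beta centered_entry_def)
    also have "\<dots> = (\<Prod>q\<in>?I. ?\<phi> q (q \<in> E))"
      using J by (intro prod.mono_neutral_cong_left) auto
    finally show ?thesis .
  qed
  hence "measure_pmf.expectation ?G (\<lambda>E. exp (t * ?S E))
      = (\<Prod>(i, j)\<in>?I. p i j * ?\<phi> (i, j) True + (1 - p i j) * ?\<phi> (i, j) False)"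
    by (simp only: expectation_prod_inhom_er_bipartite[where \<phi> = ?\<phi>, OF p])
  also have "\<dots> = (\<Prod>q\<in>J. p (fst q) (snd q) * ?\<phi> q True + (1 - p (fst q) (snd q)) * ?\<phi> q False)"
    using J by (intro prod.mono_neutral_cong_right) auto
  also have "\<dots> \<le> (\<Prod>q\<in>J. exp ((t + t\<^sup>2) * (p (fst q) (snd q) * (1 - p (fst q) (snd q)))))"
  proof (rule prod_mono, safe)
    fix i j assume ij: "(i, j) \<in> J"
    define q where "q = p i j"
    have q: "0 \<le> q" "q \<le> 1" using p[of i j] J ij unfolding q_def by auto
    show "0 \<le> p (fst (i, j)) (snd (i, j)) * ?\<phi> (i, j) True + (1 - p (fst (i, j)) (snd (i, j))) * ?\<phi> (i, j) False"
      using q ij by (simp flip: q_def)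
    have e: "exp (t * z\<^sup>2) \<le> 1 + (t + t\<^sup>2) * z\<^sup>2" if "\<bar>z\<bar> \<le> 1" for z
    proof -
      have z2: "z\<^sup>2 \<le> 1" using that by (simp add: abs_square_le_1)
      hence "\<bar>t * z\<^sup>2\<bar> \<le> 1" using t by (simp add: abs_mult mult_le_one)
      hence "exp (t * z\<^sup>2) \<le> 1 + t * z\<^sup>2 + t\<^sup>2 * (z\<^sup>2 * z\<^sup>2)"
        using exp_le_quadratic[of "t * z\<^sup>2"] by (simp add: power2_eq_square mult_ac)
      also have "\<dots> \<le> 1 + t * z\<^sup>2 + t\<^sup>2 * (z\<^sup>2 * 1)"
        using z2 by (intro add_left_mono mult_left_mono) auto
      finally show ?thesis by (simp add: algebra_simps)
    qed
    have "q * exp (t * (1 - q)\<^sup>2) + (1 - q) * exp (t * (0 - q)\<^sup>2)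
        \<le> q * (1 + (t + t\<^sup>2) * (1 - q)\<^sup>2) + (1 - q) * (1 + (t + t\<^sup>2) * (0 - q)\<^sup>2)"
      using q by (intro add_mono mult_left_mono e) auto
    also have "\<dots> = 1 + (t + t\<^sup>2) * (q * (1 - q))"
      by (simp add: algebra_simps power2_eq_square)
    also have "\<dots> \<le> exp ((t + t\<^sup>2) * (q * (1 - q)))" by (rule exp_ge_add_one_self)
    finally show "p (fst (i, j)) (snd (i, j)) * ?\<phi> (i, j) True + (1 - p (fst (i, j)) (snd (i, j))) * ?\<phi> (i, j) False
        \<le> exp ((t + t\<^sup>2) * (p (fst (i, j)) (snd (i, j)) * (1 - p (fst (i, j)) (snd (i, j)))))"
      using ij by (simp add: q_def)
  qed
  also have "\<dots> = exp ((t + t\<^sup>2) * \<mu>)"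
    unfolding \<mu>_def by (simp add: exp_sum[OF finJ, symmetric] sum_distrib_left case_prod_beta)
  finally have mgf: "measure_pmf.expectation ?G (\<lambda>E. exp (t * ?S E)) \<le> exp ((t + t\<^sup>2) * \<mu>)" .
  let ?a = "exp (t * \<mu> + 2 * t\<^sup>2 * D)"
  have "measure_pmf.prob ?G {E. t * ?S E \<ge> t * \<mu> + 2 * t\<^sup>2 * D} = measure_pmf.prob ?G {E \<in> space ?G. ?a \<le> exp (t * ?S E)}"
    by simp
  also have "\<dots> \<le> measure_pmf.expectation ?G (\<lambda>E. exp (t * ?S E)) / ?a"
    by (rule integral_Markov_inequality_measure[where A = "{}"]) (auto intro: integrable_inhom_er_bipartite)
  also have "\<dots> \<le> exp ((t + t\<^sup>2) * \<mu>) / ?a" by (intro divide_right_mono mgf) auto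
  also have "\<dots> = exp ((t + t\<^sup>2) * \<mu> - (t * \<mu> + 2 * t\<^sup>2 * D))" by (simp add: exp_diff)
  also have "\<dots> \<le> exp (- (t\<^sup>2 * D))"
  proof -
    have "t\<^sup>2 * \<mu> \<le> t\<^sup>2 * D" using D unfolding \<mu>_def by (intro mult_left_mono) auto
    thus ?thesis by (simp add: algebra_simps)
  qed
  finally show ?thesis unfolding \<mu>_def .
qed

section \<open>The expected Frobenius norm for the random graph\<close>

lemma on_edges_pair:
  "on_edges n m F {Inl i, Inl i'} = 0" "on_edges n m F {Inr j, Inr j'} = 0"
  "on_edges n m F {Inl i, Inr j} = (if i < n \<and> j < m then F i j else 0)"
  "on_edges n m F {Inr j, Inl i} = (if i < n \<and> j < m then F i j else 0)"
proof -
  show "on_edges n m F {Inl i, Inl i'} = 0" "on_edges n m F {Inr j, Inr j'} = 0"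
    by (rule on_edges_other, auto simp: bip_edge_def doubleton_eq_iff)+
  show 1: "on_edges n m F {Inl i, Inr j} = (if i < n \<and> j < m then F i j else 0)"
  proof (cases "i < n \<and> j < m")
    case True thus ?thesis using on_edges_bip_edge[of i n j m F] by (simp add: bip_edge_def)
  next
    case False thus ?thesis by (auto intro!: on_edges_other simp: bip_edge_def doubleton_eq_iff)
  qed
  thus "on_edges n m F {Inr j, Inl i} = (if i < n \<and> j < m then F i j else 0)"
    by (simp add: insert_commute)
qed

definition side_sign :: "nat + nat \<Rightarrow> real" where
  "side_sign v = (case v of Inl _ \<Rightarrow> - 1 | Inr _ \<Rightarrow> 1)"

lemma expectation_nb_frobenius_bipartite:
  fixes d \<gamma> P :: real
  assumes p: "\<And>i j. i < n \<Longrightarrow> j < m \<Longrightarrow> 0 \<le> p i j \<and> p i j \<le> 1"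
    and P: "\<And>i j. i < n \<Longrightarrow> j < m \<Longrightarrow> p i j \<le> P" "0 \<le> P"
    and \<gamma>: "0 < \<gamma>" "\<gamma> \<le> 1"
    and row: "\<And>i. i < n \<Longrightarrow> (\<Sum>j<m. p i j) \<le> \<gamma> * d"
    and col: "\<And>j. j < m \<Longrightarrow> (\<Sum>i<n. p i j) \<le> d"
    and s: "0 < s" "s \<le> 1" "s\<^sup>2 * (sqrt \<gamma> * d) = 1" and k: "0 < k"
    and small: "2 * real k ^ 3 * P * exp (4 * s * k) \<le> sqrt \<gamma> * s ^ 4"
  shows "measure_pmf.expectation (inhom_er_bipartite n m p)
      (\<lambda>E. nb_frobenius ({..<n} <+> {..<m}) (\<lambda>u v. side_sign u * on_edges n m (centered_entry p E) {u, v}) k)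
    \<le> (real n + real m)\<^sup>2 * exp 4 / (sqrt \<gamma> * s ^ (2 * k))"
proof -
  define V where "V = {..<n} <+> {..<m}"
  define e where "e = exp (s * real (2 * k))"
  \<comment> \<open>Makes the price \<open>\<alpha> * e / s ^ 3\<close> of leaving the old edges
    equal to \<open>1 / k\<close>.\<close>
  define \<alpha> where "\<alpha> = s ^ 3 / (k * e)"
  \<comment> \<open>A loss of \<open>1 / k\<close> is available for each of the two terms in
    \<open>leave_old\<close>, and \<open>\<mu> ^ (2 * k)\<close> still stays below
    \<open>exp 4\<close>.\<close>
  define \<mu> where "\<mu> = 1 + 2 / real k"
  \<comment> \<open>These weights balance the two sides: row sums up to \<open>\<gamma> * d\<close>
    and column sums up to \<open>d\<close> both turn into the common growth rate
    \<open>sqrt \<gamma> * d = 1 / s^2\<close>.\<close>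
  define f where "f v = (case v of Inl _ \<Rightarrow> sqrt \<gamma> | Inr _ \<Rightarrow> 1)" for v :: "nat + nat"
  have finV: "finite V" and cardV: "card V = n + m" unfolding V_def by (auto simp: card_Plus)
  have e1: "1 \<le> e" using s by (simp add: e_def)
  have e2: "e\<^sup>2 = exp (4 * s * k)" unfolding e_def by (simp add: power2_eq_square flip: exp_add)
  have sg: "0 < sqrt \<gamma>" "sqrt \<gamma> \<le> 1" using \<gamma> by auto
  have small': "2 * real k ^ 3 * P * e\<^sup>2 \<le> sqrt \<gamma> * s ^ 4" using small by (simp add: e2)
  interpret walk_potential V "on_edges n m p" f s "sqrt \<gamma>" \<alpha> \<mu> P "2 * k"
  proof
    show "finite V" by fact
    show "0 \<le> on_edges n m p e" for e using p by (intro on_edges_nonneg) auto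
    show "on_edges n m p e \<le> P" for e
    proof (cases "e \<in> bip_edge ` ({..<n} \<times> {..<m})")
      case True thus ?thesis using P by auto
    next
      case False thus ?thesis using on_edges_other[OF False] P by simp
    qed
    show "sqrt \<gamma> \<le> f u" "f u \<le> 1" for u using sg by (auto simp: f_def split: sum.split)
    show "0 < sqrt \<gamma>" "0 < s" "s \<le> 1" using s sg by auto
    show "0 < \<alpha>" using s k e1 by (simp add: \<alpha>_def)
    show "1 \<le> \<mu>" by (simp add: \<mu>_def)
    have "s ^ 3 \<le> 1" using s by (simp add: power_le_one)
    moreover have "1 * 1 \<le> k * e" using k e1 by (intro mult_mono) auto
    ultimately have "\<alpha> \<le> 1" unfolding \<alpha>_def using k e1 by (simp add: divide_le_eq)
    thus "sqrt \<gamma> * \<alpha> \<le> 1" using sg \<open>0 < \<alpha>\<close> by (simp add: mult_le_one)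
    show "s\<^sup>2 * (\<Sum>v\<in>V. on_edges n m p {v, u} * f v) \<le> f u" if "u \<in> V" for u
    proof (cases u)
      case (Inl i)
      hence i: "i < n" using that by (auto simp: V_def)
      have "(\<Sum>v\<in>V. on_edges n m p {v, u} * f v) = (\<Sum>j<m. p i j)"
        unfolding V_def Inl using i by (simp add: sum.Plus on_edges_pair f_def)
      also have "\<dots> \<le> \<gamma> * d" by (rule row[OF i])
      finally have "s\<^sup>2 * (\<Sum>v\<in>V. on_edges n m p {v, u} * f v) \<le> s\<^sup>2 * (\<gamma> * d)"
        using s by (intro mult_left_mono) auto
      also have "\<dots> = s\<^sup>2 * (sqrt \<gamma> * sqrt \<gamma> * d)" using \<gamma> by simp
      also have "\<dots> = sqrt \<gamma> * (s\<^sup>2 * (sqrt \<gamma> * d))" by (simp only: mult_ac)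
      also have "\<dots> = f u" using s Inl by (simp add: f_def)
      finally show ?thesis .
    next
      case (Inr j)
      hence j: "j < m" using that by (auto simp: V_def)
      have "(\<Sum>v\<in>V. on_edges n m p {v, u} * f v) = (\<Sum>i<n. p i j) * sqrt \<gamma>"
        unfolding V_def Inr using j by (simp add: sum.Plus on_edges_pair f_def sum_distrib_right)
      also have "\<dots> \<le> d * sqrt \<gamma>" using col[OF j] sg by (intro mult_right_mono) auto
      finally have "s\<^sup>2 * (\<Sum>v\<in>V. on_edges n m p {v, u} * f v) \<le> s\<^sup>2 * (d * sqrt \<gamma>)"
        using s by (intro mult_left_mono) auto
      also have "\<dots> = f u" using s Inr by (simp add: f_def mult_ac)
      finally show ?thesis .
    qed
    \<comment> \<open>With the chosen \<open>\<alpha>\<close> and \<open>\<mu>\<close> this reads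
      \<open>k ^ 3 * P * e^2 \<le> sqrt \<gamma> * s ^ 4\<close>, which is the origin of the
      hypothesis \<open>small\<close>.\<close>
    show "real (2 * k) * P * exp (s * real (2 * k)) / s \<le> (\<mu> - 1) * \<alpha> * sqrt \<gamma>"
    proof -
      have "real (2 * k) * P * e * (k ^ 2 * e) = 2 * real k ^ 3 * P * e\<^sup>2"
        by (simp add: power2_eq_square power3_eq_cube)
      also have "\<dots> \<le> sqrt \<gamma> * s ^ 4" by (rule small')
      also have "\<dots> \<le> 2 * (sqrt \<gamma> * s ^ 4)" using sg s by simp
      also have "\<dots> = 2 * s ^ 3 * sqrt \<gamma> * s" by (simp add: power3_eq_cube power4_eq_xxxx)
      finally have "real (2 * k) * P * e * (k ^ 2 * e) \<le> 2 * s ^ 3 * sqrt \<gamma> * s" .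
      hence "real (2 * k) * P * e / s \<le> 2 * s ^ 3 * sqrt \<gamma> / (k ^ 2 * e)"
        using s k e1 by (simp add: field_simps)
      also have "\<dots> = (\<mu> - 1) * \<alpha> * sqrt \<gamma>"
        using k e1 by (simp add: \<mu>_def \<alpha>_def power2_eq_square)
      finally show ?thesis by (simp add: e_def)
    qed
    show "\<alpha> * exp (s * real (2 * k)) / s ^ 3 + real (2 * k) * P * (exp (s * real (2 * k)))\<^sup>2 / s ^ 4 \<le> \<mu> - 1"
    proof -
      have "real k * (2 * k * P * e\<^sup>2) = 2 * real k ^ 2 * P * e\<^sup>2 * 1" by (simp add: power2_eq_square)
      also have "\<dots> \<le> 2 * real k ^ 2 * P * e\<^sup>2 * k" using k P by (intro mult_left_mono) auto
      also have "\<dots> \<le> sqrt \<gamma> * s ^ 4" using small' by (simp add: power2_eq_square power3_eq_cube mult_ac)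
      also have "\<dots> \<le> 1 * s ^ 4" using sg s by (intro mult_right_mono) auto
      finally have "2 * k * P * e\<^sup>2 / s ^ 4 \<le> 1 / k" using k s by (simp add: field_simps)
      moreover have "\<alpha> * e / s ^ 3 = 1 / k" using s e1 by (simp add: \<alpha>_def)
      ultimately show ?thesis unfolding \<mu>_def e_def by simp
    qed
  qed
  have "measure_pmf.expectation (inhom_er_bipartite n m p)
      (\<lambda>E. nb_frobenius V (\<lambda>u v. side_sign u * on_edges n m (centered_entry p E) {u, v}) k)
    \<le> card V * (\<Sum>xs\<in>{xs\<in>turn_walks V k (2 * k). \<forall>e\<in>set (walk_edges xs). count_list (walk_edges xs) e \<noteq> 1}.
     \<Prod>e\<in>set (walk_edges xs). on_edges n m p e)"
  proof (rule expectation_nb_frobenius_le[OF finite_set_inhom_er_bipartite finV k])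
    show "side_sign v = 1 \<or> side_sign v = - 1" for v by (simp add: side_sign_def split: sum.split)
    show "0 \<le> on_edges n m p e" for e by (rule p_nonneg)
  qed (rule edge_moment_bound[OF p])
  also have "\<dots> \<le> card V * (card V * \<mu> ^ (2 * k) / (sqrt \<gamma> * s ^ (2 * k)))"
    using sum_doubled_walks[of k] k by (intro mult_left_mono) auto
  also have "\<dots> \<le> card V * (card V * exp 4 / (sqrt \<gamma> * s ^ (2 * k)))"
  proof (intro mult_left_mono divide_right_mono)
    have "\<mu> \<le> exp (2 / k)" unfolding \<mu>_def by (rule exp_ge_add_one_self)
    hence "\<mu> ^ (2 * k) \<le> exp (2 / k) ^ (2 * k)" by (intro power_mono) (auto simp: \<mu>_def)
    also have "\<dots> = exp 4" using k by (simp flip: exp_of_nat_mult)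
    finally show "\<mu> ^ (2 * k) \<le> exp 4" .
  qed (use sg s in auto)
  also have "\<dots> = (real n + real m)\<^sup>2 * exp 4 / (sqrt \<gamma> * s ^ (2 * k))"
    by (simp add: cardV power2_eq_square algebra_simps)
  finally show ?thesis unfolding V_def .
qed

section \<open>The Ihara--Bass matrix at an imaginary parameter\<close>

definition left_coeff :: "nat \<Rightarrow> (nat \<Rightarrow> nat \<Rightarrow> real) \<Rightarrow> real \<Rightarrow> nat \<Rightarrow> real" where
  "left_coeff m h y i = 1 - (\<Sum>j<m. (h i j)\<^sup>2 / (y\<^sup>2 + (h i j)\<^sup>2))"

definition right_coeff :: "nat \<Rightarrow> (nat \<Rightarrow> nat \<Rightarrow> real) \<Rightarrow> real \<Rightarrow> nat \<Rightarrow> real" where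
  "right_coeff n h y j = 1 - (\<Sum>i<n. (h i j)\<^sup>2 / (y\<^sup>2 + (h i j)\<^sup>2))"

text \<open>The off-diagonal block of the Ihara--Bass matrix. For \<open>y^2\<close> much larger
  than the squared entries of \<open>h\<close>, \<open>y * damped\<close> is close to
  \<open>H b\<close>.\<close>

definition damped :: "nat \<Rightarrow> (nat \<Rightarrow> nat \<Rightarrow> real) \<Rightarrow> real \<Rightarrow> (nat \<Rightarrow> real) \<Rightarrow> nat \<Rightarrow> real" where
  "damped m h y b i = (\<Sum>j<m. y * h i j * b j / (y\<^sup>2 + (h i j)\<^sup>2))"

text \<open>The Schur complement, with respect to the left block, of the Ihara--Bass matrix at \<open>\<i> y\<close>.\<close>

definition schur_form :: "nat \<Rightarrow> nat \<Rightarrow> (nat \<Rightarrow> nat \<Rightarrow> real) \<Rightarrow> real \<Rightarrow> (nat \<Rightarrow> real) \<Rightarrow> real" where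
  "schur_form n m h y b =
     (\<Sum>j<m. right_coeff n h y j * (b j)\<^sup>2) + (\<Sum>i<n. (damped m h y b i)\<^sup>2 / left_coeff m h y i)"

text \<open>Vectors are functions on all of \<open>nat\<close> with the product topology. Fixing the
  coordinates from \<open>m\<close> on to 0 gives, by Tychonoff, a compact set that contains the
  unit sphere.\<close>

lemma compact_coordinate_box:
  "compact {b :: nat \<Rightarrow> real. \<forall>j. b j \<in> (if j < m then {-1..1} else {0})}"
proof -
  have "compactin (product_topology (\<lambda>_. euclidean) UNIV)
      (PiE UNIV (\<lambda>j. if j < m then {-1..1::real} else {0}))"
    by (subst compactin_PiE) (auto simp: compactin_euclidean_iff)
  also have "(PiE UNIV (\<lambda>j. if j < m then {-1..1::real} else {0}))
      = {b. \<forall>j. b j \<in> (if j < m then {-1..1} else {0})}"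
    by (auto simp: PiE_def Pi_def)
  finally show ?thesis by (simp add: euclidean_product_topology compactin_euclidean_iff)
qed

text \<open>The first-order condition that puts a zero of a nonnegative quadratic form into its
  kernel.\<close>

lemma quadratic_linear_term_zero:
  fixes a b :: real
  assumes "\<And>t. 0 \<le> a * t\<^sup>2 + b * t"
  shows "b = 0"
proof (rule ccontr)
  assume b: "b \<noteq> 0"
  define c where "c = \<bar>a\<bar> + 1"
  have c: "0 < c" "a < c" by (auto simp: c_def)
  have "0 \<le> a * (- b / c)\<^sup>2 + b * (- b / c)" by (rule assms)
  also have "\<dots> = (a / c - 1) * (b\<^sup>2 / c)" using c by (simp add: field_simps power2_eq_square)
  also have "\<dots> < 0" using b c by (intro mult_neg_pos) auto
  finally show False by simp
qed

lemma schur_form_scale: "schur_form n m h y (\<lambda>j. c * b j) = c\<^sup>2 * schur_form n m h y b"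
proof -
  have "damped m h y (\<lambda>j. c * b j) i = c * damped m h y b i" for i
    unfolding damped_def by (simp add: sum_distrib_left mult_ac)
  thus ?thesis unfolding schur_form_def
    by (simp add: power_mult_distrib sum_distrib_left distrib_left mult_ac)
qed

lemma schur_form_cong: "(\<And>j. j < m \<Longrightarrow> b j = b' j) \<Longrightarrow> schur_form n m h y b = schur_form n m h y b'"
  unfolding schur_form_def damped_def by (intro arg_cong2[of _ _ _ _ "(+)"] sum.cong) auto

lemma schur_form_add_unit:
  assumes "j < m"
  shows "schur_form n m h y (\<lambda>l. b l + (if l = j then t else 0)) = schur_form n m h y b
    + 2 * t * (right_coeff n h y j * b j + (\<Sum>i<n. (y * h i j / (y\<^sup>2 + (h i j)\<^sup>2)) * damped m h y b i / left_coeff m h y i))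
    + t\<^sup>2 * schur_form n m h y (\<lambda>l. if l = j then 1 else 0)"
proof -
  let ?e = "\<lambda>i. y * h i j / (y\<^sup>2 + (h i j)\<^sup>2)"
  have *: "(\<Sum>l<m. f l * (if l = j then x else 0) / g l) = f j * x / g j" for f g :: "nat \<Rightarrow> real" and x
  proof -
    have "(\<Sum>l<m. f l * (if l = j then x else 0) / g l) = (\<Sum>l<m. if l = j then f l * x / g l else 0)"
      by (rule sum.cong) auto
    thus ?thesis using assms by (simp add: sum.delta)
  qed
  have d: "damped m h y (\<lambda>l. b l + (if l = j then t else 0)) i = damped m h y b i + t * ?e i"
    "damped m h y (\<lambda>l. if l = j then 1 else 0) i = ?e i" for i
    unfolding damped_def using assms
    by (simp_all add: distrib_left add_divide_distrib sum.distrib *)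
  have "(\<Sum>l<m. right_coeff n h y l * (b l + (if l = j then t else 0))\<^sup>2)
      = (\<Sum>l<m. right_coeff n h y l * (b l)\<^sup>2 + (if l = j then right_coeff n h y l * (2 * t * b l + t\<^sup>2) else 0))"
    by (rule sum.cong) (auto simp: power2_eq_square algebra_simps)
  also have "\<dots> = (\<Sum>l<m. right_coeff n h y l * (b l)\<^sup>2) + right_coeff n h y j * (2 * t * b j + t\<^sup>2)"
    using assms by (simp add: sum.distrib sum.delta)
  finally have r: "(\<Sum>l<m. right_coeff n h y l * (b l + (if l = j then t else 0))\<^sup>2)
      = (\<Sum>l<m. right_coeff n h y l * (b l)\<^sup>2) + right_coeff n h y j * (2 * t * b j + t\<^sup>2)" .
  have "(\<Sum>l<m. right_coeff n h y l * (if l = j then 1 else 0)\<^sup>2) = (\<Sum>l<m. if l = j then right_coeff n h y l else 0)"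
    by (rule sum.cong) auto
  also have "\<dots> = right_coeff n h y j" using assms by (simp add: sum.delta)
  finally have r1: "(\<Sum>l<m. right_coeff n h y l * (if l = j then 1 else 0)\<^sup>2) = right_coeff n h y j" .
  have l: "(\<Sum>i<n. (damped m h y b i + t * ?e i)\<^sup>2 / left_coeff m h y i) =
      (\<Sum>i<n. (damped m h y b i)\<^sup>2 / left_coeff m h y i)
      + 2 * t * (\<Sum>i<n. ?e i * damped m h y b i / left_coeff m h y i)
      + t\<^sup>2 * (\<Sum>i<n. (?e i)\<^sup>2 / left_coeff m h y i)"
    unfolding sum_distrib_left sum.distrib[symmetric]
    by (rule sum.cong) (auto simp: power2_eq_square algebra_simps add_divide_distrib)
  show ?thesis unfolding schur_form_def d r r1 l by (simp add: algebra_simps)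
qed

lemma continuous_on_schur_form:
  assumes y: "0 < y0" and A: "\<And>y i. y0 \<le> y \<Longrightarrow> i < n \<Longrightarrow> left_coeff m h y i \<noteq> 0"
  shows "continuous_on ({y0..Y} \<times> S) (\<lambda>z. schur_form n m h (fst z) (snd z))"
proof -
  have snd: "continuous_on X (\<lambda>z :: real \<times> (nat \<Rightarrow> real). snd z j)" for X j
    by (rule continuous_on_product_then_coordinatewise) (intro continuous_intros)
  have pos: "(fst z)\<^sup>2 + x\<^sup>2 \<noteq> 0" if "z \<in> {y0..Y} \<times> S" for z :: "real \<times> (nat \<Rightarrow> real)" and x
  proof -
    have "fst z > 0" using that y by auto
    hence "(fst z)\<^sup>2 + x\<^sup>2 > 0" by (simp add: add_pos_nonneg)
    thus ?thesis by linarith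
  qed
  have A': "left_coeff m h (fst z) i \<noteq> 0" if "z \<in> {y0..Y} \<times> S" "i < n" for z i
    using A that by auto
  show ?thesis using A' pos
    unfolding schur_form_def damped_def right_coeff_def left_coeff_def
    by (intro continuous_intros snd) auto
qed

text \<open>
  For large \<open>y\<close> the form is positive definite. If it were not nonnegative at \<open>y0\<close>, then at the last
  \<open>y\<close> where it takes a value \<open>\<le> 0\<close> on the unit sphere it would be positive semidefinite and singular.
\<close>

lemma schur_form_nonneg:
  assumes y0: "0 < y0"
    and A: "\<And>y i. y0 \<le> y \<Longrightarrow> i < n \<Longrightarrow> 0 < left_coeff m h y i"
    and null: "\<And>y a b j. y0 \<le> y \<Longrightarrow> (\<And>i. i < n \<Longrightarrow> a i * left_coeff m h y i = damped m h y b i) \<Longrightarrow>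
      (\<And>j. j < m \<Longrightarrow> b j * right_coeff n h y j = - (\<Sum>i<n. y * h i j * a i / (y\<^sup>2 + (h i j)\<^sup>2))) \<Longrightarrow>
      j < m \<Longrightarrow> b j = 0"
  shows "0 \<le> schur_form n m h y0 b"
proof (rule ccontr)
  assume neg: "\<not> 0 \<le> schur_form n m h y0 b"
  let ?Q = "schur_form n m h"
  \<comment> \<open>Large enough that every column has squared norm below \<open>Y^2\<close>, which
    makes all right coefficients positive at \<open>Y\<close>.\<close>
  define Y where "Y = max y0 (1 + (\<Sum>i<n. \<Sum>j<m. (h i j)\<^sup>2))"
  define box where "box = {b :: nat \<Rightarrow> real. \<forall>j. b j \<in> (if j < m then {-1..1} else {0})}"
  define S where "S = {b\<in>box. (\<Sum>j<m. (b j)\<^sup>2) = 1}"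
  have normalize: "\<exists>c b'. 0 < c \<and> b' \<in> S \<and> (\<forall>j<m. b j = c * b' j)" if nz: "\<exists>j<m. b j \<noteq> 0" for b
  proof -
    define N where "N = (\<Sum>j<m. (b j)\<^sup>2)"
    obtain j0 where j0: "j0 < m" "b j0 \<noteq> 0" using nz by auto
    have "0 < (b j0)\<^sup>2" using j0 by simp
    also have "\<dots> \<le> N" unfolding N_def using j0 by (intro member_le_sum) auto
    finally have N: "0 < N" .
    define b' where "b' j = (if j < m then b j / sqrt N else 0)" for j
    have sq: "(b' j)\<^sup>2 = (b j)\<^sup>2 / N" if "j < m" for j
      using that N by (simp add: b'_def power_divide)
    have "(b' j)\<^sup>2 \<le> 1" if "j < m" for j
    proof -
      have "(b j)\<^sup>2 \<le> N" unfolding N_def using that by (intro member_le_sum) auto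
      thus ?thesis using sq[OF that] N by simp
    qed
    hence "b' \<in> box" unfolding box_def by (auto simp: abs_square_le_1 abs_le_iff) (auto simp: b'_def)
    moreover have "(\<Sum>j<m. (b' j)\<^sup>2) = 1" using N by (simp add: sq N_def flip: sum_divide_distrib)
    ultimately show ?thesis using N by (intro exI[of _ "sqrt N"] exI[of _ b']) (auto simp: S_def b'_def)
  qed
  have large: "0 < ?Q Y b" if "b \<in> S" for b
  proof -
    let ?N = "\<Sum>i<n. \<Sum>j<m. (h i j)\<^sup>2"
    have N0: "0 \<le> ?N" by (intro sum_nonneg) auto
    have Y: "1 \<le> Y" "1 + ?N \<le> Y" "y0 \<le> Y" using N0 by (auto simp: Y_def)
    have "?N < Y * 1" using Y by simp
    also have "\<dots> \<le> Y * Y" using Y by (intro mult_left_mono) auto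
    finally have NY: "?N < Y\<^sup>2" by (simp add: power2_eq_square)
    have pos: "0 < right_coeff n h Y j" if "j < m" for j
    proof -
      have "(\<Sum>i<n. (h i j)\<^sup>2 / (Y\<^sup>2 + (h i j)\<^sup>2)) \<le> (\<Sum>i<n. (h i j)\<^sup>2 / Y\<^sup>2)"
        using Y by (intro sum_mono divide_left_mono mult_pos_pos) (auto intro: add_pos_nonneg)
      also have "\<dots> = (\<Sum>i<n. (h i j)\<^sup>2) / Y\<^sup>2" by (simp add: sum_divide_distrib)
      also have "\<dots> \<le> ?N / Y\<^sup>2"
        using that by (intro divide_right_mono sum_mono member_le_sum) auto
      also have "\<dots> < 1" using NY Y by (simp add: divide_less_eq)
      finally show ?thesis by (simp add: right_coeff_def)
    qed
    have "\<exists>j<m. b j \<noteq> 0"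
    proof (rule ccontr)
      assume "\<not> ?thesis"
      hence "(\<Sum>j<m. (b j)\<^sup>2) = 0" by simp
      thus False using that by (simp add: S_def)
    qed
    then obtain j where j: "j < m" "b j \<noteq> 0" by auto
    have "0 < right_coeff n h Y j * (b j)\<^sup>2" using pos[OF j(1)] j by simp
    also have "\<dots> \<le> (\<Sum>j<m. right_coeff n h Y j * (b j)\<^sup>2)"
      using j(1) pos by (intro member_le_sum[of _ _ "\<lambda>j. right_coeff n h Y j * (b j)\<^sup>2"]) (auto intro!: mult_nonneg_nonneg intro: less_imp_le)
    also have "\<dots> \<le> ?Q Y b" unfolding schur_form_def
      using A[OF Y(3)] by (auto intro!: sum_nonneg divide_nonneg_nonneg intro: less_imp_le)
    finally show ?thesis .
  qed
  have "\<exists>j<m. b j \<noteq> 0"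
  proof (rule ccontr)
    assume "\<not> ?thesis"
    hence "?Q y0 b = ?Q y0 (\<lambda>j. 0 * b j)" by (intro schur_form_cong) auto
    thus False using neg unfolding schur_form_scale by simp
  qed
  from normalize[OF this] obtain c b1 where b1: "0 < c" "b1 \<in> S" "\<forall>j<m. b j = c * b1 j" by auto
  have "?Q y0 b = c\<^sup>2 * ?Q y0 b1"
    unfolding schur_form_scale[symmetric] using b1(3) by (intro schur_form_cong) auto
  hence Qb1: "?Q y0 b1 < 0" using neg b1(1) by (simp add: not_le mult_less_0_iff)
  have A0: "left_coeff m h y i \<noteq> 0" if "y0 \<le> y" "i < n" for y i using A[OF that] by simp
  have contQ: "continuous_on ({y0..Y} \<times> X) (\<lambda>z. ?Q (fst z) (snd z))" for X
    by (rule continuous_on_schur_form[OF y0 A0])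
  have cbox: "compact ({y0..Y} \<times> box)"
    unfolding box_def by (intro compact_Times compact_coordinate_box) auto
  have csum: "continuous_on X (\<lambda>z :: real \<times> (nat \<Rightarrow> real). \<Sum>j<m. (snd z j)\<^sup>2)" for X
    by (intro continuous_intros continuous_on_product_then_coordinatewise)
  define C where "C = {z\<in>{y0..Y} \<times> S. ?Q (fst z) (snd z) \<le> 0}"
  have "compact ({y0..Y} \<times> S)"
  proof -
    have "{y0..Y} \<times> S = ({y0..Y} \<times> box) \<inter> (\<lambda>z. \<Sum>j<m. (snd z j)\<^sup>2) -` {1}"
      by (auto simp: S_def)
    thus ?thesis using closedin_compact[OF cbox continuous_closedin_preimage[OF csum, of "{1}"]] by simp
  qed
  moreover have "C = ({y0..Y} \<times> S) \<inter> (\<lambda>z. ?Q (fst z) (snd z)) -` {..0}" by (auto simp: C_def)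
  ultimately have "compact C"
    using closedin_compact[OF _ continuous_closedin_preimage[OF contQ, of "{..0}"]] by simp
  moreover have "C \<noteq> {}"
    using Qb1 b1 by (auto simp: C_def Y_def intro!: exI[of _ y0] exI[of _ b1])
  moreover have "continuous_on C fst" by (intro continuous_intros)
  ultimately have "\<exists>z\<in>C. \<forall>z'\<in>C. fst z' \<le> fst z" by (rule continuous_attains_sup)
  then obtain z where z: "z \<in> C" "\<And>z'. z' \<in> C \<Longrightarrow> fst z' \<le> fst z" by blast
  define y bs where "y = fst z" and "bs = snd z"
  have ybs: "y0 \<le> y" "y \<le> Y" "bs \<in> S" "?Q y bs \<le> 0"
    using z(1) by (auto simp: C_def y_def bs_def)
  \<comment> \<open>If the form were negative at \<open>(y, b')\<close>, then, being positive at
    \<open>Y\<close>, it would vanish at \<open>b'\<close> for some larger parameter, against the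
    maximality of \<open>y\<close>.\<close>
  have QS: "0 \<le> ?Q y b'" if b': "b' \<in> S" for b'
  proof (rule ccontr)
    assume n: "\<not> 0 \<le> ?Q y b'"
    have "continuous_on {y..Y} (\<lambda>x. ?Q (fst (x, b')) (snd (x, b')))"
      by (rule continuous_on_compose2[OF contQ[of UNIV], where f = "\<lambda>x. (x, b')"])
         (use ybs in \<open>auto intro!: continuous_intros\<close>)
    hence cont: "continuous_on {y..Y} (\<lambda>x. ?Q x b')" by simp
    have "\<exists>x\<ge>y. x \<le> Y \<and> ?Q x b' = 0"
      by (rule IVT'[OF _ _ ybs(2) cont]) (use n large[OF b'] in auto)
    then obtain x where x: "y \<le> x" "x \<le> Y" "?Q x b' = 0" by auto
    hence "(x, b') \<in> C" using ybs b' by (auto simp: C_def)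
    hence "x \<le> y" using z(2) by (force simp: y_def)
    thus False using x n by auto
  qed
  have Q0: "0 \<le> ?Q y b'" for b'
  proof (cases "\<exists>j<m. b' j \<noteq> 0")
    case True
    from normalize[OF this] obtain c b2 where b2: "0 < c" "b2 \<in> S" "\<forall>j<m. b' j = c * b2 j" by auto
    have "?Q y b' = c\<^sup>2 * ?Q y b2"
      unfolding schur_form_scale[symmetric] using b2(3) by (intro schur_form_cong) auto
    thus ?thesis using QS[OF b2(2)] by simp
  next
    case False
    hence "?Q y b' = ?Q y (\<lambda>j. 0 * b' j)" by (intro schur_form_cong) auto
    thus ?thesis unfolding schur_form_scale by simp
  qed
  hence Qbs: "?Q y bs = 0" using ybs(4) by (intro antisym) auto
  \<comment> \<open>Back substitution for the eliminated left block: \<open>(a, bs)\<close> is a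
    null vector of the full Ihara--Bass matrix at \<open>y\<close>.\<close>
  define a where "a i = damped m h y bs i / left_coeff m h y i" for i
  have "bs j = 0" if j: "j < m" for j
  proof (rule null[OF ybs(1) _ _ j])
    fix i assume "i < n"
    thus "a i * left_coeff m h y i = damped m h y bs i"
      using A0[OF ybs(1)] by (simp add: a_def)
  next
    fix j assume j: "j < m"
    have "2 * (right_coeff n h y j * bs j + (\<Sum>i<n. (y * h i j / (y\<^sup>2 + (h i j)\<^sup>2)) * damped m h y bs i / left_coeff m h y i)) = 0"
    proof (rule quadratic_linear_term_zero)
      fix t
      show "0 \<le> ?Q y (\<lambda>l. if l = j then 1 else 0) * t\<^sup>2
         + 2 * (right_coeff n h y j * bs j + (\<Sum>i<n. (y * h i j / (y\<^sup>2 + (h i j)\<^sup>2)) * damped m h y bs i / left_coeff m h y i)) * t"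
        using Q0[of "\<lambda>l. bs l + (if l = j then t else 0)"] unfolding schur_form_add_unit[OF j] Qbs
        by (simp add: mult_ac)
    qed
    thus "bs j * right_coeff n h y j = - (\<Sum>i<n. y * h i j * a i / (y\<^sup>2 + (h i j)\<^sup>2))"
      by (simp add: a_def mult_ac)
  qed
  hence "(\<Sum>j<m. (bs j)\<^sup>2) = 0" by simp
  thus False using ybs(3) by (simp add: S_def)
qed

text \<open>A null vector with nonzero right part at some \<open>y \<ge> y0\<close> would, by
  \<open>ihara_bass_frobenius\<close>, force \<open>y ^ (2 * k)\<close> below the Frobenius norm,
  contradicting \<open>frob\<close>. The sign -1 on the left side matches the sign of
  \<open>damped\<close> in the equations for \<open>a\<close>.\<close>

lemma schur_form_nonneg_of_frobenius:
  fixes h :: "nat \<Rightarrow> nat \<Rightarrow> real"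
  assumes y0: "0 < y0"
    and A: "\<And>y i. y0 \<le> y \<Longrightarrow> i < n \<Longrightarrow> 0 < left_coeff m h y i"
    and frob: "nb_frobenius ({..<n} <+> {..<m}) (\<lambda>u v. side_sign u * on_edges n m h {u, v}) k < y0 ^ (2 * k)"
  shows "0 \<le> schur_form n m h y0 b"
proof (rule schur_form_nonneg[OF y0 A])
  fix y a b j
  assume y: "y0 \<le> y" and left: "\<And>i. i < n \<Longrightarrow> a i * left_coeff m h y i = damped m h y b i"
    and right: "\<And>j. j < m \<Longrightarrow> b j * right_coeff n h y j = - (\<Sum>i<n. y * h i j * a i / (y\<^sup>2 + (h i j)\<^sup>2))"
    and j: "j < m"
  let ?V = "{..<n} <+> {..<m}" and ?H = "\<lambda>u v. on_edges n m h {u, v}"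
  define g where "g v = (case v of Inl i \<Rightarrow> a i | Inr j \<Rightarrow> b j)" for v
  show "b j = 0"
  proof (rule ccontr)
    assume nz: "b j \<noteq> 0"
    have "y ^ (2 * k) \<le> nb_frobenius ?V (\<lambda>u v. side_sign u * ?H u v) k"
    proof (rule ihara_bass_frobenius[where g = g and ?v0.0 = "Inr j"])
      show "finite ?V" by simp
      show "0 < y" using y y0 by simp
      show "on_edges n m h {u, v} = on_edges n m h {v, u}" for u v by (simp add: insert_commute)
      show "side_sign v = 1 \<or> side_sign v = - 1" for v by (simp add: side_sign_def split: sum.split)
      show "side_sign u = - side_sign v" if "on_edges n m h {u, v} \<noteq> 0" for u v
        using that by (cases u; cases v) (auto simp: side_sign_def on_edges_pair)
      show "Inr j \<in> ?V" using j by auto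
      show "g (Inr j) \<noteq> 0" using nz by (simp add: g_def)
      show "g v * (1 - (\<Sum>w\<in>?V. (?H v w)\<^sup>2 / (y\<^sup>2 + (?H v w)\<^sup>2))) =
        - side_sign v * (\<Sum>w\<in>?V. y * ?H v w * g w / (y\<^sup>2 + (?H v w)\<^sup>2))" if "v \<in> ?V" for v
      proof (cases v)
        case (Inl i)
        hence "i < n" using that by auto
        thus ?thesis using left[of i] Inl
          by (simp add: sum.Plus on_edges_pair g_def side_sign_def left_coeff_def damped_def)
      next
        case (Inr j)
        hence "j < m" using that by auto
        thus ?thesis using right[of j] Inr
          by (simp add: sum.Plus on_edges_pair g_def side_sign_def right_coeff_def)
      qed
    qed
    also have "\<dots> < y0 ^ (2 * k)" by (rule frob)
    also have "\<dots> \<le> y ^ (2 * k)" using y y0 by (intro power_mono) auto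
    finally show False by simp
  qed
qed

section \<open>Lower bound for the norm of \<open>H b\<close>\<close>

lemma schur_test:
  fixes e :: "nat \<Rightarrow> nat \<Rightarrow> real"
  assumes row: "\<And>i. i < n \<Longrightarrow> (\<Sum>j<m. \<bar>e i j\<bar>) \<le> R" and col: "\<And>j. j < m \<Longrightarrow> (\<Sum>i<n. \<bar>e i j\<bar>) \<le> C"
    and R: "0 \<le> R"
  shows "(\<Sum>i<n. (\<Sum>j<m. e i j * b j)\<^sup>2) \<le> R * C * (\<Sum>j<m. (b j)\<^sup>2)"
proof -
  have "(\<Sum>i<n. (\<Sum>j<m. e i j * b j)\<^sup>2) \<le> (\<Sum>i<n. R * (\<Sum>j<m. \<bar>e i j\<bar> * (b j)\<^sup>2))"
  proof (rule sum_mono)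
    fix i assume i: "i \<in> {..<n}"
    have "\<bar>\<Sum>j<m. e i j * b j\<bar> \<le> (\<Sum>j<m. sqrt \<bar>e i j\<bar> * (sqrt \<bar>e i j\<bar> * \<bar>b j\<bar>))"
      by (rule order_trans[OF sum_abs]) (simp add: abs_mult flip: mult.assoc)
    hence "(\<Sum>j<m. e i j * b j)\<^sup>2 \<le> (\<Sum>j<m. sqrt \<bar>e i j\<bar> * (sqrt \<bar>e i j\<bar> * \<bar>b j\<bar>))\<^sup>2"
      by (metis abs_ge_zero power2_abs power_mono)
    also have "\<dots> \<le> (\<Sum>j<m. (sqrt \<bar>e i j\<bar>)\<^sup>2) * (\<Sum>j<m. (sqrt \<bar>e i j\<bar> * \<bar>b j\<bar>)\<^sup>2)"
      by (rule Cauchy_Schwarz_ineq_sum)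
    also have "\<dots> = (\<Sum>j<m. \<bar>e i j\<bar>) * (\<Sum>j<m. \<bar>e i j\<bar> * (b j)\<^sup>2)"
      by (simp add: power_mult_distrib)
    also have "\<dots> \<le> R * (\<Sum>j<m. \<bar>e i j\<bar> * (b j)\<^sup>2)"
      using row i by (intro mult_right_mono sum_nonneg) auto
    finally show "(\<Sum>j<m. e i j * b j)\<^sup>2 \<le> R * (\<Sum>j<m. \<bar>e i j\<bar> * (b j)\<^sup>2)" .
  qed
  also have "\<dots> = R * (\<Sum>j<m. \<Sum>i<n. \<bar>e i j\<bar> * (b j)\<^sup>2)"
    by (subst sum.swap) (simp add: sum_distrib_left)
  also have "\<dots> = R * (\<Sum>j<m. (\<Sum>i<n. \<bar>e i j\<bar>) * (b j)\<^sup>2)"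
    by (simp add: sum_distrib_right)
  also have "\<dots> \<le> R * (\<Sum>j<m. C * (b j)\<^sup>2)"
    using R col by (intro mult_left_mono sum_mono mult_right_mono) auto
  also have "\<dots> = R * C * (\<Sum>j<m. (b j)\<^sup>2)" by (simp add: sum_distrib_left mult.assoc)
  finally show ?thesis .
qed

text \<open>Nonnegativity of the form is combined with right coefficients at most
  \<open>1 - c / (y0^2 + 1)\<close> (entries have modulus at most 1) and left coefficients at least
  \<open>1 - R / y0^2\<close>. Replacing \<open>y0 * damped\<close> by \<open>H b\<close> leaves an
  error matrix with entries at most \<open>(h i j)^2 / y0^2\<close>, whose operator norm the Schur
  test bounds by \<open>sqrt (R * C) / y0^2\<close>.\<close>

lemma L2_norm_lower_bound:
  fixes h :: "nat \<Rightarrow> nat \<Rightarrow> real"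
  assumes y0: "0 < y0" and h: "\<And>i j. i < n \<Longrightarrow> j < m \<Longrightarrow> \<bar>h i j\<bar> \<le> 1"
    and row: "\<And>i. i < n \<Longrightarrow> (\<Sum>j<m. (h i j)\<^sup>2) \<le> R" and R: "0 \<le> R" "R < y0\<^sup>2"
    and col: "\<And>j. j < m \<Longrightarrow> (\<Sum>i<n. (h i j)\<^sup>2) \<le> C"
    and col_min: "\<And>j. j < m \<Longrightarrow> c \<le> (\<Sum>i<n. (h i j)\<^sup>2)"
    and frob: "nb_frobenius ({..<n} <+> {..<m}) (\<lambda>u v. side_sign u * on_edges n m h {u, v}) k < y0 ^ (2 * k)"
    and b: "(\<Sum>j<m. (b j)\<^sup>2) = 1"
  shows "sqrt ((1 - R / y0\<^sup>2) * (c / (y0\<^sup>2 + 1) - 1)) * y0 - sqrt (R * C) / y0\<^sup>2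
     \<le> L2_set (\<lambda>i. \<Sum>j<m. h i j * b j) {..<n}"
proof -
  have A: "1 - R / y0\<^sup>2 \<le> left_coeff m h y i" if "y0 \<le> y" "i < n" for y i
  proof -
    have "(\<Sum>j<m. (h i j)\<^sup>2 / (y\<^sup>2 + (h i j)\<^sup>2)) \<le> (\<Sum>j<m. (h i j)\<^sup>2 / y0\<^sup>2)"
    proof (rule sum_mono)
      fix j
      have "y0\<^sup>2 \<le> y\<^sup>2" using that y0 by (intro power_mono) auto
      hence "y0\<^sup>2 \<le> y\<^sup>2 + (h i j)\<^sup>2" by (simp add: add_increasing2)
      moreover have "0 < y0\<^sup>2" using y0 by simp
      moreover from calculation have "0 < y\<^sup>2 + (h i j)\<^sup>2" by linarith
      ultimately show "(h i j)\<^sup>2 / (y\<^sup>2 + (h i j)\<^sup>2) \<le> (h i j)\<^sup>2 / y0\<^sup>2"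
        by (intro divide_left_mono mult_pos_pos) simp_all
    qed
    also have "\<dots> = (\<Sum>j<m. (h i j)\<^sup>2) / y0\<^sup>2" by (simp add: sum_divide_distrib)
    also have "\<dots> \<le> R / y0\<^sup>2" using row[OF that(2)] by (intro divide_right_mono) auto
    finally show ?thesis by (simp add: left_coeff_def)
  qed
  define \<alpha> where "\<alpha> = 1 - R / y0\<^sup>2"
  have \<alpha>: "0 < \<alpha>" unfolding \<alpha>_def using R y0 by simp
  have pos: "0 < left_coeff m h y i" if "y0 \<le> y" "i < n" for y i
    using A[OF that] \<alpha> unfolding \<alpha>_def by simp
  have Q: "0 \<le> schur_form n m h y0 b"
    by (rule schur_form_nonneg_of_frobenius[OF y0 pos frob])
  have "(\<Sum>j<m. right_coeff n h y0 j * (b j)\<^sup>2) \<le> (\<Sum>j<m. (1 - c / (y0\<^sup>2 + 1)) * (b j)\<^sup>2)"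
  proof (intro sum_mono mult_right_mono)
    fix j assume j: "j \<in> {..<m}"
    have "c / (y0\<^sup>2 + 1) \<le> (\<Sum>i<n. (h i j)\<^sup>2) / (y0\<^sup>2 + 1)"
      using col_min j by (intro divide_right_mono) (auto intro: add_nonneg_nonneg)
    also have "\<dots> = (\<Sum>i<n. (h i j)\<^sup>2 / (y0\<^sup>2 + 1))" by (simp add: sum_divide_distrib)
    also have "\<dots> \<le> (\<Sum>i<n. (h i j)\<^sup>2 / (y0\<^sup>2 + (h i j)\<^sup>2))"
      using h j y0 by (intro sum_mono divide_left_mono mult_pos_pos) (auto simp: abs_square_le_1 intro!: add_pos_nonneg)
    finally show "right_coeff n h y0 j \<le> 1 - c / (y0\<^sup>2 + 1)" by (simp add: right_coeff_def)
  qed auto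
  also have "\<dots> = 1 - c / (y0\<^sup>2 + 1)" by (simp add: b flip: sum_distrib_left)
  finally have r: "(\<Sum>j<m. right_coeff n h y0 j * (b j)\<^sup>2) \<le> 1 - c / (y0\<^sup>2 + 1)" .
  have l: "(\<Sum>i<n. (damped m h y0 b i)\<^sup>2 / left_coeff m h y0 i) \<le> (\<Sum>i<n. (damped m h y0 b i)\<^sup>2) / \<alpha>"
    unfolding sum_divide_distrib
  proof (intro sum_mono divide_left_mono mult_pos_pos)
    fix i assume "i \<in> {..<n}"
    hence i: "i < n" by simp
    show "\<alpha> \<le> left_coeff m h y0 i" using A[OF order.refl i] by (simp add: \<alpha>_def)
    show "0 < left_coeff m h y0 i" by (rule pos[OF order.refl i])
  qed (use \<alpha> in auto)
  have "c / (y0\<^sup>2 + 1) - 1 \<le> (\<Sum>i<n. (damped m h y0 b i)\<^sup>2) / \<alpha>"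
    using Q r l unfolding schur_form_def by simp
  hence "\<alpha> * (c / (y0\<^sup>2 + 1) - 1) \<le> (\<Sum>i<n. (damped m h y0 b i)\<^sup>2)"
    using \<alpha> by (simp add: field_simps)
  hence D: "sqrt (\<alpha> * (c / (y0\<^sup>2 + 1) - 1)) \<le> L2_set (damped m h y0 b) {..<n}"
    unfolding L2_set_def by (rule real_sqrt_le_mono)
  define e where "e i j = y0 * (y0 * h i j / (y0\<^sup>2 + (h i j)\<^sup>2)) - h i j" for i j
  have e: "\<bar>e i j\<bar> \<le> (h i j)\<^sup>2 / y0\<^sup>2" if "i < n" "j < m" for i j
  proof -
    have p: "0 < y0\<^sup>2 + (h i j)\<^sup>2" using y0 by (simp add: add_pos_nonneg)
    have "y0 * (y0 * t / D) - t = (y0 * y0 - D) * t / D" if "0 < D" for t D :: real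
      using that by (simp add: field_simps)
    from this[OF p, of "h i j"] have "e i j = - (h i j * (h i j)\<^sup>2 / (y0\<^sup>2 + (h i j)\<^sup>2))"
      unfolding e_def by (simp add: power2_eq_square mult_ac)
    hence "\<bar>e i j\<bar> = \<bar>h i j\<bar> * (h i j)\<^sup>2 / (y0\<^sup>2 + (h i j)\<^sup>2)"
      using p by (simp add: abs_mult)
    also have "\<dots> \<le> 1 * (h i j)\<^sup>2 / y0\<^sup>2"
      using h[OF that] y0 by (intro frac_le mult_right_mono) auto
    finally show ?thesis by simp
  qed
  have "(\<Sum>i<n. (\<Sum>j<m. e i j * b j)\<^sup>2) \<le> (R / y0\<^sup>2) * (C / y0\<^sup>2) * (\<Sum>j<m. (b j)\<^sup>2)"
  proof (rule schur_test)
    fix i assume i: "i < n"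
    have "(\<Sum>j<m. \<bar>e i j\<bar>) \<le> (\<Sum>j<m. (h i j)\<^sup>2 / y0\<^sup>2)" using e i by (intro sum_mono) auto
    also have "\<dots> = (\<Sum>j<m. (h i j)\<^sup>2) / y0\<^sup>2" by (simp add: sum_divide_distrib)
    also have "\<dots> \<le> R / y0\<^sup>2" using row[OF i] by (intro divide_right_mono) auto
    finally show "(\<Sum>j<m. \<bar>e i j\<bar>) \<le> R / y0\<^sup>2" .
  next
    fix j assume j: "j < m"
    have "(\<Sum>i<n. \<bar>e i j\<bar>) \<le> (\<Sum>i<n. (h i j)\<^sup>2 / y0\<^sup>2)" using e j by (intro sum_mono) auto
    also have "\<dots> = (\<Sum>i<n. (h i j)\<^sup>2) / y0\<^sup>2" by (simp add: sum_divide_distrib)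
    also have "\<dots> \<le> C / y0\<^sup>2" using col[OF j] by (intro divide_right_mono) auto
    finally show "(\<Sum>i<n. \<bar>e i j\<bar>) \<le> C / y0\<^sup>2" .
  qed (use R in auto)
  also have "\<dots> = (R * C) / (y0\<^sup>2)\<^sup>2" unfolding b by (simp add: power2_eq_square)
  finally have "sqrt (\<Sum>i<n. (\<Sum>j<m. e i j * b j)\<^sup>2) \<le> sqrt ((R * C) / (y0\<^sup>2)\<^sup>2)"
    by (rule real_sqrt_le_mono)
  hence E: "L2_set (\<lambda>i. \<Sum>j<m. e i j * b j) {..<n} \<le> sqrt (R * C) / y0\<^sup>2"
    unfolding L2_set_def by (simp only: real_sqrt_divide real_sqrt_abs abs_power2)
  have "y0 * sqrt (\<alpha> * (c / (y0\<^sup>2 + 1) - 1)) \<le> y0 * L2_set (damped m h y0 b) {..<n}"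
    using D y0 by simp
  also have "\<dots> = L2_set (\<lambda>i. y0 * damped m h y0 b i) {..<n}"
    using y0 by (simp add: L2_set_right_distrib)
  also have "(\<lambda>i. y0 * damped m h y0 b i) = (\<lambda>i. (\<Sum>j<m. h i j * b j) + (\<Sum>j<m. e i j * b j))"
    unfolding damped_def e_def
    by (rule ext) (simp add: sum_distrib_left algebra_simps flip: sum.distrib)
  also have "L2_set \<dots> {..<n} \<le> L2_set (\<lambda>i. \<Sum>j<m. h i j * b j) {..<n} + L2_set (\<lambda>i. \<Sum>j<m. e i j * b j) {..<n}"
    by (rule L2_set_triangle_ineq)
  finally show ?thesis using E unfolding \<alpha>_def by (simp add: mult_ac)
qed

section \<open>The smallest singular value\<close>

text \<open>\<open>proots\<close> of a real polynomial collects real roots only. That all roots are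
  real guarantees that the list of singular values has full length, so that the position read by
  \<open>sigma_min\<close> exists.\<close>

lemma size_proots_real_rooted:
  fixes p :: "real poly"
  assumes "p \<noteq> 0" "\<And>z. poly (map_poly complex_of_real p) z = 0 \<Longrightarrow> z \<in> \<real>"
  shows "size (proots p) = degree p"
  using assms
proof (induction "degree p" arbitrary: p)
  case 0
  then obtain a where "p = [:a:]" by (metis degree_eq_zeroE)
  thus ?case by simp
next
  case (Suc k)
  have "degree (map_poly complex_of_real p) = Suc k" using Suc by (simp add: degree_map_poly)
  then obtain z where z: "poly (map_poly complex_of_real p) z = 0"
    using fundamental_theorem_of_algebra[of "map_poly complex_of_real p"] by (auto simp: constant_degree)
  then obtain x where x: "z = complex_of_real x" using Suc.prems(2) by (auto elim: Reals_cases)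
  have "poly p x = 0"
  proof -
    have "complex_of_real (poly p x) = 0"
      using z unfolding x by (simp add: poly_altdef degree_map_poly coeff_map_poly)
    thus ?thesis by simp
  qed
  then obtain q where q: "p = [:- x, 1:] * q" by (metis poly_eq_0_iff_dvd dvdE)
  have q0: "q \<noteq> 0" using Suc.prems q by auto
  have "degree p = Suc (degree q)" unfolding q using q0 by (subst degree_mult_eq) auto
  hence dq: "k = degree q" using Suc by simp
  have "map_poly complex_of_real p = map_poly complex_of_real [:- x, 1:] * map_poly complex_of_real q"
    unfolding q by (rule poly_eqI) (simp add: coeff_map_poly coeff_pCons split: nat.split)
  hence "size (proots q) = degree q"
    using Suc.prems by (intro Suc.hyps(1)[OF dq q0]) auto
  moreover have "proots p = {#x#} + proots q" unfolding q using q0 by (subst proots_mult) auto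
  ultimately show ?case using dq Suc by simp
qed

lemma symmetric_real_eigenvalue:
  fixes N :: "real mat"
  assumes N: "N \<in> carrier_mat m m" and sym: "\<And>i j. i < m \<Longrightarrow> j < m \<Longrightarrow> N $$ (i, j) = N $$ (j, i)"
    and z: "poly (map_poly complex_of_real (char_poly N)) z = 0"
  shows "z \<in> \<real>"
proof -
  let ?N = "map_mat complex_of_real N"
  have cN: "?N \<in> carrier_mat m m" using N by simp
  have "char_poly ?N = map_poly complex_of_real (char_poly N)"
    by (rule of_real_hom.char_poly_hom[OF N])
  hence "eigenvalue ?N z" using z eigenvalue_root_char_poly[OF cN] by simp
  then obtain v where v: "v \<in> carrier_vec m" "v \<noteq> 0\<^sub>v m" "?N *\<^sub>v v = z \<cdot>\<^sub>v v"
    using cN by (auto simp: eigenvalue_def eigenvector_def)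
  have row: "(\<Sum>j<m. complex_of_real (N $$ (i, j)) * v $ j) = z * v $ i" if i: "i < m" for i
  proof -
    have "(?N *\<^sub>v v) $ i = (\<Sum>j<m. complex_of_real (N $$ (i, j)) * v $ j)"
      using i N v(1) by (simp add: scalar_prod_def atLeast0LessThan)
    thus ?thesis unfolding v(3) using v(1) i by simp
  qed
  define S where "S = (\<Sum>i<m. cnj (v $ i) * v $ i)"
  let ?T = "\<Sum>i<m. \<Sum>j<m. cnj (v $ i) * (complex_of_real (N $$ (i, j)) * v $ j)"
  have T: "?T = z * S"
    unfolding S_def by (simp add: row flip: sum_distrib_left) (simp add: sum_distrib_left mult_ac)
  have "cnj ?T = (\<Sum>i<m. \<Sum>j<m. cnj (v $ j) * (complex_of_real (N $$ (i, j)) * v $ i))"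
    by (simp add: mult_ac)
  also have "\<dots> = (\<Sum>j<m. \<Sum>i<m. cnj (v $ j) * (complex_of_real (N $$ (i, j)) * v $ i))"
    by (rule sum.swap)
  also have "\<dots> = ?T" using sym by (intro sum.cong refl) auto
  finally have T': "cnj (z * S) = z * S" unfolding T .
  have S: "S = complex_of_real (\<Sum>i<m. (cmod (v $ i))\<^sup>2)"
    unfolding S_def of_real_sum by (intro sum.cong refl) (metis complex_norm_square mult.commute)
  have "\<exists>i<m. v $ i \<noteq> 0"
  proof (rule ccontr)
    assume "\<not> ?thesis"
    hence "v = 0\<^sub>v m" using v(1) by (intro eq_vecI) auto
    thus False using v by simp
  qed
  then obtain i where i: "i < m" "v $ i \<noteq> 0" by auto
  have "0 < (cmod (v $ i))\<^sup>2" using i by simp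
  also have "\<dots> \<le> (\<Sum>i<m. (cmod (v $ i))\<^sup>2)" using i by (intro member_le_sum) auto
  finally have "S \<noteq> 0" unfolding S of_real_eq_0_iff by simp
  moreover have "cnj S = S" unfolding S by (rule complex_cnj_complex_of_real)
  ultimately have "cnj z = z" using T' by simp
  thus ?thesis by (simp add: Reals_cnj_iff)
qed

text \<open>The lower bound for \<open>H b\<close> is uniform over unit vectors, so it suffices to
  exhibit the selected singular value as the norm at a normalized eigenvector of the Gram
  matrix.\<close>

lemma sigma_min_cases:
  fixes M :: "real mat"
  assumes M: "M \<in> carrier_mat n m" and m: "1 \<le> m"
  obtains b where "(\<Sum>j<m. (b j)\<^sup>2) = 1" "sigma_min M = L2_set (\<lambda>i. \<Sum>j<m. M $$ (i, j) * b j) {..<n}"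
proof -
  define N where "N = transpose_mat M * M"
  have N: "N \<in> carrier_mat m m" using M by (simp add: N_def)
  have Nij: "N $$ (i, j) = (\<Sum>l<n. M $$ (l, i) * M $$ (l, j))" if "i < m" "j < m" for i j
    using that M by (simp add: N_def scalar_prod_def atLeast0LessThan)
  have deg: "degree (char_poly N) = m" "char_poly N \<noteq> 0"
    using degree_monic_char_poly[OF N] by auto
  have "size (proots (char_poly N)) = m"
    using size_proots_real_rooted[OF deg(2)] symmetric_real_eigenvalue[OF N] Nij deg
    by (simp add: mult.commute)
  hence "length (singular_values M) = m"
    unfolding singular_values_def N_def[symmetric] by (simp flip: size_mset)
  hence "sigma_min M \<in> set (singular_values M)"
    unfolding sigma_min_def using m M by (intro nth_mem) auto
  also have "set (singular_values M) = sqrt ` {x. poly (char_poly N) x = 0}"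
    unfolding singular_values_def N_def[symmetric] using deg by simp
  finally obtain x where x: "sigma_min M = sqrt x" "poly (char_poly N) x = 0" by auto
  hence "eigenvalue N x" using eigenvalue_root_char_poly[OF N] by simp
  then obtain v where v: "v \<in> carrier_vec m" "v \<noteq> 0\<^sub>v m" "N *\<^sub>v v = x \<cdot>\<^sub>v v"
    using N by (auto simp: eigenvalue_def eigenvector_def)
  define V where "V = (\<Sum>j<m. (v $ j)\<^sup>2)"
  have row: "(\<Sum>j<m. N $$ (i, j) * v $ j) = x * v $ i" if i: "i < m" for i
  proof -
    have "(N *\<^sub>v v) $ i = (\<Sum>j<m. N $$ (i, j) * v $ j)"
      using i N v(1) by (simp add: scalar_prod_def atLeast0LessThan)
    thus ?thesis unfolding v(3) using v(1) i by simp
  qed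
  have "(\<Sum>l<n. (\<Sum>j<m. M $$ (l, j) * v $ j)\<^sup>2)
      = (\<Sum>l<n. \<Sum>i<m. \<Sum>j<m. v $ i * (M $$ (l, i) * M $$ (l, j) * v $ j))"
    by (simp add: power2_eq_square sum_product mult_ac)
  also have "\<dots> = (\<Sum>i<m. \<Sum>l<n. \<Sum>j<m. v $ i * (M $$ (l, i) * M $$ (l, j) * v $ j))"
    by (rule sum.swap)
  also have "\<dots> = (\<Sum>i<m. \<Sum>j<m. \<Sum>l<n. v $ i * (M $$ (l, i) * M $$ (l, j) * v $ j))"
    by (intro sum.cong refl sum.swap)
  also have "\<dots> = (\<Sum>i<m. v $ i * (\<Sum>j<m. N $$ (i, j) * v $ j))"
    by (simp add: Nij sum_distrib_left sum_distrib_right)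
  also have "\<dots> = (\<Sum>i<m. v $ i * (x * v $ i))" by (intro sum.cong refl) (simp add: row)
  also have "\<dots> = x * V"
    unfolding V_def by (simp add: sum_distrib_left power2_eq_square mult_ac)
  finally have xV: "(\<Sum>l<n. (\<Sum>j<m. M $$ (l, j) * v $ j)\<^sup>2) = x * V" .
  have "\<exists>i<m. v $ i \<noteq> 0"
  proof (rule ccontr)
    assume "\<not> ?thesis"
    hence "v = 0\<^sub>v m" using v(1) by (intro eq_vecI) auto
    thus False using v by simp
  qed
  then obtain i where i: "i < m" "v $ i \<noteq> 0" by auto
  have "0 < (v $ i)\<^sup>2" using i by simp
  also have "\<dots> \<le> V" unfolding V_def using i by (intro member_le_sum) auto
  finally have V: "0 < V" .
  show ?thesis
  proof
    show "(\<Sum>j<m. (v $ j / sqrt V)\<^sup>2) = 1"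
      using V by (simp add: power_divide V_def flip: sum_divide_distrib)
    have "(\<Sum>l<n. (\<Sum>j<m. M $$ (l, j) * (v $ j / sqrt V))\<^sup>2) = (\<Sum>l<n. (\<Sum>j<m. M $$ (l, j) * v $ j)\<^sup>2) / V"
      using V by (simp add: power_divide flip: sum_divide_distrib)
    also have "\<dots> = x" unfolding xV using V by simp
    finally show "sigma_min M = L2_set (\<lambda>i. \<Sum>j<m. M $$ (i, j) * (v $ j / sqrt V)) {..<n}"
      unfolding L2_set_def x(1) by simp
  qed
qed

text \<open>Here \<open>q\<close> stands for \<open>sqrt \<gamma>\<close>, \<open>\<rho>\<close> for
  the minimal column variance ratio and \<open>x\<close> for \<open>\<delta> powr (1 / 4)\<close>.
  After division by \<open>sqrt d\<close> the two factors under the root differ from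
  \<open>1 - q\<close> and \<open>\<rho> - q\<close> by a multiple of \<open>x / c0\<close>.\<close>

lemma normalized_lower_bound:
  fixes q \<rho> x d c0 \<delta> :: real
  assumes c0: "0 < c0" "c0 \<le> q" "q \<le> 1 - c0" "q + c0 \<le> \<rho>" "\<rho> \<le> 1"
    and x: "0 < x" "15 * x \<le> c0\<^sup>2" and \<delta>: "0 \<le> \<delta>" "\<delta> \<le> x" and d: "1 / x\<^sup>2 \<le> d"
    and y0: "y0 = sqrt (q * d * (1 + 12 * x))"
    and R: "R = (q\<^sup>2 + 2 * \<delta>) * d" and C: "C = (1 + 2 * \<delta>) * d" and c: "c = (\<rho> - 2 * \<delta>) * d"
  shows "R < y0\<^sup>2"
    and "sqrt ((1 - q) * (\<rho> - q)) - 20 / c0\<^sup>2 * x \<le>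
      (sqrt ((1 - R / y0\<^sup>2) * (c / (y0\<^sup>2 + 1) - 1)) * y0 - sqrt (R * C) / y0\<^sup>2) / sqrt d"
proof -
  define A B where "A = 1 - q" and "B = \<rho> - q"
  have c01: "c0 \<le> 1" using c0 by simp
  have c0sq: "c0\<^sup>2 \<le> c0" using c0(1) c01 by (simp add: power2_eq_square mult_left_le)
  have x1: "15 * x \<le> c0" "x \<le> 1" using x c0sq c01 by auto
  have q: "0 < q" "q \<le> 1" using c0 by auto
  have dpos: "0 < d" using d x by (smt (verit) divide_pos_pos zero_less_power)
  have AB: "c0 \<le> A" "A \<le> 1" "c0 \<le> B" "B \<le> 1" using c0 q by (auto simp: A_def B_def)
  have y2: "y0\<^sup>2 = q * d * (1 + 12 * x)" unfolding y0 using q dpos x by simp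
  have y2ge: "q * d \<le> y0\<^sup>2" unfolding y2 using q dpos x by simp
  have qd: "0 < q * d" using q dpos by simp
  have y2pos: "0 < y0\<^sup>2" using y2ge qd by linarith
  have y0pos: "0 < y0" unfolding y0 using q dpos x by simp
  have iq: "1 / q \<le> 1 / c0" using c0 by (simp add: frac_le)
  have Ry: "R / y0\<^sup>2 \<le> q + 2 * x / c0"
  proof -
    have "R / y0\<^sup>2 \<le> R / (q * d)"
      using y2ge qd y2pos dpos \<delta> unfolding R by (intro divide_left_mono) auto
    also have "\<dots> = q + 2 * \<delta> * (1 / q)" unfolding R using q dpos by (simp add: field_simps power2_eq_square)
    also have "\<dots> \<le> q + 2 * x * (1 / c0)" using \<delta> iq c0 by (intro add_left_mono mult_mono) auto
    finally show ?thesis by simp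
  qed
  have e1: "2 * x / c0 < c0" using x c0(1) by (simp add: divide_less_eq power2_eq_square)
  have first: "A - 2 * x / c0 \<le> 1 - R / y0\<^sup>2" using Ry by (simp add: A_def)
  have first_pos: "0 < A - 2 * x / c0" using e1 AB by simp
  have "R / y0\<^sup>2 < 1" using first first_pos by simp
  thus "R < y0\<^sup>2" using y2pos by (simp add: divide_less_eq)
  have id: "1 / d \<le> x"
  proof -
    have "1 / d \<le> x\<^sup>2" using d x dpos by (simp add: field_simps)
    also have "\<dots> \<le> x" using x x1 by (simp add: power2_eq_square mult_left_le)
    finally show ?thesis .
  qed
  have iy: "1 / y0\<^sup>2 \<le> x / c0"
  proof -
    have "1 / y0\<^sup>2 \<le> 1 / (q * d)" using y2ge y2pos q dpos by (intro divide_left_mono mult_pos_pos) simp_all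
    also have "\<dots> = (1 / q) * (1 / d)" by simp
    also have "\<dots> \<le> (1 / c0) * x" using iq id q dpos c0 by (intro mult_mono) auto
    finally show ?thesis by simp
  qed
  \<comment> \<open>The losses are \<open>2 * \<delta>\<close> from concentration,
    \<open>12 * x\<close> from the choice of \<open>y0\<close>, and \<open>x / c0\<close> from the
    \<open>+ 1\<close> in the denominator.\<close>
  have second: "B - 15 * x / c0 \<le> (c / (y0\<^sup>2 + 1) - 1) * (y0\<^sup>2 / d)"
  proof -
    define r where "r = \<rho> - 2 * \<delta>"
    have r: "0 \<le> r" "r \<le> 1" using c0 \<delta> x1 q by (auto simp: r_def)
    have y1: "1 - 1 / y0\<^sup>2 \<le> y0\<^sup>2 / (y0\<^sup>2 + 1)"
      using y2pos by (simp add: field_simps add_pos_pos)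
    have "r - 1 / y0\<^sup>2 \<le> r * (1 - 1 / y0\<^sup>2)"
      using r y2pos mult_right_mono[of r 1 "1 / y0\<^sup>2"] by (simp add: algebra_simps)
    also have "\<dots> \<le> r * (y0\<^sup>2 / (y0\<^sup>2 + 1))" by (rule mult_left_mono[OF y1 r(1)])
    also have "\<dots> = c / (y0\<^sup>2 + 1) * (y0\<^sup>2 / d)" unfolding c r_def using dpos by simp
    finally have 1: "r - 1 / y0\<^sup>2 \<le> c / (y0\<^sup>2 + 1) * (y0\<^sup>2 / d)" .
    have "y0\<^sup>2 / d = q + 12 * (q * x)" unfolding y2 using dpos by (simp add: field_simps)
    also have "\<dots> \<le> q + 12 * (1 * x)" using q x by (intro add_left_mono mult_left_mono mult_right_mono) auto
    finally have 2: "y0\<^sup>2 / d \<le> q + 12 * x" by simp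
    have 3: "14 * x \<le> 14 * x / c0" using x c0(1) c01 by (simp add: le_divide_eq mult_left_le)
    have "B - 15 * x / c0 \<le> r - 1 / y0\<^sup>2 - (q + 12 * x)"
      using iy 3 \<delta> by (simp add: B_def r_def)
    also have "\<dots> \<le> c / (y0\<^sup>2 + 1) * (y0\<^sup>2 / d) - y0\<^sup>2 / d" using 1 2 by simp
    also have "\<dots> = (c / (y0\<^sup>2 + 1) - 1) * (y0\<^sup>2 / d)" by (simp add: algebra_simps)
    finally show ?thesis .
  qed
  have second_nn: "0 \<le> B - 15 * x / c0"
  proof -
    have "15 * x / c0 \<le> c0" using x c0(1) by (simp add: divide_le_eq power2_eq_square)
    thus ?thesis using AB(3) by simp
  qed
  define G where "G = (1 - R / y0\<^sup>2) * ((c / (y0\<^sup>2 + 1) - 1) * (y0\<^sup>2 / d))"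
  have G: "(A - 2 * x / c0) * (B - 15 * x / c0) \<le> G"
    unfolding G_def using first second first_pos second_nn by (intro mult_mono) auto
  have G0: "0 \<le> G" using G first_pos second_nn by (smt (verit) mult_nonneg_nonneg)
  \<comment> \<open>17 = 2 + 15 adds the losses of the two factors. The second division by
    \<open>c0\<close> comes from taking the root: since \<open>S\<close> is at least
    \<open>c0\<close>, the loss \<open>w * c0\<close> in the square costs at most
    \<open>w\<close>.\<close>
  define S w where "S = sqrt (A * B)" and "w = 17 * x / c0\<^sup>2"
  have S2: "S\<^sup>2 = A * B" using AB c0(1) by (simp add: S_def)
  have Sc: "c0 \<le> S"
    unfolding S_def using AB c0(1) by (intro real_le_rsqrt) (auto simp: power2_eq_square intro: mult_mono)
  have w: "0 \<le> w" "w * c0 = 17 * x / c0" using x c0(1) by (auto simp: w_def power2_eq_square)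
  have "S\<^sup>2 - w * c0 \<le> (A - 2 * x / c0) * (B - 15 * x / c0)"
  proof -
    define z where "z = x / c0"
    have z: "0 \<le> z" using x c0(1) by (simp add: z_def)
    have "A * z \<le> z" "B * z \<le> z" using AB z c0(1) by (auto intro!: mult_left_le_one_le)
    moreover have "0 \<le> z * z" by simp
    moreover have "(A - 2 * z) * (B - 15 * z) = A * B - 15 * (A * z) - 2 * (B * z) + 30 * (z * z)"
      by (simp add: algebra_simps)
    ultimately have "A * B - 17 * z \<le> (A - 2 * z) * (B - 15 * z)" by linarith
    thus ?thesis unfolding S2 w(2) z_def by simp
  qed
  hence Gw: "S\<^sup>2 - w * c0 \<le> G" using G by simp
  have main: "S - w \<le> sqrt G"
  proof (cases "w \<le> S")
    case True
    have "(S - w)\<^sup>2 = S\<^sup>2 - w * S - w * (S - w)" by (simp add: power2_eq_square algebra_simps)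
    also have "\<dots> \<le> S\<^sup>2 - w * c0"
    proof -
      have "w * c0 \<le> w * S" "0 \<le> w * (S - w)"
        using True Sc w(1) by (auto intro!: mult_left_mono mult_nonneg_nonneg)
      thus ?thesis by linarith
    qed
    finally show ?thesis using Gw by (intro real_le_rsqrt) simp
  next
    case False
    have "0 \<le> sqrt G" using G0 by simp
    thus ?thesis using False by linarith
  qed
  have "sqrt ((1 - R / y0\<^sup>2) * (c / (y0\<^sup>2 + 1) - 1)) * y0 / sqrt d = sqrt G"
  proof -
    have "sqrt G = sqrt ((1 - R / y0\<^sup>2) * (c / (y0\<^sup>2 + 1) - 1) * (y0\<^sup>2 / d))" by (simp add: G_def mult.assoc)
    also have "\<dots> = sqrt ((1 - R / y0\<^sup>2) * (c / (y0\<^sup>2 + 1) - 1)) * (y0 / sqrt d)"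
      using y0pos by (simp only: real_sqrt_mult real_sqrt_divide) (simp add: real_sqrt_mult)
    finally show ?thesis by simp
  qed
  moreover have "sqrt (R * C) / y0\<^sup>2 / sqrt d \<le> 3 * x / c0"
  proof -
    have R3: "0 \<le> R" "R \<le> 3 * d" and C3: "0 \<le> C" "C \<le> 3 * d"
    proof -
      have "q\<^sup>2 \<le> 1" using q by (simp add: power_le_one)
      thus "0 \<le> R" "R \<le> 3 * d" unfolding R using \<delta> x1 dpos by auto
      show "0 \<le> C" "C \<le> 3 * d" unfolding C using \<delta> x1 dpos by auto
    qed
    have "R * C \<le> (3 * d)\<^sup>2" unfolding power2_eq_square using R3 C3 by (intro mult_mono) auto
    hence "sqrt (R * C) \<le> 3 * d" using dpos by (intro real_le_lsqrt) auto
    hence "sqrt (R * C) / y0\<^sup>2 / sqrt d \<le> 3 * d / (q * d) / sqrt d"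
      using y2ge qd dpos by (intro divide_right_mono frac_le) auto
    also have "\<dots> = 3 * (1 / q) * (1 / sqrt d)" using dpos q by simp
    also have "\<dots> \<le> 3 * (1 / c0) * x"
    proof (intro mult_mono)
      have "1 / x \<le> sqrt d" using d x by (intro real_le_rsqrt) (simp add: power_divide)
      thus "1 / sqrt d \<le> x" using x dpos by (simp add: field_simps)
    qed (use iq c0 q dpos in auto)
    finally show ?thesis by simp
  qed
  moreover have "3 * x / c0 \<le> 3 * x / c0\<^sup>2"
    using c0sq x c0(1) by (intro divide_left_mono) auto
  ultimately have "S - w - 3 * x / c0\<^sup>2 \<le>
      (sqrt ((1 - R / y0\<^sup>2) * (c / (y0\<^sup>2 + 1) - 1)) * y0 - sqrt (R * C) / y0\<^sup>2) / sqrt d"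
    using main by (simp add: diff_divide_distrib)
  moreover have "w + 3 * x / c0\<^sup>2 = 20 / c0\<^sup>2 * x" by (simp add: w_def flip: add_divide_distrib)
  ultimately show "sqrt ((1 - q) * (\<rho> - q)) - 20 / c0\<^sup>2 * x \<le>
      (sqrt ((1 - R / y0\<^sup>2) * (c / (y0\<^sup>2 + 1) - 1)) * y0 - sqrt (R * C) / y0\<^sup>2) / sqrt d"
    unfolding S_def A_def B_def by linarith
qed

text \<open>The left side collects the logarithmic losses of the trace method:
  \<open>2 * (2 * ln n) ^ 3\<close> from the cube of the walk length and an exponential of
  \<open>sqrt (ln n)\<close> from revisited vertices. The power of \<open>n\<close> is the one
  gained from sparsity.\<close>

lemma eventually_log_small:
  "eventually (\<lambda>n::nat. 16 * ln (real n) ^ 3 * exp (8 * sqrt (ln (real n))) \<le> real n powr (1 / 10)) at_top"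
  by real_asymp

lemma centered_biadjacency_carrier:
  "biadjacency n m E - expected_biadjacency n m p \<in> carrier_mat n m"
  by (rule minus_carrier_mat) (simp add: expected_biadjacency_def)

lemma sigma_min_lower_bound:
  fixes q \<rho> x d c0 \<delta> :: real
  assumes p: "\<And>i j. i < n \<Longrightarrow> j < m \<Longrightarrow> 0 \<le> p i j \<and> p i j \<le> 1" and m: "1 \<le> m"
    and c0: "0 < c0" "c0 \<le> q" "q \<le> 1 - c0" "q + c0 \<le> \<rho>" "\<rho> \<le> 1"
    and x: "0 < x" "15 * x \<le> c0\<^sup>2" and \<delta>: "0 \<le> \<delta>" "\<delta> \<le> x" and d: "1 / x\<^sup>2 \<le> d"
    and y0: "y0 = sqrt (q * d * (1 + 12 * x))"
    and frob: "nb_frobenius ({..<n} <+> {..<m})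
      (\<lambda>u v. side_sign u * on_edges n m (centered_entry p E) {u, v}) k < y0 ^ (2 * k)"
    and row: "\<And>i. i < n \<Longrightarrow> (\<Sum>j<m. (centered_entry p E i j)\<^sup>2) \<le> (q\<^sup>2 + 2 * \<delta>) * d"
    and col: "\<And>j. j < m \<Longrightarrow> (\<Sum>i<n. (centered_entry p E i j)\<^sup>2) \<le> (1 + 2 * \<delta>) * d"
    and col_min: "\<And>j. j < m \<Longrightarrow> (\<rho> - 2 * \<delta>) * d \<le> (\<Sum>i<n. (centered_entry p E i j)\<^sup>2)"
  shows "sqrt ((1 - q) * (\<rho> - q)) - 20 / c0\<^sup>2 * x
    \<le> 1 / sqrt d * sigma_min (biadjacency n m E - expected_biadjacency n m p)"
proof -
  let ?M = "biadjacency n m E - expected_biadjacency n m p"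
  note M = centered_biadjacency_carrier[of n m E p]
  note num = normalized_lower_bound[OF c0 x \<delta> d y0 refl refl refl]
  have "0 < 1 / x\<^sup>2" using x by simp
  hence dpos: "0 < d" using d by linarith
  have q: "0 < q" using c0 by simp
  have y0pos: "0 < y0" unfolding y0 using q dpos x by simp
  have h: "\<bar>centered_entry p E i j\<bar> \<le> 1" if "i < n" "j < m" for i j
    using p[OF that] by (auto simp: centered_entry_def abs_le_iff)
  obtain b where b: "(\<Sum>j<m. (b j)\<^sup>2) = 1" "sigma_min ?M = L2_set (\<lambda>i. \<Sum>j<m. ?M $$ (i, j) * b j) {..<n}"
    using sigma_min_cases[OF M m] by blast
  have "sigma_min ?M = L2_set (\<lambda>i. \<Sum>j<m. centered_entry p E i j * b j) {..<n}"
    unfolding b(2) by (intro L2_set_cong refl sum.cong) (simp add: centered_biadjacency_index[OF p])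
  also have "\<dots> \<ge> sqrt ((1 - (q\<^sup>2 + 2 * \<delta>) * d / y0\<^sup>2) * ((\<rho> - 2 * \<delta>) * d / (y0\<^sup>2 + 1) - 1)) * y0
      - sqrt ((q\<^sup>2 + 2 * \<delta>) * d * ((1 + 2 * \<delta>) * d)) / y0\<^sup>2"
    by (rule L2_norm_lower_bound[OF y0pos h row _ num(1) col col_min frob b(1)])
       (use q \<delta> dpos in auto)
  finally have "(sqrt ((1 - (q\<^sup>2 + 2 * \<delta>) * d / y0\<^sup>2) * ((\<rho> - 2 * \<delta>) * d / (y0\<^sup>2 + 1) - 1)) * y0
      - sqrt ((q\<^sup>2 + 2 * \<delta>) * d * ((1 + 2 * \<delta>) * d)) / y0\<^sup>2) / sqrt d \<le> sigma_min ?M / sqrt d"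
    using dpos by (intro divide_right_mono) auto
  with num(2) show ?thesis by simp
qed

section \<open>Probabilities of the exceptional events\<close>

lemma nb_frobenius_nonneg: "0 \<le> nb_frobenius V H k"
  unfolding nb_frobenius_def by (intro sum_nonneg) auto

lemma row_concentration:
  assumes p: "\<And>i j. i < n \<Longrightarrow> j < m \<Longrightarrow> 0 \<le> p i j \<and> p i j \<le> 1" and i: "i < n"
    and row: "(\<Sum>j<m. p i j) \<le> r * d" "r \<le> 1" and d: "0 < d" and \<delta>: "0 < \<delta>" "\<delta> \<le> 1"
  shows "measure_pmf.prob (inhom_er_bipartite n m p)
      {E. \<not> (\<Sum>j<m. (centered_entry p E i j)\<^sup>2) \<le> (r + 2 * \<delta>) * d} \<le> exp (- (\<delta>\<^sup>2 * d))"
proof -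
  let ?\<mu> = "\<Sum>j<m. p i j * (1 - p i j)"
  have "?\<mu> \<le> (\<Sum>j<m. p i j)" using p[OF i] by (intro sum_mono) (auto simp: mult_left_le)
  hence \<mu>: "?\<mu> \<le> r * d" using row by simp
  also have "\<dots> \<le> d" using row d mult_right_mono[of r 1 d] by simp
  finally have \<mu>d: "?\<mu> \<le> d" .
  have J: "(\<Sum>(i, j)\<in>{i} \<times> {..<m}. f i j) = (\<Sum>j<m. f i j)" for f :: "nat \<Rightarrow> nat \<Rightarrow> real"
    by (simp flip: sum.cartesian_product)
  have "measure_pmf.prob (inhom_er_bipartite n m p)
      {E. \<not> (\<Sum>j<m. (centered_entry p E i j)\<^sup>2) \<le> (r + 2 * \<delta>) * d}
    \<le> measure_pmf.prob (inhom_er_bipartite n m p)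
      {E. \<delta> * (\<Sum>(i, j)\<in>{i} \<times> {..<m}. (centered_entry p E i j)\<^sup>2)
          \<ge> \<delta> * (\<Sum>(i, j)\<in>{i} \<times> {..<m}. p i j * (1 - p i j)) + 2 * \<delta>\<^sup>2 * d}"
  proof (rule measure_pmf.finite_measure_mono)
    show "{E. \<not> (\<Sum>j<m. (centered_entry p E i j)\<^sup>2) \<le> (r + 2 * \<delta>) * d} \<subseteq>
      {E. \<delta> * (\<Sum>(i, j)\<in>{i} \<times> {..<m}. (centered_entry p E i j)\<^sup>2)
          \<ge> \<delta> * (\<Sum>(i, j)\<in>{i} \<times> {..<m}. p i j * (1 - p i j)) + 2 * \<delta>\<^sup>2 * d}"
      unfolding J
    proof safe
      fix E assume "\<not> (\<Sum>j<m. (centered_entry p E i j)\<^sup>2) \<le> (r + 2 * \<delta>) * d"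
      hence "?\<mu> + 2 * \<delta> * d \<le> (\<Sum>j<m. (centered_entry p E i j)\<^sup>2)" using \<mu> by (simp add: algebra_simps)
      hence "\<delta> * (?\<mu> + 2 * \<delta> * d) \<le> \<delta> * (\<Sum>j<m. (centered_entry p E i j)\<^sup>2)"
        using \<delta> by (intro mult_left_mono) auto
      thus "\<delta> * ?\<mu> + 2 * \<delta>\<^sup>2 * d \<le> \<delta> * (\<Sum>j<m. (centered_entry p E i j)\<^sup>2)"
        by (simp add: algebra_simps power2_eq_square)
    qed
  qed simp
  also have "\<dots> \<le> exp (- (\<delta>\<^sup>2 * d))"
    by (rule chernoff_inhom_er_bipartite[OF p]) (use i \<delta> \<mu>d in \<open>auto simp: J\<close>)
  finally show ?thesis .
qed

lemma column_concentration:
  assumes p: "\<And>i j. i < n \<Longrightarrow> j < m \<Longrightarrow> 0 \<le> p i j \<and> p i j \<le> 1" and j: "j < m"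
    and col: "(\<Sum>i<n. p i j) \<le> d" and col_min: "\<rho> * d \<le> (\<Sum>i<n. p i j * (1 - p i j))"
    and \<delta>: "0 < \<delta>" "\<delta> \<le> 1"
  shows "measure_pmf.prob (inhom_er_bipartite n m p)
      {E. \<not> (\<Sum>i<n. (centered_entry p E i j)\<^sup>2) \<le> (1 + 2 * \<delta>) * d} \<le> exp (- (\<delta>\<^sup>2 * d))" (is ?upper)
    and "measure_pmf.prob (inhom_er_bipartite n m p)
      {E. \<not> (\<rho> - 2 * \<delta>) * d \<le> (\<Sum>i<n. (centered_entry p E i j)\<^sup>2)} \<le> exp (- (\<delta>\<^sup>2 * d))" (is ?lower)
proof -
  let ?\<mu> = "\<Sum>i<n. p i j * (1 - p i j)"
  have "?\<mu> \<le> (\<Sum>i<n. p i j)" using p[OF _ j] by (intro sum_mono) (auto simp: mult_left_le)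
  hence \<mu>: "?\<mu> \<le> d" using col by simp
  have J: "(\<Sum>(i, j)\<in>{..<n} \<times> {j}. f i j) = (\<Sum>i<n. f i j)" for f :: "nat \<Rightarrow> nat \<Rightarrow> real"
    by (simp flip: sum.cartesian_product)
  have ch: "measure_pmf.prob (inhom_er_bipartite n m p)
      {E. t * (\<Sum>i<n. (centered_entry p E i j)\<^sup>2) \<ge> t * ?\<mu> + 2 * t\<^sup>2 * d} \<le> exp (- (t\<^sup>2 * d))" if "\<bar>t\<bar> \<le> 1" for t
    using chernoff_inhom_er_bipartite[where p = p and n = n and m = m and J = "{..<n} \<times> {j}" and t = t and D = d, OF p] that j \<mu> unfolding J by auto
  have "measure_pmf.prob (inhom_er_bipartite n m p)
      {E. \<not> (\<Sum>i<n. (centered_entry p E i j)\<^sup>2) \<le> (1 + 2 * \<delta>) * d}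
    \<le> measure_pmf.prob (inhom_er_bipartite n m p)
      {E. \<delta> * (\<Sum>i<n. (centered_entry p E i j)\<^sup>2) \<ge> \<delta> * ?\<mu> + 2 * \<delta>\<^sup>2 * d}"
  proof (rule measure_pmf.finite_measure_mono, safe)
    fix E assume "\<not> (\<Sum>i<n. (centered_entry p E i j)\<^sup>2) \<le> (1 + 2 * \<delta>) * d"
    hence "?\<mu> + 2 * \<delta> * d \<le> (\<Sum>i<n. (centered_entry p E i j)\<^sup>2)" using \<mu> by (simp add: algebra_simps)
    hence "\<delta> * (?\<mu> + 2 * \<delta> * d) \<le> \<delta> * (\<Sum>i<n. (centered_entry p E i j)\<^sup>2)"
      using \<delta> by (intro mult_left_mono) auto
    thus "\<delta> * ?\<mu> + 2 * \<delta>\<^sup>2 * d \<le> \<delta> * (\<Sum>i<n. (centered_entry p E i j)\<^sup>2)"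
      by (simp add: algebra_simps power2_eq_square)
  qed simp
  also have "\<dots> \<le> exp (- (\<delta>\<^sup>2 * d))" using ch[of \<delta>] \<delta> by simp
  finally show ?upper .
  have "measure_pmf.prob (inhom_er_bipartite n m p)
      {E. \<not> (\<rho> - 2 * \<delta>) * d \<le> (\<Sum>i<n. (centered_entry p E i j)\<^sup>2)}
    \<le> measure_pmf.prob (inhom_er_bipartite n m p)
      {E. (- \<delta>) * (\<Sum>i<n. (centered_entry p E i j)\<^sup>2) \<ge> (- \<delta>) * ?\<mu> + 2 * (- \<delta>)\<^sup>2 * d}"
  proof (rule measure_pmf.finite_measure_mono, safe)
    fix E assume "\<not> (\<rho> - 2 * \<delta>) * d \<le> (\<Sum>i<n. (centered_entry p E i j)\<^sup>2)"
    hence "(\<Sum>i<n. (centered_entry p E i j)\<^sup>2) \<le> ?\<mu> - 2 * \<delta> * d" using col_min by (simp add: algebra_simps)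
    hence "\<delta> * (\<Sum>i<n. (centered_entry p E i j)\<^sup>2) \<le> \<delta> * (?\<mu> - 2 * \<delta> * d)"
      using \<delta> by (intro mult_left_mono) auto
    thus "(- \<delta>) * ?\<mu> + 2 * (- \<delta>)\<^sup>2 * d \<le> (- \<delta>) * (\<Sum>i<n. (centered_entry p E i j)\<^sup>2)"
      by (simp add: algebra_simps power2_eq_square)
  qed simp
  also have "\<dots> \<le> exp (- (\<delta>\<^sup>2 * d))" using ch[of "- \<delta>"] \<delta> by simp
  finally show ?lower .
qed

text \<open>Markov's inequality. With \<open>s^2 = 1 / (q * d)\<close> the expected norm divided by
  \<open>y0 ^ (2 * k)\<close> is of order \<open>n^2 / (1 + 12 * x) ^ k\<close>, and
  \<open>k\<close> is chosen as the length at which the power wins.\<close>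

lemma frobenius_tail:
  fixes q d x :: real
  assumes p: "\<And>i j. i < n \<Longrightarrow> j < m \<Longrightarrow> 0 \<le> p i j \<and> p i j \<le> 1" and nm: "m \<le> n" "1 \<le> m"
    and P: "\<And>i j. i < n \<Longrightarrow> j < m \<Longrightarrow> p i j \<le> P" "0 \<le> P"
    and q: "0 < q" "q \<le> 1" and qd: "1 \<le> q * d"
    and row: "\<And>i. i < n \<Longrightarrow> (\<Sum>j<m. p i j) \<le> q\<^sup>2 * d"
    and col: "\<And>j. j < m \<Longrightarrow> (\<Sum>i<n. p i j) \<le> d"
    and x: "0 < x" "6 * x \<le> 1" and dx: "1 / x\<^sup>2 \<le> d" and dln: "4 * ln n \<le> x\<^sup>2 * (q * d)"
    and sparse: "d powr (7 / 2) * P \<le> real n powr (- 1 / 10)"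
    and large: "16 * ln n ^ 3 * exp (8 * sqrt (ln n)) \<le> real n powr (1 / 10)" "1 \<le> ln n"
    and y0: "y0 = sqrt (q * d * (1 + 12 * x))" and k: "k = nat \<lceil>ln n / x\<rceil>"
  shows "measure_pmf.prob (inhom_er_bipartite n m p) {E. \<not> nb_frobenius ({..<n} <+> {..<m})
      (\<lambda>u v. side_sign u * on_edges n m (centered_entry p E) {u, v}) k < y0 ^ (2 * k)}
    \<le> 4 * exp 4 / q / real n ^ 4"
proof -
  define s where "s = 1 / sqrt (q * d)"
  define L where "L = ln (real n)"
  have L: "1 \<le> L" using large by (simp add: L_def)
  have n: "0 < real n" using nm by simp
  have dpos: "0 < d" using qd q by (smt (verit) zero_less_mult_pos)
  have s0: "0 < s" using qd by (simp add: s_def)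
  have s1: "s \<le> 1" using qd by (simp add: s_def)
  have s2: "s\<^sup>2 = 1 / (q * d)" using q dpos by (simp add: s_def power_divide)
  have Lx: "1 \<le> L / x" using L x by (simp add: le_divide_eq)
  have kge: "L / x \<le> k" unfolding k L_def by linarith
  have kle: "k \<le> 2 * L / x"
  proof -
    have "real k \<le> L / x + 1" using Lx unfolding k L_def by linarith
    thus ?thesis using Lx by simp
  qed
  have k0: "0 < k" using kge Lx by (metis gr0I not_one_le_zero of_nat_0 order_trans)
  \<comment> \<open>This is where the degree must exceed a multiple of \<open>ln n / x^2\<close>: it
    keeps \<open>exp (4 * s * k)\<close> below every fixed power of \<open>n\<close>.\<close>
  have ks: "s * k \<le> sqrt L"
  proof -
    have "(2 / x)\<^sup>2 * L \<le> q * d" using dln x by (simp add: L_def power_divide field_simps)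
    hence "sqrt ((2 / x)\<^sup>2 * L) \<le> sqrt (q * d)" by simp
    hence "2 / x * sqrt L \<le> sqrt (q * d)" using x by (simp add: real_sqrt_mult)
    hence "s * (2 / x * sqrt L) \<le> s * sqrt (q * d)" using s0 by (intro mult_left_mono) auto
    also have "\<dots> = 1" using q dpos by (simp add: s_def)
    finally have "s * (2 / x * sqrt L) \<le> 1" .
    hence "s * (2 / x * sqrt L) * sqrt L \<le> 1 * sqrt L" using L by (intro mult_right_mono) auto
    hence "s * (2 * L / x) \<le> sqrt L" using L by (simp add: mult.assoc)
    moreover have "s * k \<le> s * (2 * L / x)" using kle s0 by (intro mult_left_mono) auto
    ultimately show ?thesis by simp
  qed
  have small: "2 * real k ^ 3 * P * exp (4 * s * k) \<le> sqrt (q\<^sup>2) * s ^ 4"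
  proof -
    have "real k ^ 3 \<le> (2 * L / x) ^ 3" using kle by (intro power_mono) auto
    also have "\<dots> = 8 * L ^ 3 * (1 / x ^ 3)" by (simp add: power_divide power_mult_distrib)
    also have "1 / x ^ 3 \<le> d powr (3 / 2)"
    proof -
      have "1 / x ^ 3 = x powr (- 3)" using x by (simp add: powr_minus powr_numeral divide_simps)
      also have "\<dots> = (x powr (- 2)) powr (3 / 2)" by (simp add: powr_powr)
      also have "\<dots> = (1 / x\<^sup>2) powr (3 / 2)" using x by (simp add: powr_minus powr_numeral divide_simps)
      also have "\<dots> \<le> d powr (3 / 2)" using dx x by (intro powr_mono2) auto
      finally show ?thesis .
    qed
    finally have k3: "real k ^ 3 \<le> 8 * L ^ 3 * d powr (3 / 2)" using L by simp
    have ek: "exp (4 * s * k) \<le> exp (8 * sqrt L)"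
    proof -
      have "0 \<le> sqrt L" using L by simp
      hence "4 * (s * k) \<le> 8 * sqrt L" using ks by linarith
      thus ?thesis by (simp add: mult.assoc)
    qed
    have "2 * real k ^ 3 * P * exp (4 * s * k) * d\<^sup>2
        \<le> 2 * (8 * L ^ 3 * d powr (3 / 2)) * P * exp (8 * sqrt L) * d\<^sup>2"
      using k3 ek P L by (intro mult_right_mono mult_mono) auto
    also have "\<dots> = (16 * L ^ 3 * exp (8 * sqrt L)) * ((d powr (3 / 2) * d\<^sup>2) * P)"
      by (simp add: mult_ac)
    \<comment> \<open>The exponent in the sparsity condition: 3/2 comes from \<open>k ^ 3\<close>
      through \<open>1 / x^2 \<le> d\<close>, and 2 from \<open>s ^ 4\<close>.\<close>
    also have "d powr (3 / 2) * d\<^sup>2 = d powr (7 / 2)"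
      using dpos by (simp add: powr_add[symmetric] flip: powr_numeral)
    also have "(16 * L ^ 3 * exp (8 * sqrt L)) * (d powr (7 / 2) * P) \<le> real n powr (1 / 10) * real n powr (- 1 / 10)"
      using large(1) sparse P L unfolding L_def by (intro mult_mono) auto
    also have "\<dots> = 1" using n by (simp flip: powr_add)
    finally have "2 * real k ^ 3 * P * exp (4 * s * k) \<le> 1 / d\<^sup>2" using dpos by (simp add: field_simps)
    also have "\<dots> \<le> 1 / q * (1 / d\<^sup>2)" using q mult_right_mono[of 1 "1 / q" "1 / d\<^sup>2"] by simp
    also have "\<dots> = q * (s\<^sup>2)\<^sup>2" unfolding s2 using q dpos by (simp add: field_simps power2_eq_square)
    also have "\<dots> = sqrt (q\<^sup>2) * s ^ 4" using q by simp
    finally show ?thesis .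
  qed
  let ?F = "\<lambda>E. nb_frobenius ({..<n} <+> {..<m}) (\<lambda>u v. side_sign u * on_edges n m (centered_entry p E) {u, v}) k"
  have y0pos: "0 < y0" unfolding y0 using q dpos x by simp
  have "measure_pmf.expectation (inhom_er_bipartite n m p) ?F
      \<le> (real n + real m)\<^sup>2 * exp 4 / (sqrt (q\<^sup>2) * s ^ (2 * k))"
    by (rule expectation_nb_frobenius_bipartite[OF p P, where \<gamma> = "q\<^sup>2" and d = d])
       (use q s0 s1 k0 small row col in \<open>auto simp: s2 power_le_one dpos[THEN less_imp_neq, THEN not_sym]\<close>)
  also have "sqrt (q\<^sup>2) = q" using q by simp
  finally have EF: "measure_pmf.expectation (inhom_er_bipartite n m p) ?F
      \<le> (real n + real m)\<^sup>2 * exp 4 / (q * s ^ (2 * k))" .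
  have "measure_pmf.prob (inhom_er_bipartite n m p) {E. \<not> ?F E < y0 ^ (2 * k)}
      = measure_pmf.prob (inhom_er_bipartite n m p) {E \<in> space (inhom_er_bipartite n m p). y0 ^ (2 * k) \<le> ?F E}"
    by (simp add: not_less)
  also have "\<dots> \<le> measure_pmf.expectation (inhom_er_bipartite n m p) ?F / y0 ^ (2 * k)"
    by (rule integral_Markov_inequality_measure[where A = "{}"])
       (use y0pos in \<open>auto intro: integrable_inhom_er_bipartite nb_frobenius_nonneg\<close>)
  also have "\<dots> \<le> (real n + real m)\<^sup>2 * exp 4 / (q * s ^ (2 * k)) / y0 ^ (2 * k)"
    using EF y0pos by (intro divide_right_mono) auto
  also have "\<dots> = (real n + real m)\<^sup>2 * exp 4 / q / (s\<^sup>2 * y0\<^sup>2) ^ k"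
    by (simp add: power_mult power_mult_distrib)
  also have "s\<^sup>2 * y0\<^sup>2 = 1 + 12 * x" unfolding s2 y0 using q dpos x by simp
  also have "(real n + real m)\<^sup>2 * exp 4 / q / (1 + 12 * x) ^ k \<le> (2 * real n)\<^sup>2 * exp 4 / q / real n ^ 6"
  proof (intro frac_le divide_right_mono mult_right_mono power_mono)
    \<comment> \<open>The 12 in \<open>y0\<close> serves this estimate. As \<open>x * k\<close> is
      at least \<open>ln n\<close>, the power exceeds \<open>n ^ 6\<close>, which turns the
      prefactor \<open>(2 * n)^2\<close> into order \<open>n^(-4)\<close>.\<close>
    have "exp (6 * x) \<le> 1 + 6 * x + (6 * x)\<^sup>2" using x by (intro exp_le_quadratic) auto
    also have "\<dots> \<le> 1 + 12 * x" using x mult_left_le[of "6 * x" "6 * x"] by (simp add: power2_eq_square)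
    finally have "exp (6 * x) ^ k \<le> (1 + 12 * x) ^ k" by (intro power_mono) auto
    moreover have "real n ^ 6 \<le> exp (6 * x) ^ k"
    proof -
      have "real n ^ 6 = exp (6 * L)" unfolding L_def using n exp_of_nat_mult[of 6 "ln (real n)"] by simp
      also have "\<dots> \<le> exp (6 * (x * k))" using kge x by (simp add: field_simps)
      also have "\<dots> = exp (6 * x) ^ k" by (simp add: mult_ac flip: exp_of_nat_mult)
      finally show ?thesis .
    qed
    ultimately show "real n ^ 6 \<le> (1 + 12 * x) ^ k" by simp
  qed (use nm q n in auto)
  also have "\<dots> = 4 * exp 4 / q / real n ^ 4"
    using n by (simp add: field_simps power2_eq_square eval_nat_numeral)
  finally show ?thesis .
qed

text \<open>A union bound over the trace event, \<open>n\<close> row events and \<open>2 * m\<close>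
  column events, each of probability of order \<open>n^(-4)\<close>; since \<open>m \<le> n\<close>,
  the total is of order \<open>n^(-3)\<close>.\<close>

lemma sigma_min_tail:
  fixes q \<rho> x d c0 \<delta> :: real
  assumes p: "\<And>i j. i < n \<Longrightarrow> j < m \<Longrightarrow> 0 \<le> p i j \<and> p i j \<le> 1" and nm: "m \<le> n" "1 \<le> m"
    and P: "\<And>i j. i < n \<Longrightarrow> j < m \<Longrightarrow> p i j \<le> P" "0 \<le> P"
    and c0: "0 < c0" "c0 \<le> q" "q \<le> 1 - c0" "q + c0 \<le> \<rho>" "\<rho> \<le> 1" and qd: "1 \<le> q * d"
    and row: "\<And>i. i < n \<Longrightarrow> (\<Sum>j<m. p i j) \<le> q\<^sup>2 * d"
    and col: "\<And>j. j < m \<Longrightarrow> (\<Sum>i<n. p i j) \<le> d"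
    and col_min: "\<And>j. j < m \<Longrightarrow> \<rho> * d \<le> (\<Sum>i<n. p i j * (1 - p i j))"
    and x: "0 < x" "15 * x \<le> c0\<^sup>2" and \<delta>: "0 < \<delta>" "\<delta> \<le> x"
    and dx: "1 / x\<^sup>2 \<le> d" and dln: "4 * ln n \<le> \<delta>\<^sup>2 * (q * d)"
    and sparse: "d powr (7 / 2) * P \<le> real n powr (- 1 / 10)"
    and large: "16 * ln n ^ 3 * exp (8 * sqrt (ln n)) \<le> real n powr (1 / 10)" "1 \<le> ln n"
  shows "1 - (4 * exp 4 / c0 + 3) * real n powr (- 3) \<le> measure_pmf.prob (inhom_er_bipartite n m p)
     {E. sqrt ((1 - q) * (\<rho> - q)) - 20 / c0\<^sup>2 * x
      \<le> 1 / sqrt d * sigma_min (biadjacency n m E - expected_biadjacency n m p)}"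
proof -
  let ?G = "inhom_er_bipartite n m p"
  define y0 where "y0 = sqrt (q * d * (1 + 12 * x))"
  define k where "k = nat \<lceil>ln n / x\<rceil>"
  have n: "1 \<le> real n" using nm by simp
  have c01: "c0 \<le> 1" using c0 by simp
  have "c0\<^sup>2 \<le> 1" using c0(1) c01 by (simp add: power_le_one)
  hence x1: "15 * x \<le> 1" using x by simp
  have q: "0 < q" "q \<le> 1" using c0 by auto
  have "0 < 1 / x\<^sup>2" using x by simp
  hence d: "0 < d" using dx by linarith
  have \<delta>1: "\<delta> \<le> 1" using \<delta> x1 by simp
  have \<delta>d: "4 * ln n \<le> \<delta>\<^sup>2 * d"
  proof -
    have "\<delta>\<^sup>2 * (q * d) \<le> \<delta>\<^sup>2 * (1 * d)" using q d by (intro mult_left_mono mult_right_mono) auto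
    thus ?thesis using dln by simp
  qed
  have e: "exp (- (\<delta>\<^sup>2 * d)) \<le> 1 / real n ^ 4"
  proof -
    have "exp (- (\<delta>\<^sup>2 * d)) \<le> exp (- (4 * ln n))" using \<delta>d by simp
    also have "\<dots> = 1 / exp (ln n) ^ 4" by (simp add: exp_minus divide_inverse flip: exp_of_nat_mult)
    also have "exp (ln (real n)) = n" using n by simp
    finally show ?thesis .
  qed
  have dlnx: "4 * ln n \<le> x\<^sup>2 * (q * d)"
  proof -
    have "\<delta>\<^sup>2 * (q * d) \<le> x\<^sup>2 * (q * d)" using \<delta> q d by (intro mult_right_mono power_mono) auto
    thus ?thesis using dln by simp
  qed
  define F where "F = {E. \<not> nb_frobenius ({..<n} <+> {..<m})
      (\<lambda>u v. side_sign u * on_edges n m (centered_entry p E) {u, v}) k < y0 ^ (2 * k)}"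
  define R where "R i = {E. \<not> (\<Sum>j<m. (centered_entry p E i j)\<^sup>2) \<le> (q\<^sup>2 + 2 * \<delta>) * d}" for i
  define U where "U j = {E. \<not> (\<Sum>i<n. (centered_entry p E i j)\<^sup>2) \<le> (1 + 2 * \<delta>) * d}" for j
  define W where "W j = {E. \<not> (\<rho> - 2 * \<delta>) * d \<le> (\<Sum>i<n. (centered_entry p E i j)\<^sup>2)}" for j
  define bad where "bad = F \<union> ((\<Union>i<n. R i) \<union> ((\<Union>j<m. U j) \<union> (\<Union>j<m. W j)))"
  let ?P = "measure_pmf.prob ?G"
  have F: "?P F \<le> 4 * exp 4 / q / real n ^ 4" unfolding F_def
    by (rule frobenius_tail[OF p nm P q qd row col x(1) _ dx dlnx sparse large y0_def k_def]) (use x1 x in auto)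
  have "?P (R i) \<le> 1 / real n ^ 4" if "i < n" for i
    unfolding R_def
    by (rule order_trans[OF row_concentration e]) (use p that row d \<delta> \<delta>1 q in \<open>auto simp: power_le_one\<close>)
  hence R: "(\<Sum>i<n. ?P (R i)) \<le> n * (1 / real n ^ 4)"
    using sum_bounded_above[of "{..<n}" "\<lambda>i. ?P (R i)" "1 / real n ^ 4"] by simp
  have "?P (U j) \<le> 1 / real n ^ 4" if "j < m" for j
    unfolding U_def
    by (rule order_trans[OF column_concentration(1)[where \<rho> = \<rho>] e]) (use p that col col_min \<delta> \<delta>1 in auto)
  hence U: "(\<Sum>j<m. ?P (U j)) \<le> m * (1 / real n ^ 4)"
    using sum_bounded_above[of "{..<m}" "\<lambda>j. ?P (U j)" "1 / real n ^ 4"] by simp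
  have "?P (W j) \<le> 1 / real n ^ 4" if "j < m" for j
    unfolding W_def
    by (rule order_trans[OF column_concentration(2) e]) (use p that col col_min \<delta> \<delta>1 in auto)
  hence W: "(\<Sum>j<m. ?P (W j)) \<le> m * (1 / real n ^ 4)"
    using sum_bounded_above[of "{..<m}" "\<lambda>j. ?P (W j)" "1 / real n ^ 4"] by simp
  have un: "?P (A \<union> B) \<le> ?P A + ?P B" for A B
    by (rule measure_Un_le) auto
  have Un: "?P (\<Union>i<l. A i) \<le> (\<Sum>i<l. ?P (A i))" for A and l :: nat
    by (rule measure_UNION_le) auto
  have "?P bad \<le> ?P F + ((\<Sum>i<n. ?P (R i)) + ((\<Sum>j<m. ?P (U j)) + (\<Sum>j<m. ?P (W j))))"
    unfolding bad_def by (intro order_trans[OF un] add_mono order.refl Un)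
  also have "\<dots> \<le> 4 * exp 4 / q / real n ^ 4 + (n * (1 / real n ^ 4) + (m * (1 / real n ^ 4) + m * (1 / real n ^ 4)))"
    by (intro add_mono F R U W)
  also have "\<dots> \<le> 4 * exp 4 / c0 * (n / real n ^ 4) + (n * (1 / real n ^ 4) + (n * (1 / real n ^ 4) + n * (1 / real n ^ 4)))"
  proof (intro add_mono mult_right_mono order.refl)
    have "4 * exp 4 / q / real n ^ 4 = 4 * exp 4 / q * (1 / real n ^ 4)" by simp
    also have "\<dots> \<le> 4 * exp 4 / c0 * (n / real n ^ 4)"
      using c0 n by (intro mult_mono divide_left_mono divide_right_mono) auto
    finally show "4 * exp 4 / q / real n ^ 4 \<le> 4 * exp 4 / c0 * (n / real n ^ 4)" .
  qed (use nm in auto)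
  also have "\<dots> = (4 * exp 4 / c0 + 3) * (n / real n ^ 4)" by (simp add: algebra_simps)
  also have "n / real n ^ 4 = real n powr (- 3)"
    using n by (simp add: powr_minus powr_numeral field_simps eval_nat_numeral)
  finally have bad: "?P bad \<le> (4 * exp 4 / c0 + 3) * real n powr (- 3)" .
  have "1 - ?P bad = ?P (- bad)"
    using measure_pmf.prob_compl[of bad ?G] by (simp add: Compl_eq_Diff_UNIV)
  also have "\<dots> \<le> ?P {E. sqrt ((1 - q) * (\<rho> - q)) - 20 / c0\<^sup>2 * x
      \<le> 1 / sqrt d * sigma_min (biadjacency n m E - expected_biadjacency n m p)}"
  proof (rule measure_pmf.finite_measure_mono, safe)
    fix E assume E: "E \<notin> bad"
    show "sqrt ((1 - q) * (\<rho> - q)) - 20 / c0\<^sup>2 * x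
      \<le> 1 / sqrt d * sigma_min (biadjacency n m E - expected_biadjacency n m p)"
      by (rule sigma_min_lower_bound[OF p nm(2) c0 x _ \<delta>(2) dx y0_def, where k = k])
         (use E \<delta> in \<open>auto simp: bad_def F_def R_def U_def W_def\<close>)
  qed simp
  finally show ?thesis using bad by linarith
qed

section \<open>Choice of the constants and passage to the expectation\<close>

lemma sigma_min_nonneg:
  assumes "1 \<le> m"
  shows "0 \<le> sigma_min (biadjacency n m E - expected_biadjacency n m p)"
  using sigma_min_cases[OF centered_biadjacency_carrier assms, of n E p] by (metis L2_set_nonneg)

theorem theorem2p4:
  shows "\<exists>C::real. C > 0 \<and> (\<forall>c0::real. 0 < c0 \<and> c0 < 1 \<longrightarrow> (\<exists>K::real. K > 0 \<and>
    (\<forall>(n::nat) (m::nat) (p :: nat \<Rightarrow> nat \<Rightarrow> real) (\<delta>::real).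
      (let G = inhom_er_bipartite n m p;
           EA = expected_biadjacency n m p;
           d = deg_max n m p;
           \<rho>max = rho_max n m p;
           \<rho>tmax = rho_tilde_max n m p;
           \<rho>tmin = rho_tilde_min n m p;
           \<gamma> = aspect_gamma n m p
       in
         n \<ge> m \<and> m \<ge> 1 \<and> (\<forall>i<n. \<forall>j<m. 0 \<le> p i j \<and> p i j \<le> 1) \<and> 0 < \<delta> \<and> \<delta> < 1 \<and>
         \<gamma> \<ge> c0 \<and> d \<ge> \<gamma> powr (- 1 / 2) \<and>
         \<rho>tmax \<ge> \<rho>max \<and> \<rho>tmin > sqrt \<gamma> \<and> min (1 - sqrt \<gamma>) (\<rho>tmin - sqrt \<gamma>) \<ge> c0 \<and>
         d powr (7 / 2) * prob_max n m p \<le> real n powr (- 1 / 10) \<and>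
         d \<ge> C * max (\<delta> powr (- 1 / 2)) (\<delta> powr (- 2) * \<gamma> powr (- 1) * ln (real n))
         \<longrightarrow>
         1 / sqrt d * measure_pmf.expectation G (\<lambda>E. sigma_min (biadjacency n m E - EA))
           \<ge> sqrt ((1 - sqrt \<gamma>) * (\<rho>tmin - sqrt \<gamma>)) - K * \<delta> powr (1 / 4) \<and>
         measure_pmf.prob G
             {E. 1 / sqrt d * sigma_min (biadjacency n m E - EA)
                 \<ge> sqrt ((1 - sqrt \<gamma>) * (\<rho>tmin - sqrt \<gamma>)) - K * \<delta> powr (1 / 4)}
           \<ge> 1 - K * real n powr (- 3)))))"
proof (rule exI[of _ "4::real"], intro conjI allI impI)
  show "0 < (4::real)" by simp
  fix c0 :: real assume c0: "0 < c0 \<and> c0 < 1"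
  obtain N :: nat where N: "\<And>n. n \<ge> N \<Longrightarrow> 16 * ln (real n) ^ 3 * exp (8 * sqrt (ln (real n))) \<le> real n powr (1 / 10)"
    using eventually_log_small unfolding eventually_sequentially by auto
  \<comment> \<open>Threshold for \<open>x\<close>. Below it, \<open>15 * x \<le> c0^2\<close> holds
    and \<open>n\<close> exceeds \<open>N\<close>; from it on, the term \<open>1 / x0\<close> in
    \<open>K\<close> makes \<open>K * x\<close> at least 1 and both claims trivial.\<close>
  define x0 where "x0 = min (c0\<^sup>2 / 15) (1 / (real N + 3))"
  have x0: "0 < x0" using c0 by (simp add: x0_def)
  define K1 K2 where "K1 = 20 / c0\<^sup>2" and "K2 = 4 * exp 4 / c0 + 3"
  have K12: "0 < K1" "0 < K2" using c0 by (auto simp: K1_def K2_def add_pos_pos)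
  define K where "K = K1 + K2 + 1 / x0"
  have K: "0 < K" "K1 \<le> K" "K2 \<le> K" "K1 + K2 \<le> K" using x0 K12 by (auto simp: K_def add_pos_pos)
  show "\<exists>K>0. \<forall>n m p \<delta>.
      (let G = inhom_er_bipartite n m p;
           EA = expected_biadjacency n m p;
           d = deg_max n m p;
           \<rho>max = rho_max n m p;
           \<rho>tmax = rho_tilde_max n m p;
           \<rho>tmin = rho_tilde_min n m p;
           \<gamma> = aspect_gamma n m p
       in
         n \<ge> m \<and> m \<ge> 1 \<and> (\<forall>i<n. \<forall>j<m. 0 \<le> p i j \<and> p i j \<le> 1) \<and> 0 < \<delta> \<and> \<delta> < 1 \<and>
         \<gamma> \<ge> c0 \<and> d \<ge> \<gamma> powr (- 1 / 2) \<and>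
         \<rho>tmax \<ge> \<rho>max \<and> \<rho>tmin > sqrt \<gamma> \<and> min (1 - sqrt \<gamma>) (\<rho>tmin - sqrt \<gamma>) \<ge> c0 \<and>
         d powr (7 / 2) * prob_max n m p \<le> real n powr (- 1 / 10) \<and>
         d \<ge> 4 * max (\<delta> powr (- 1 / 2)) (\<delta> powr (- 2) * \<gamma> powr (- 1) * ln (real n))
         \<longrightarrow>
         1 / sqrt d * measure_pmf.expectation G (\<lambda>E. sigma_min (biadjacency n m E - EA))
           \<ge> sqrt ((1 - sqrt \<gamma>) * (\<rho>tmin - sqrt \<gamma>)) - K * \<delta> powr (1 / 4) \<and>
         measure_pmf.prob G
             {E. 1 / sqrt d * sigma_min (biadjacency n m E - EA)
                 \<ge> sqrt ((1 - sqrt \<gamma>) * (\<rho>tmin - sqrt \<gamma>)) - K * \<delta> powr (1 / 4)}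
           \<ge> 1 - K * real n powr (- 3))"
    unfolding Let_def
  proof (intro exI[of _ K] conjI[OF K(1)] allI impI, elim conjE)
    fix n m :: nat and p :: "nat \<Rightarrow> nat \<Rightarrow> real" and \<delta> :: real
    define d \<gamma> \<rho> q x where "d = deg_max n m p" and "\<gamma> = aspect_gamma n m p" and "\<rho> = rho_tilde_min n m p"
      and "q = sqrt \<gamma>" and "x = \<delta> powr (1 / 4)"
    let ?G = "inhom_er_bipartite n m p"
    let ?\<sigma> = "\<lambda>E. sigma_min (biadjacency n m E - expected_biadjacency n m p)"
    assume "m \<le> n" "1 \<le> m" "\<forall>i<n. \<forall>j<m. 0 \<le> p i j \<and> p i j \<le> 1" and \<delta>: "0 < \<delta>" "\<delta> < 1"
      and "c0 \<le> aspect_gamma n m p" "aspect_gamma n m p powr (- 1 / 2) \<le> deg_max n m p"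
      and rho: "rho_max n m p \<le> rho_tilde_max n m p"
      and "sqrt (aspect_gamma n m p) < rho_tilde_min n m p"
      and "c0 \<le> min (1 - sqrt (aspect_gamma n m p)) (rho_tilde_min n m p - sqrt (aspect_gamma n m p))"
      and "deg_max n m p powr (7 / 2) * prob_max n m p \<le> real n powr (- 1 / 10)"
      and "4 * max (\<delta> powr (- 1 / 2)) (\<delta> powr (- 2) * aspect_gamma n m p powr (- 1) * ln (real n)) \<le> deg_max n m p"
    hence nm: "m \<le> n" "1 \<le> m" and p: "\<And>i j. i < n \<Longrightarrow> j < m \<Longrightarrow> 0 \<le> p i j \<and> p i j \<le> 1"
      and \<gamma>: "c0 \<le> \<gamma>" and dq: "\<gamma> powr (- 1 / 2) \<le> d" and q1: "c0 \<le> 1 - q" "c0 \<le> \<rho> - q"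
      and sparse: "d powr (7 / 2) * prob_max n m p \<le> real n powr (- 1 / 10)"
      and d1: "4 * \<delta> powr (- 1 / 2) \<le> d" and d2: "4 * (\<delta> powr (- 2) * \<gamma> powr (- 1) * ln n) \<le> d"
      unfolding d_def \<gamma>_def \<rho>_def q_def by auto
    have n: "1 \<le> real n" using nm by simp
    have \<gamma>0: "0 < \<gamma>" using \<gamma> c0 by simp
    have q0: "0 < q" using \<gamma>0 by (simp add: q_def)
    have q2: "q\<^sup>2 = \<gamma>" using \<gamma>0 by (simp add: q_def)
    have x: "0 < x" "x \<le> 1" using \<delta> by (auto simp: x_def powr_le1)
    have x4: "\<delta> = x ^ 4" using \<delta> by (simp add: x_def powr_power)
    have d0: "0 < d" using dq \<gamma>0 by (smt (verit) powr_gt_zero)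
    have nonempty: "{..<n} \<noteq> {}" "{..<m} \<noteq> {}" using nm by (auto simp: lessThan_empty_iff)
    \<comment> \<open>The comparison of the two ratios forces the columns to realize
      \<open>d\<close>, so \<open>\<gamma> * d\<close> is the maximal row sum.\<close>
    have cr: "row_sum_max n m p \<le> col_sum_max n m p" "d = col_sum_max n m p"
      using rho d0 unfolding rho_max_def rho_tilde_max_def d_def[symmetric]
      by (auto simp: divide_le_cancel d_def deg_max_def)
    have \<gamma>d: "\<gamma> * d = row_sum_max n m p"
      using rho d0 by (simp add: \<gamma>_def aspect_gamma_def rho_max_def d_def)
    have row: "(\<Sum>j<m. p i j) \<le> q\<^sup>2 * d" if "i < n" for i
      unfolding q2 \<gamma>d row_sum_max_def using that by (intro Max_ge) auto
    have col: "(\<Sum>i<n. p i j) \<le> d" if "j < m" for j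
      unfolding cr(2) col_sum_max_def using that by (intro Max_ge) auto
    have \<rho>d: "\<rho> * d = Min ((\<lambda>j. \<Sum>i<n. p i j * (1 - p i j)) ` {..<m})"
      using d0 by (simp add: \<rho>_def rho_tilde_min_def d_def)
    have col_min: "\<rho> * d \<le> (\<Sum>i<n. p i j * (1 - p i j))" if "j < m" for j
      unfolding \<rho>d using that by (intro Min_le) auto
    have P: "p i j \<le> prob_max n m p" if "i < n" "j < m" for i j
      unfolding prob_max_def using that by (intro Max_ge) (auto intro!: rev_image_eqI[of "(i, j)"])
    have P0: "0 \<le> prob_max n m p" using P[of 0 0] p[of 0 0] nm by auto
    have \<rho>1: "\<rho> \<le> 1"
    proof -
      have "\<rho> * d \<le> (\<Sum>i<n. p i 0 * (1 - p i 0))" using nm by (intro col_min) auto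
      also have "\<dots> \<le> (\<Sum>i<n. p i 0)" using p nm by (intro sum_mono) (auto simp: mult_left_le)
      also have "\<dots> \<le> 1 * d" using col[of 0] nm by simp
      finally show ?thesis using d0 by simp
    qed
    have cq: "c0 \<le> q"
    proof -
      have "c0\<^sup>2 \<le> c0 * 1" unfolding power2_eq_square using c0 by (intro mult_left_mono) auto
      hence "c0\<^sup>2 \<le> \<gamma>" using \<gamma> by simp
      thus ?thesis unfolding q_def by (rule real_le_rsqrt)
    qed
    define S where "S = sqrt ((1 - q) * (\<rho> - q))"
    have S1: "S \<le> 1" unfolding S_def using q0 q1 \<rho>1 c0 by (auto intro!: mult_le_one)
    have \<sigma>0: "0 \<le> ?\<sigma> E" for E by (rule sigma_min_nonneg[OF nm(2)])
    have E\<sigma>0: "0 \<le> measure_pmf.expectation ?G ?\<sigma>" by (intro integral_nonneg_AE) (use \<sigma>0 in auto)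
    have "S - K * x \<le> 1 / sqrt d * measure_pmf.expectation ?G ?\<sigma> \<and>
        1 - K * real n powr (- 3) \<le> measure_pmf.prob ?G {E. S - K * x \<le> 1 / sqrt d * ?\<sigma> E}"
    proof (cases "x < x0")
      case False
      have "1 = 1 / x0 * x0" using x0 by simp
      also have "\<dots> \<le> K * x" using False x0 K K12 by (intro mult_mono) (auto simp: K_def)
      finally have Kx: "S - K * x \<le> 0" using S1 by simp
      have "S - K * x \<le> 1 / sqrt d * ?\<sigma> E" for E
        by (rule order_trans[OF Kx]) (use \<sigma>0[of E] d0 in auto)
      hence "{E. S - K * x \<le> 1 / sqrt d * ?\<sigma> E} = UNIV" by auto
      moreover have "0 \<le> 1 / sqrt d * measure_pmf.expectation ?G ?\<sigma>" using E\<sigma>0 d0 by auto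
      ultimately show ?thesis using Kx K(1) by auto
    next
      case True
      have x15: "15 * x \<le> c0\<^sup>2" using True by (simp add: x0_def)
      have xN: "x * (real N + 3) < 1" using True by (simp add: x0_def less_divide_eq)
      have dx: "4 / x\<^sup>2 \<le> d"
      proof -
        have "\<delta> powr (- 1 / 2) = 1 / x\<^sup>2"
          using \<delta> by (simp add: x_def powr_power powr_minus divide_simps)
        thus ?thesis using d1 by simp
      qed
      have "1 * 1 \<le> 1 / x * (1 / x)" using x by (intro mult_mono) auto
      hence ix: "1 \<le> 1 / x\<^sup>2" by (simp add: power2_eq_square)
      have dge1: "1 \<le> d" using dx ix by simp
      \<comment> \<open>Together with \<open>4 / x^2 \<le> d\<close> this yields
        \<open>1 / x \<le> n\<close>: a small \<open>x\<close> forces a large \<open>n\<close>, so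
        the asymptotic estimate needs no separate hypothesis on \<open>n\<close>.\<close>
      have nd: "d \<le> n"
      proof -
        have "d \<le> (\<Sum>i<n. prob_max n m p)"
        proof -
          have "d \<in> (\<lambda>j. \<Sum>i<n. p i j) ` {..<m}"
            unfolding cr(2) col_sum_max_def using nonempty by (intro Max_in) auto
          then obtain j where j: "j < m" "d = (\<Sum>i<n. p i j)" by auto
          show ?thesis unfolding j(2) using P j(1) by (intro sum_mono) auto
        qed
        hence dn: "d \<le> n * prob_max n m p" by simp
        have "1 \<le> d powr (7 / 2)" using dge1 by (simp add: ge_one_powr_ge_zero)
        hence "1 * prob_max n m p \<le> d powr (7 / 2) * prob_max n m p" using P0 by (intro mult_right_mono)
        also have "\<dots> \<le> real n powr (- 1 / 10)" by (rule sparse)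
        also have "\<dots> \<le> real n powr 0" using n by (intro powr_mono) auto
        finally have "prob_max n m p \<le> 1" using n by simp
        hence "real n * prob_max n m p \<le> real n * 1" by (intro mult_left_mono) auto
        thus ?thesis using dn by simp
      qed
      have "1 / x \<le> 1 / x * (1 / x)" using x by (simp add: le_divide_eq)
      hence "1 / x \<le> 1 / x\<^sup>2" by (simp add: power2_eq_square)
      also have "\<dots> \<le> 4 / x\<^sup>2" by (intro divide_right_mono) auto
      finally have nx: "1 / x \<le> n" using dx nd by linarith
      have "real N + 3 < 1 / x" using xN x by (simp add: field_simps)
      hence nN: "real N + 3 < real n" using nx by linarith
      have ln1: "1 \<le> ln (real n)"
      proof -
        have "exp 1 \<le> real n" using exp_le nN by linarith
        thus ?thesis using n by (simp add: ln_ge_iff)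
      qed
      have qd: "1 \<le> q * d"
      proof -
        have "\<gamma> powr (- 1 / 2) = inverse (\<gamma> powr (1 / 2))" using powr_minus[of \<gamma> "1 / 2"] by simp
        also have "\<gamma> powr (1 / 2) = q" unfolding q_def using \<gamma>0 by (intro powr_half_sqrt) auto
        finally have "\<gamma> powr (- 1 / 2) = 1 / q" by (simp add: inverse_eq_divide)
        hence "1 / q \<le> d" using dq by simp
        thus ?thesis using q0 by (simp add: field_simps)
      qed
      \<comment> \<open>The constant 4 becomes the exponent in the single failure probabilities
        \<open>n^(-4)\<close>, one power of which is spent on the union bound.\<close>
      have dln: "4 * ln n \<le> \<delta>\<^sup>2 * (q * d)"
      proof -
        have "\<delta> powr (- 2) * \<gamma> powr (- 1) = 1 / (\<delta>\<^sup>2 * \<gamma>)"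
          using \<delta> \<gamma>0 by (simp add: powr_minus powr_numeral divide_simps)
        hence "4 * (1 / (\<delta>\<^sup>2 * \<gamma>) * ln n) \<le> d" using d2 by simp
        hence "4 * ln n \<le> \<delta>\<^sup>2 * (\<gamma> * d)" using \<delta> \<gamma>0 by (simp add: field_simps)
        also have "\<gamma> * d \<le> q * d"
          using q0 q1 c0 d0 unfolding q2[symmetric] power2_eq_square by (intro mult_right_mono mult_left_le) auto
        finally show ?thesis using \<delta> by simp
      qed
      have \<delta>x: "\<delta> \<le> x" unfolding x4 using power_decreasing[of 1 4 x] x by simp
      have tail: "1 - K2 * real n powr (- 3) \<le> measure_pmf.prob ?G {E. S - K1 * x \<le> 1 / sqrt d * ?\<sigma> E}"
        unfolding K1_def K2_def S_def
      proof (rule sigma_min_tail[OF p nm P P0 _ cq _ _ \<rho>1 qd row col col_min x(1) x15 \<delta>(1) \<delta>x _ dln sparse])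
        show "1 / x\<^sup>2 \<le> d" using dx ix by (intro order_trans[OF _ dx] divide_right_mono) auto
        show "16 * ln (real n) ^ 3 * exp (8 * sqrt (ln (real n))) \<le> real n powr (1 / 10)"
          using nN by (intro N) linarith
      qed (use c0 q1 ln1 in auto)
      have sub: "S - K * x \<le> S - K1 * x" using K x by (simp add: mult_right_mono)
      have "1 - K * real n powr (- 3) \<le> 1 - K2 * real n powr (- 3)" using K by (simp add: mult_right_mono)
      also have "\<dots> \<le> measure_pmf.prob ?G {E. S - K1 * x \<le> 1 / sqrt d * ?\<sigma> E}" by (rule tail)
      also have "\<dots> \<le> measure_pmf.prob ?G {E. S - K * x \<le> 1 / sqrt d * ?\<sigma> E}"
        using sub by (intro measure_pmf.finite_measure_mono) auto
      finally have prob: "1 - K * real n powr (- 3) \<le> measure_pmf.prob ?G {E. S - K * x \<le> 1 / sqrt d * ?\<sigma> E}" .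
      have "S - K * x \<le> 1 / sqrt d * measure_pmf.expectation ?G ?\<sigma>"
      proof (cases "S - K1 * x \<le> 0")
        case True
        have "0 \<le> 1 / sqrt d * measure_pmf.expectation ?G ?\<sigma>" using E\<sigma>0 d0 by auto
        thus ?thesis using True sub by linarith
      next
        case False
        \<comment> \<open>Markov's inequality read backwards: the nonnegative variable has
          expectation at least \<open>T\<close> times the probability that it reaches
          \<open>T\<close>.\<close>
        define T where "T = sqrt d * (S - K1 * x)"
        have T0: "0 < T" using False d0 by (simp add: T_def)
        have "{E. S - K1 * x \<le> 1 / sqrt d * ?\<sigma> E} = {E \<in> space ?G. T \<le> ?\<sigma> E}"
          using d0 by (auto simp: T_def field_simps)
        hence "measure_pmf.prob ?G {E. S - K1 * x \<le> 1 / sqrt d * ?\<sigma> E}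
            \<le> measure_pmf.expectation ?G ?\<sigma> / T"
          using integral_Markov_inequality_measure[OF integrable_inhom_er_bipartite, of "{}" n m p ?\<sigma> T] \<sigma>0 T0 by simp
        hence "1 - K2 * real n powr (- 3) \<le> measure_pmf.expectation ?G ?\<sigma> / T" using tail by linarith
        hence "(1 - K2 * real n powr (- 3)) * T \<le> measure_pmf.expectation ?G ?\<sigma>"
          using T0 by (simp add: le_divide_eq)
        hence "1 / sqrt d * ((1 - K2 * real n powr (- 3)) * T) \<le> 1 / sqrt d * measure_pmf.expectation ?G ?\<sigma>"
          using d0 by (intro mult_left_mono) auto
        moreover have "1 / sqrt d * ((1 - K2 * real n powr (- 3)) * T) = (1 - K2 * real n powr (- 3)) * (S - K1 * x)"
          using d0 by (simp add: T_def)
        moreover have "S - K * x \<le> (1 - K2 * real n powr (- 3)) * (S - K1 * x)"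
        proof -
          \<comment> \<open>The failure probability is itself at most a multiple of
            \<open>x\<close>, because \<open>1 / n \<le> x\<close>; it can therefore be absorbed
            into the error term \<open>K * x\<close>.\<close>
          have "real n powr (- 3) \<le> real n powr (- 1)" using n by (intro powr_mono) auto
          also have "\<dots> = 1 / n" using n by (simp add: powr_minus inverse_eq_divide)
          also have "\<dots> \<le> x" using nx x n by (simp add: field_simps)
          finally have "real n powr (- 3) \<le> x" .
          moreover have "S - K1 * x \<le> 1" using S1 mult_pos_pos[OF K12(1) x(1)] by linarith
          ultimately have "K2 * real n powr (- 3) * (S - K1 * x) \<le> K2 * x * 1"
            using False K12 x by (intro mult_mono) auto
          moreover have "(K1 + K2) * x \<le> K * x" using K x by (intro mult_right_mono) auto
          ultimately show ?thesis by (simp add: algebra_simps)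
        qed
        ultimately show ?thesis by linarith
      qed
      with prob show ?thesis by blast
    qed
    thus "sqrt ((1 - sqrt (aspect_gamma n m p)) * (rho_tilde_min n m p - sqrt (aspect_gamma n m p))) - K * \<delta> powr (1 / 4)
          \<le> 1 / sqrt (deg_max n m p) * measure_pmf.expectation ?G ?\<sigma> \<and>
        1 - K * real n powr (- 3) \<le> measure_pmf.prob ?G
          {E. sqrt ((1 - sqrt (aspect_gamma n m p)) * (rho_tilde_min n m p - sqrt (aspect_gamma n m p))) - K * \<delta> powr (1 / 4)
            \<le> 1 / sqrt (deg_max n m p) * ?\<sigma> E}"
      unfolding S_def q_def x_def \<gamma>_def \<rho>_def d_def .
  qed
qed

end
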